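(* Let $0<\beta<3$, $p=\frac{3+\beta}{3}$ and $\alpha\ge 0$. Then for every $\mu>0$ there is no ground state at mass $\mu$; that is, the functional $E$ restricted to $X_\mu$ does not attain its infimum $\inf_{v\in X_\mu}E(v)$.
   Context: All function spaces are over $\mathbb{R}^3$ and consist of complex-valued functions. The Riesz potential is $$I_\beta(x)=\frac{\Gamma\left(\frac{3-\beta}{2}\right)}{\Gamma(\beta/2)\,\pi^{3/2}\,2^\beta}\,\frac{1}{|x|^{3-\beta}},\qquad x\in\mathbb{R}^3\setminus\{0\}.$$ For $\lambda>0$, $\mathcal{G}_\lambda(x)=\frac{1}{4\pi|x|}e^{-\sqrt\lambda|x|}$. Let $$X=\{\phi+q\,\mathcal{G}_\lambda:(\phi,q,\lambda)\in H^1\times\mathbb{C}\times(0,\infty)\}\subset L^2,\qquad X_\mu=\{v\in X:\|v\|_{L^2}^2=\mu\}.$$ For $u\in X$ the charge $q$ is uniquely determined by $u$, and for each $\lambda>0$ there is a unique $\phi\in H^1$ with $u=\phi+q\,\mathcal{G}_\lambda$. The quadratic form $Q:X\to\mathbb{R}$, $$Q(u)=\|\nabla\phi\|_{L^2}^2+\lambda\big(\|\phi\|_{L^2}^2-\|u\|_{L^2}^2\big)+\Big(\alpha+\frac{\sqrt\lambda}{4\pi}\Big)|q|^2\qquad (u=\phi+q\,\mathcal{G}_\lambda),$$ does not depend on the choice of $\lambda$. Let $N(u)=\int_{\mathbb{R}^3}(I_\beta*|u|^p)|u|^p$, which is finite on $X$ when $\frac{3+\beta}{3}\le p<\frac{3+\beta}{2}$,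 and let $E:X\to\mathbb{R}$, $E(u)=\frac12Q(u)-\frac1{2p}N(u)$. A ground state at mass $\mu$ (of the equation $i\partial_t\psi=-\Delta\psi+\alpha\delta_0\psi-(I_\beta*|\psi|^p)|\psi|^{p-2}\psi$) is by definition a minimizer of $E|_{X_\mu}$. *)

theory Defs
  imports "HOL-Analysis.Analysis"
begin

text \<open>
  Elements of Lebesgue and Sobolev spaces are represented by Borel functions. The sets \<open>L2\<close>, \<open>H1\<close>
  and \<open>X_space\<close> below are closed under Borel modifications on null sets, so identities between
  functions (such as \<open>u = \<phi> + q G\<^sub>\<lambda>\<close>) may be stated pointwise, and the functionals take the same
  value on representatives of the same class.
\<close>

definition L2 :: "(real^3 \<Rightarrow> 'b::euclidean_space) set" where
  "L2 = {f. f \<in> borel_measurable lborel \<and> integrable lborel (\<lambda>x. (norm (f x))\<^sup>2)}"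

definition L2_norm :: "(real^3 \<Rightarrow> 'b::euclidean_space) \<Rightarrow> real" where
  "L2_norm f = sqrt (\<integral>x. (norm (f x))\<^sup>2 \<partial>lborel)"

definition partial :: "3 \<Rightarrow> (real^3 \<Rightarrow> complex) \<Rightarrow> real^3 \<Rightarrow> complex" where
  "partial i f x = frechet_derivative f (at x) (axis i 1)"

primrec C_k :: "nat \<Rightarrow> (real^3 \<Rightarrow> complex) \<Rightarrow> bool" where
  "C_k 0 f \<longleftrightarrow> continuous_on UNIV f"
| "C_k (Suc k) f \<longleftrightarrow> (\<forall>x. f differentiable (at x)) \<and> (\<forall>i. C_k k (partial i f))"

definition test_function :: "(real^3 \<Rightarrow> complex) \<Rightarrow> bool" where
  "test_function \<eta> \<longleftrightarrow> (\<forall>k. C_k k \<eta>) \<and> compact (closure {x. \<eta> x \<noteq> 0})"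

definition weak_gradient :: "(real^3 \<Rightarrow> complex) \<Rightarrow> (real^3 \<Rightarrow> complex^3) \<Rightarrow> bool" where
  "weak_gradient u g \<longleftrightarrow>
    (\<forall>\<eta> i. test_function \<eta> \<longrightarrow>
      (\<integral>x. u x * partial i \<eta> x \<partial>lborel) = - (\<integral>x. g x $ i * \<eta> x \<partial>lborel))"

definition H1 :: "(real^3 \<Rightarrow> complex) set" where
  "H1 = {u \<in> L2. \<exists>g\<in>L2. weak_gradient u g}"

text \<open>Only determined up to null sets, hence the choice operator.\<close>

definition grad :: "(real^3 \<Rightarrow> complex) \<Rightarrow> real^3 \<Rightarrow> complex^3" where
  "grad u = (SOME g. g \<in> L2 \<and> weak_gradient u g)"

text \<open>The kernels get the irrelevant value \<open>0\<close> at the origin, by the convention \<open>a / 0 = 0\<close>.\<close>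

definition riesz_potential :: "real \<Rightarrow> real^3 \<Rightarrow> real" where
  "riesz_potential \<beta> x =
    Gamma ((3 - \<beta>) / 2) / (Gamma (\<beta> / 2) * pi powr (3/2) * 2 powr \<beta>) * (1 / norm x powr (3 - \<beta>))"

definition green :: "real \<Rightarrow> real^3 \<Rightarrow> complex" where
  "green lam x = complex_of_real (1 / (4 * pi * norm x) * exp (- sqrt lam * norm x))"

definition decomposition ::
    "(real^3 \<Rightarrow> complex) \<Rightarrow> (real^3 \<Rightarrow> complex) \<Rightarrow> complex \<Rightarrow> real \<Rightarrow> bool" where
  "decomposition u \<phi> q lam \<longleftrightarrow> \<phi> \<in> H1 \<and> 0 < lam \<and> u = (\<lambda>x. \<phi> x + q * green lam x)"

definition X_space :: "(real^3 \<Rightarrow> complex) set" where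
  "X_space = {u. \<exists>\<phi> q lam. decomposition u \<phi> q lam}"

definition X_mass :: "real \<Rightarrow> (real^3 \<Rightarrow> complex) set" where
  "X_mass \<mu> = {v \<in> X_space. (L2_norm v)\<^sup>2 = \<mu>}"

text \<open>The value of the form is the same for all decompositions of \<open>u\<close>.\<close>

definition Q_form :: "real \<Rightarrow> (real^3 \<Rightarrow> complex) \<Rightarrow> real" where
  "Q_form \<alpha> u =
    (THE r. \<exists>\<phi> q lam. decomposition u \<phi> q lam \<and>
      r = (L2_norm (grad \<phi>))\<^sup>2 + lam * ((L2_norm \<phi>)\<^sup>2 - (L2_norm u)\<^sup>2)
          + (\<alpha> + sqrt lam / (4 * pi)) * (cmod q)\<^sup>2)"

definition convolution :: "(real^3 \<Rightarrow> real) \<Rightarrow> (real^3 \<Rightarrow> real) \<Rightarrow> real^3 \<Rightarrow> real" where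
  "convolution f g x = (\<integral>y. f (x - y) * g y \<partial>lborel)"

definition N_functional :: "real \<Rightarrow> real \<Rightarrow> (real^3 \<Rightarrow> complex) \<Rightarrow> real" where
  "N_functional \<beta> p u =
    (\<integral>x. convolution (riesz_potential \<beta>) (\<lambda>y. cmod (u y) powr p) x * cmod (u x) powr p \<partial>lborel)"

definition energy :: "real \<Rightarrow> real \<Rightarrow> real \<Rightarrow> (real^3 \<Rightarrow> complex) \<Rightarrow> real" where
  "energy \<alpha> \<beta> p u = 1/2 * Q_form \<alpha> u - 1 / (2 * p) * N_functional \<beta> p u"

definition ground_state ::
    "real \<Rightarrow> real \<Rightarrow> real \<Rightarrow> real \<Rightarrow> (real^3 \<Rightarrow> complex) \<Rightarrow> bool" where
  "ground_state \<alpha> \<beta> p \<mu> u \<longleftrightarrow> u \<in> X_mass \<mu> \<and> (\<forall>v\<in>X_mass \<mu>. energy \<alpha> \<beta> p u \<le> energy \<alpha> \<beta> p v)"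

end

theory Submission
  imports Defs "HOL-Real_Asymp.Real_Asymp"
begin

text \<open>
  The dilation \<open>u\<^sub>t = t powr (3/2) * u (t x)\<close> preserves the mass, and at \<open>p = (3 + \<beta>) / 3\<close> also \<open>N\<close>,
  while it turns \<open>Q u = S + \<alpha> |q|\<^sup>2\<close> into \<open>t\<^sup>2 S + \<alpha> t |q|\<^sup>2\<close>, where \<open>S\<close> is the value of the form
  for \<open>\<alpha> = 0\<close>. As soon as \<open>S > 0\<close>, taking \<open>t = 1/2\<close> strictly lowers the energy, so no minimizer exists.

  Positivity of \<open>S\<close> comes from its independence of \<open>\<lambda>\<close>. If \<open>q \<noteq> 0\<close>, then \<open>S\<close> is at least
  \<open>\<surd>\<lambda> |q|\<^sup>2 / (4 \<pi>) - \<lambda> \<mu>\<close>, which is positive for small \<open>\<lambda>\<close>; if \<open>q = 0\<close>, then \<open>S\<close> is the Dirichlet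
  integral of \<open>u\<close>, and a square-integrable function with vanishing weak gradient is zero.

  Independence of \<open>\<lambda>\<close> and uniqueness of \<open>q\<close> rest on the weak form of
  \<open>- \<Delta> (G\<^sub>a - G\<^sub>b) = b\<^sup>2 G\<^sub>b - a\<^sup>2 G\<^sub>a\<close> for \<open>G\<^sub>a = exp (- a |x|) / (4 \<pi> |x|)\<close>, tested against an
  arbitrary \<open>H\<^sup>1\<close> function, and on \<open>\<integral> G\<^sub>a G\<^sub>b = 1 / (4 \<pi> (a + b))\<close>.
\<close>

section \<open>Integrals over Euclidean space\<close>

text \<open>A weak gradient may be tested only against smooth compactly supported functions, whereas
  the computation needs to test it against the gradient of G_a - G_b, a field that decays but is not
  smooth at the origin and has unbounded support. It is therefore approximated by test fields: x
  times the radial profile at a regularised radius, times a cutoff. The limit exists because the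
  leading singularities of G_a and G_b agree: the gradient of the difference is bounded with
  exponential decay, and its divergence is at worst of order 1 / |x|, which is locally
  square-integrable in dimension three. The resulting identity serves three times: for an arbitrary
  regular part \<phi>, to compare the form at two values of \<lambda>; for \<phi> = G_a - G_b
  itself, to compute its Dirichlet integral; and for a multiple of a single kernel supposed to lie
  in H^1, to show that the multiple is zero. In the final step the sign of \<alpha> matters: for
  \<alpha> \<ge> 0 and S > 0 the function t^2 S + \<alpha> t |q|^2 is strictly increasing on t > 0,
  so any t below 1 would do as well as 1/2.\<close>

lemma nn_integral_exp_over_norm_square:
  fixes c :: real
  assumes c: "0 < c"
  shows "(\<integral>\<^sup>+x. ennreal (exp (- c * norm x) / (norm x)\<^sup>2) \<partial>(lborel :: (real^3) measure)) = ennreal (4 * pi / c)"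
proof -
  \<comment> \<open>\<open>h\<close> is minus the derivative of
    \<open>exp (- c * s) / s\<^sup>2\<close>, so the integrand at radius r is the integral of
    \<open>h\<close> over s \<ge> r. After exchanging the integrals only volumes of balls remain,
    and no polar coordinates are involved.\<close>
  define h where "h s = (c / s\<^sup>2 + 2 / s ^ 3) * exp (- c * s)" for s :: real
  have [measurable]: "h \<in> borel_measurable borel"
    unfolding h_def[abs_def] by measurable
  have layer: "ennreal (exp (- c * r) / r\<^sup>2) = (\<integral>\<^sup>+s. ennreal (h s) * indicator {r..} s \<partial>lborel)" if r: "r > 0" for r
  proof -
    have "(\<integral>\<^sup>+s. ennreal (h s) * indicator {r..} s \<partial>lborel) = ennreal (0 - (- exp (- c * r) / r\<^sup>2))"
    proof (rule nn_integral_FTC_atLeast)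
      show "((\<lambda>s. - exp (- c * s) / s\<^sup>2) has_real_derivative h s) (at s)" if "r \<le> s" for s
      proof -
        have "s > 0" using that r by simp
        then show ?thesis unfolding h_def
          by (auto intro!: derivative_eq_intros simp: field_simps power2_eq_square power3_eq_cube)
      qed
      show "0 \<le> h s" if "r \<le> s" for s
        unfolding h_def using that r c by (intro mult_nonneg_nonneg add_nonneg_nonneg) auto
      show "((\<lambda>s. - exp (- c * s) / s\<^sup>2) \<longlongrightarrow> 0) at_top"
        using c by real_asymp
    qed simp
    then show ?thesis by simp
  qed
  have "(\<integral>\<^sup>+x. ennreal (exp (- c * norm x) / (norm x)\<^sup>2) \<partial>(lborel :: (real^3) measure))
      = (\<integral>\<^sup>+x. (\<integral>\<^sup>+s. ennreal (h s) * indicator {norm x..} s \<partial>lborel) \<partial>(lborel :: (real^3) measure))"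
    by (intro nn_integral_cong_AE, rule AE_mp[OF AE_lborel_singleton[of 0]])
       (use layer in \<open>auto intro!: AE_I2\<close>)
  also have "\<dots> = (\<integral>\<^sup>+x. (\<integral>\<^sup>+s. ennreal (h s) * indicator {p. norm (fst p) \<le> snd p} (x, s) \<partial>lborel) \<partial>(lborel :: (real^3) measure))"
    by (intro nn_integral_cong) (auto simp: indicator_def)
  also have "\<dots> = (\<integral>\<^sup>+s. (\<integral>\<^sup>+x. ennreal (h s) * indicator {p. norm (fst p) \<le> snd p} (x, s) \<partial>(lborel :: (real^3) measure)) \<partial>lborel)"
  proof (intro lborel_pair.Fubini'[symmetric])
    have "{p::(real^3) \<times> real. norm (fst p) \<le> snd p} \<in> sets borel"
      by (intro borel_closed closed_Collect_le continuous_intros)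
    then have [measurable]: "{p::(real^3) \<times> real. norm (fst p) \<le> snd p} \<in> sets (lborel \<Otimes>\<^sub>M lborel)"
      by (metis lborel_prod sets_lborel)
    show "(\<lambda>(x, s). ennreal (h s) * indicator {p. norm (fst p) \<le> snd p} (x, s)) \<in> borel_measurable ((lborel :: (real^3) measure) \<Otimes>\<^sub>M lborel)"
      by measurable
  qed
  also have "\<dots> = (\<integral>\<^sup>+s. ennreal (4 / 3 * pi * (c * s + 2) * exp (- c * s)) * indicator {0..} s \<partial>lborel)"
  proof (intro nn_integral_cong_AE, rule AE_mp[OF AE_lborel_singleton[of 0]], intro AE_I2 impI)
    \<comment> \<open>The origin has to be excluded: \<open>h 0\<close> is 0 by the convention for
      division, while the right-hand integrand is positive there.\<close>
    fix s :: real assume s0: "s \<noteq> 0"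
    have eq: "(\<integral>\<^sup>+x. ennreal (h s) * indicator {p. norm (fst p) \<le> snd p} (x, s) \<partial>(lborel :: (real^3) measure))
       = ennreal (h s) * emeasure lborel (cball (0::real^3) s)"
      by (subst nn_integral_cmult_indicator[symmetric]) (auto intro!: nn_integral_cong simp: indicator_def)
    show "(\<integral>\<^sup>+x. ennreal (h s) * indicator {p. norm (fst p) \<le> snd p} (x, s) \<partial>(lborel :: (real^3) measure))
       = ennreal (4 / 3 * pi * (c * s + 2) * exp (- c * s)) * indicator {0..} s"
    proof (cases "s > 0")
      case True
      have eq': "h s * s ^ 3 = (c * s + 2) * exp (- c * s)"
        unfolding h_def using True by (simp add: divide_simps power2_eq_square power3_eq_cube)
      have "h s \<ge> 0" unfolding h_def using True c
        by (intro mult_nonneg_nonneg add_nonneg_nonneg) auto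
      moreover have "emeasure lborel (cball (0::real^3) s) = ennreal (4 / 3 * pi * s ^ 3)"
        using True by (simp add: emeasure_cball unit_ball_vol_3)
      ultimately have "ennreal (h s) * emeasure lborel (cball (0::real^3) s) = ennreal (h s * (4 / 3 * pi * s ^ 3))"
        by (simp only: ennreal_mult')
      also have "h s * (4 / 3 * pi * s ^ 3) = 4 / 3 * pi * (h s * s ^ 3)" by (simp only: mult_ac)
      also have "\<dots> = 4 / 3 * pi * (c * s + 2) * exp (- c * s)" unfolding eq' by (simp only: mult_ac)
      finally show ?thesis using True unfolding eq by simp
    next
      case False
      then show ?thesis using s0 unfolding eq by (simp add: indicator_def)
    qed
  qed
  also have "\<dots> = ennreal (0 - (- (4 / 3 * pi * (0 + 3 / c) * exp (- c * 0))))"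
  proof (rule nn_integral_FTC_atLeast[where F="\<lambda>s. - (4 / 3 * pi * (s + 3 / c) * exp (- c * s))"])
    show "((\<lambda>s. - (4 / 3 * pi * (s + 3 / c) * exp (- c * s))) has_real_derivative
         4 / 3 * pi * (c * s + 2) * exp (- c * s)) (at s)" for s
      using c by (auto intro!: derivative_eq_intros simp: field_simps)
    show "((\<lambda>s. - (4 / 3 * pi * (s + 3 / c) * exp (- c * s))) \<longlongrightarrow> 0) at_top"
      using c by real_asymp
    show "0 \<le> 4 / 3 * pi * (c * s + 2) * exp (- c * s)" if "0 \<le> s" for s
      using that c by (intro mult_nonneg_nonneg add_nonneg_nonneg) auto
  qed simp
  also have "\<dots> = ennreal (4 * pi / c)" by simp
  finally show ?thesis .
qed

lemma integral_exp_over_norm_square: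
  fixes c :: real
  assumes c: "0 < c"
  shows "integrable (lborel :: (real^3) measure) (\<lambda>x. exp (- c * norm x) / (norm x)\<^sup>2)" (is ?I)
    and "(\<integral>x. exp (- c * norm x) / (norm x)\<^sup>2 \<partial>(lborel :: (real^3) measure)) = 4 * pi / c" (is ?E)
proof -
  have "has_bochner_integral (lborel :: (real^3) measure) (\<lambda>x. exp (- c * norm x) / (norm x)\<^sup>2) (4 * pi / c)"
    using c by (intro has_bochner_integral_nn_integral nn_integral_exp_over_norm_square) auto
  then show ?I ?E by (auto simp: has_bochner_integral_iff)
qed

section \<open>Affine changes of variables, and functions with vanishing box integrals\<close>

lemma nn_integral_affine:
  fixes f :: "'a::euclidean_space \<Rightarrow> ennreal" and c :: real
  assumes [measurable]: "f \<in> borel_measurable borel" and c: "c \<noteq> 0"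
  shows "(\<integral>\<^sup>+x. f x \<partial>lborel) = \<bar>c\<bar> ^ DIM('a) * (\<integral>\<^sup>+x. f (t + c *\<^sub>R x) \<partial>lborel)"
  by (subst lborel_affine[OF c, of t])
     (simp add: nn_integral_density nn_integral_distr nn_integral_cmult ennreal_power)

lemma integrable_affine:
  fixes f :: "'a::euclidean_space \<Rightarrow> 'b :: {banach, second_countable_topology}" and c :: real
  assumes c: "c \<noteq> 0" and f: "integrable lborel f"
  shows "integrable lborel (\<lambda>x. f (t + c *\<^sub>R x))"
proof -
  have [measurable]: "f \<in> borel_measurable borel" using f by auto
  have "(\<integral>\<^sup>+x. norm (f x) \<partial>lborel) < \<infinity>" using f unfolding integrable_iff_bounded by simp
  also have "(\<integral>\<^sup>+x. norm (f x) \<partial>lborel) = \<bar>c\<bar> ^ DIM('a) * (\<integral>\<^sup>+x. norm (f (t + c *\<^sub>R x)) \<partial>lborel)"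
    using c by (intro nn_integral_affine) auto
  finally have "(\<integral>\<^sup>+x. norm (f (t + c *\<^sub>R x)) \<partial>lborel) < \<infinity>"
    using c by (auto simp: ennreal_mult_less_top)
  then show ?thesis by (intro integrableI_bounded) auto
qed

lemma integrable_affine_iff:
  fixes f :: "'a::euclidean_space \<Rightarrow> 'b :: {banach, second_countable_topology}" and c :: real
  assumes c: "c \<noteq> 0"
  shows "integrable lborel (\<lambda>x. f (t + c *\<^sub>R x)) \<longleftrightarrow> integrable lborel f"
proof
  assume "integrable lborel (\<lambda>x. f (t + c *\<^sub>R x))"
  from integrable_affine[OF _ this, of "1/c" "- (1/c) *\<^sub>R t"] c
  show "integrable lborel f" by (simp add: scaleR_diff_right)
qed (rule integrable_affine[OF c])

text \<open>Valid for every f: if f is not integrable, neither is its composition with the affine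
  map, and both integrals take the default value 0. It can therefore be applied to the integrals in
  \<open>N_functional\<close> as they stand.\<close>

lemma integral_affine:
  fixes f :: "'a::euclidean_space \<Rightarrow> 'b :: {banach, second_countable_topology}" and c :: real
  assumes c: "c \<noteq> 0"
  shows "(\<integral>x. f (t + c *\<^sub>R x) \<partial>lborel) = (1 / \<bar>c\<bar> ^ DIM('a)) *\<^sub>R (\<integral>x. f x \<partial>lborel)"
proof cases
  assume f: "integrable lborel f"
  then have [measurable]: "f \<in> borel_measurable borel" by auto
  have "(\<integral>x. f x \<partial>lborel) = (\<integral>x. f x \<partial>density (distr lborel borel (\<lambda>x. t + c *\<^sub>R x)) (\<lambda>_. \<bar>c\<bar>^DIM('a)))"
    using lborel_affine[OF c, of t] by simp
  also have "\<dots> = \<bar>c\<bar> ^ DIM('a) *\<^sub>R (\<integral>x. f (t + c *\<^sub>R x) \<partial>lborel)"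
    by (simp add: integral_density integral_distr)
  finally show ?thesis using c by simp
next
  assume "\<not> integrable lborel f" with c show ?thesis
    by (simp add: integrable_affine_iff not_integrable_integral_eq)
qed

lemma integral_translate:
  fixes f :: "'a::euclidean_space \<Rightarrow> 'b :: {banach, second_countable_topology}"
  shows "(\<integral>x. f (x + t) \<partial>lborel) = (\<integral>x. f x \<partial>lborel)"
  using integral_affine[of 1 f t] by (simp add: add.commute)

text \<open>Boxes are an intersection-stable generator of the Borel sets, and the sets over which f
  integrates to zero form a Dynkin system. Complements require a finite total integral, so f is
  first restricted to one fixed box; countably many boxes then exhaust the space.\<close>

lemma AE_zero_if_box_integrals_zero:
  fixes f :: "'a::euclidean_space \<Rightarrow> 'b :: {banach, second_countable_topology}"
  assumes int: "\<And>a b. integrable lborel (\<lambda>x. indicator (box a b) x *\<^sub>R f x)"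
    and zero: "\<And>a b. (\<integral>x. indicator (box a b) x *\<^sub>R f x \<partial>lborel) = 0"
  shows "AE x in lborel. f x = 0"
proof -
  have loc: "AE x in lborel. indicator (box a b) x *\<^sub>R f x = 0" for a b :: 'a
  proof (rule sigma_finite_measure.density_zero[OF lborel.sigma_finite_measure_axioms int])
    define F where "F = (\<lambda>x. indicator (box a b) x *\<^sub>R f x)"
    have F: "integrable lborel F" unfolding F_def by (rule int)
    have F0: "(\<integral>x. F x \<partial>lborel) = 0" unfolding F_def by (rule zero)
    fix A assume "A \<in> sets (lborel :: 'a measure)"
    then have 1: "A \<in> sigma_sets UNIV (range (\<lambda>(a, b). box a b::'a set))"
      by (simp add: borel_eq_box)
    have 2: "Int_stable (range (\<lambda>(a, b). box a b::'a set))"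
      by (auto simp: Int_stable_def box_Int_box)
    have "range (\<lambda>(a, b). box a b::'a set) \<subseteq> Pow UNIV" by simp
    from 2 this 1 have "(\<integral>x. indicator A x *\<^sub>R F x \<partial>lborel) = 0"
    proof (induct A rule: sigma_sets_induct_disjoint)
      case (basic A)
      then obtain c d where A: "A = box c d" by auto
      obtain c' d' where "A \<inter> box a b = box c' d'" unfolding A box_Int_box by blast
      then have "(\<lambda>x. indicator A x *\<^sub>R F x) = (\<lambda>x. indicator (box c' d') x *\<^sub>R f x)"
        unfolding F_def by (auto simp: fun_eq_iff indicator_def)
      then show ?case using zero by simp
    next
      case empty then show ?case by simp
    next
      case (compl A)
      then have A: "A \<in> sets (lborel :: 'a measure)" by (simp add: borel_eq_box)
      have "(\<lambda>x. indicator (UNIV - A) x *\<^sub>R F x) = (\<lambda>x. F x - indicator A x *\<^sub>R F x)"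
        by (auto simp: fun_eq_iff indicator_def)
      then show ?case using compl F0 F A by (simp add: integrable_mult_indicator)
    next
      case (union A)
      then have A: "A i \<in> sets (lborel :: 'a measure)" for i by (auto simp: borel_eq_box)
      have "(\<integral>x\<in>(\<Union>i. A i). F x \<partial>lborel) = (\<Sum>i. (\<integral>x\<in>A i. F x \<partial>lborel))"
        using union(1) A F
        by (intro lebesgue_integral_countable_add)
           (auto simp: disjoint_family_on_def set_integrable_def intro!: integrable_mult_indicator)
      then show ?case using union(3) by (simp add: set_lebesgue_integral_def)
    qed
    then show "set_lebesgue_integral lborel A (\<lambda>x. indicator (box a b) x *\<^sub>R f x) = 0"
      by (simp add: set_lebesgue_integral_def F_def)
  qed
  have "AE x in lborel. \<forall>n. indicator (box (- (real n *\<^sub>R One)) (real n *\<^sub>R One)) x *\<^sub>R f x = 0"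
    using loc by (subst AE_all_countable) blast
  then show ?thesis
  proof eventually_elim
    case (elim x)
    have "x \<in> (\<Union>n. box (- (real n *\<^sub>R One)) (real n *\<^sub>R One))" by (simp add: UN_box_eq_UNIV)
    then show ?case using elim by (auto simp: indicator_def)
  qed
qed

section \<open>Smooth test functions\<close>

lemma partial_eq:
  assumes "(f has_derivative D) (at x)"
  shows "partial i f x = D (axis i 1)"
  unfolding partial_def using frechet_derivative_at[OF assms] by simp

lemma C_k_Suc_imp_C_k: "C_k (Suc k) f \<Longrightarrow> C_k k f"
proof (induction k arbitrary: f)
  case 0
  then have "continuous (at x) f" for x
    by (simp add: differentiable_imp_continuous_within)
  then show ?case by (simp add: continuous_at_imp_continuous_on)
next
  case (Suc k)
  then show ?case by (metis C_k.simps(2))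
qed

lemma C_k_const: "C_k k (\<lambda>x. c)"
proof (induction k arbitrary: c)
  case (Suc k)
  have "partial i (\<lambda>x. c) = (\<lambda>x. 0)" for i
    by (rule ext, subst partial_eq[where D="\<lambda>_. 0"]) auto
  then show ?case using Suc by simp
qed simp

lemma partial_add:
  assumes "f differentiable (at x)" "g differentiable (at x)"
  shows "partial i (\<lambda>x. f x + g x) x = partial i f x + partial i g x"
  using partial_eq[OF has_derivative_add[OF assms[unfolded frechet_derivative_works]], of i]
  by (simp add: partial_def)

lemma partial_mult:
  assumes "f differentiable (at x)" "g differentiable (at x)"
  shows "partial i (\<lambda>x. f x * g x) x = f x * partial i g x + partial i f x * g x"
  using partial_eq[OF has_derivative_mult[OF assms[unfolded frechet_derivative_works]], of i]
  by (simp add: partial_def)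

lemma C_k_add: "C_k k f \<Longrightarrow> C_k k g \<Longrightarrow> C_k k (\<lambda>x. f x + g x)"
proof (induction k arbitrary: f g)
  case 0 then show ?case by (simp add: continuous_on_add)
next
  case (Suc k)
  have "partial i (\<lambda>x. f x + g x) = (\<lambda>x. partial i f x + partial i g x)" for i
    using Suc.prems by (auto simp: fun_eq_iff partial_add)
  then show ?case using Suc by (auto intro: differentiable_add)
qed

lemma C_k_mult: "C_k k f \<Longrightarrow> C_k k g \<Longrightarrow> C_k k (\<lambda>x. f x * g x)"
proof (induction k arbitrary: f g)
  case 0 then show ?case by (simp add: continuous_on_mult)
next
  case (Suc k)
  have "partial i (\<lambda>x. f x * g x) = (\<lambda>x. f x * partial i g x + partial i f x * g x)" for i
    using Suc.prems by (auto simp: fun_eq_iff partial_mult)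
  then show ?case using Suc Suc.prems[THEN C_k_Suc_imp_C_k]
    by (auto intro!: differentiable_mult C_k_add)
qed

lemma C_k_sum: "(\<And>i. i \<in> I \<Longrightarrow> C_k k (f i)) \<Longrightarrow> C_k k (\<lambda>x. \<Sum>i\<in>I. f i x)"
  by (induction I rule: infinite_finite_induct) (auto intro: C_k_const C_k_add)

lemma C_k_prod: "(\<And>i. i \<in> I \<Longrightarrow> C_k k (f i)) \<Longrightarrow> C_k k (\<lambda>x. \<Prod>i\<in>I. f i x)"
  by (induction I rule: infinite_finite_induct) (auto intro: C_k_const C_k_mult)

lemma partial_of_real_component:
  "partial i (\<lambda>x. of_real (x $ j)) x = (if i = j then 1 else 0)"
proof -
  have "((\<lambda>x::real^3. complex_of_real (x $ j)) has_derivative (\<lambda>v. of_real (v $ j))) (at x)"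
    by (rule bounded_linear_imp_has_derivative[OF bounded_linear_compose[OF bounded_linear_of_real bounded_linear_vec_nth]])
  from partial_eq[OF this, of i] show ?thesis by (simp add: axis_def)
qed

lemma C_k_component: "C_k k (\<lambda>x. of_real (x $ j))"
proof (cases k)
  case 0
  then show ?thesis by (auto intro!: continuous_intros)
next
  case (Suc m)
  have "(\<lambda>x::real^3. complex_of_real (x $ j)) differentiable at x" for x
    by (rule differentiableI, rule bounded_linear_imp_has_derivative[OF bounded_linear_compose[OF bounded_linear_of_real bounded_linear_vec_nth]])
  moreover have "partial i (\<lambda>x. of_real (x $ j)) = (\<lambda>x. if i = j then 1 else 0)" for i
    by (rule ext) (rule partial_of_real_component)
  ultimately show ?thesis using Suc C_k_const by auto
qed

text \<open>\<open>partial\<close> and \<open>C_k\<close> concern complex-valued functions, but the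
  outer function here is real. The derivative D of a real function viewed as complex is real-valued,
  so the real chain rule can be applied to Re D and D recovered from it.\<close>

lemma has_derivative_of_real_compose:
  fixes q :: "real^3 \<Rightarrow> real" and h :: "real \<Rightarrow> real"
  assumes h: "(h has_real_derivative h') (at (q x))"
    and q: "((\<lambda>x. complex_of_real (q x)) has_derivative D) (at x)"
  shows "((\<lambda>x. complex_of_real (h (q x))) has_derivative (\<lambda>v. of_real h' * D v)) (at x)"
proof -
  have qr: "(q has_derivative (\<lambda>v. Re (D v))) (at x)"
    using has_derivative_Re[OF q] by simp
  have "((\<lambda>x. complex_of_real (q x)) has_derivative (\<lambda>v. of_real (Re (D v)))) (at x)"
    using qr by (auto intro!: derivative_eq_intros)
  then have D: "(\<lambda>v. of_real (Re (D v))) = D" using q has_derivative_unique by blast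
  have "((\<lambda>x. h (q x)) has_derivative (\<lambda>v. h' * Re (D v))) (at x)"
    using has_derivative_compose[OF qr h[unfolded has_field_derivative_def]] by simp
  then have "((\<lambda>x. complex_of_real (h (q x))) has_derivative (\<lambda>v. of_real (h' * Re (D v)))) (at x)"
    by (auto intro!: derivative_eq_intros)
  then show ?thesis using D by (simp add: fun_eq_iff)
qed

text \<open>Carrying the whole sequence of successive derivatives makes the induction on k close: a
  partial derivative replaces \<open>hs n\<close> by \<open>hs (Suc n)\<close> and multiplies by a
  partial derivative of q. The set S allows outer functions that are smooth only on part of the
  line, such as powers on the positive reals.\<close>

lemma C_k_compose:
  fixes q :: "real^3 \<Rightarrow> real" and hs :: "nat \<Rightarrow> real \<Rightarrow> real"
  assumes hs: "\<And>n s. s \<in> S \<Longrightarrow> (hs n has_real_derivative hs (Suc n) s) (at s)"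
    and q: "C_k k (\<lambda>x. complex_of_real (q x))" and S: "\<And>x. q x \<in> S"
  shows "C_k k (\<lambda>x. complex_of_real (hs n (q x)))"
  using q
proof (induction k arbitrary: n)
  case 0
  have "continuous_on UNIV (\<lambda>x. Re (complex_of_real (q x)))"
    using 0 by (intro continuous_intros) simp
  then have "continuous_on UNIV q" by simp
  moreover have "continuous_on S (hs n)"
    using hs by (meson DERIV_isCont continuous_at_imp_continuous_on)
  ultimately have "continuous_on UNIV (\<lambda>x. hs n (q x))"
    by - (rule continuous_on_compose2[of S "hs n" UNIV q], use S in auto)
  then show ?case by (auto intro: continuous_intros)
next
  case (Suc k)
  have der: "((\<lambda>x. complex_of_real (hs n (q x))) has_derivative
      (\<lambda>v. of_real (hs (Suc n) (q x)) * frechet_derivative (\<lambda>x. complex_of_real (q x)) (at x) v)) (at x)" for x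
  proof -
    have "(\<lambda>x. complex_of_real (q x)) differentiable (at x)" using Suc.prems by simp
    then have "((\<lambda>x. complex_of_real (q x)) has_derivative
        frechet_derivative (\<lambda>x. complex_of_real (q x)) (at x)) (at x)"
      using frechet_derivative_works by blast
    from has_derivative_of_real_compose[where h="hs n" and q=q, OF hs[OF S] this] show ?thesis .
  qed
  have "partial i (\<lambda>x. complex_of_real (hs n (q x))) =
      (\<lambda>x. of_real (hs (Suc n) (q x)) * partial i (\<lambda>x. of_real (q x)) x)" for i
    by (rule ext) (simp only: partial_eq[OF der] partial_def[of _ "\<lambda>x. complex_of_real (q x)"])
  then show ?case using Suc C_k_Suc_imp_C_k[OF Suc.prems] der[THEN differentiableI]
    by (auto intro!: C_k_mult)
qed

lemma C_k_norm_square: "C_k k (\<lambda>x. complex_of_real ((norm x)\<^sup>2))"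
proof -
  have "(\<lambda>x::real^3. complex_of_real ((norm x)\<^sup>2)) = (\<lambda>x. \<Sum>i\<in>UNIV. of_real (x $ i) * of_real (x $ i))"
    by (simp add: fun_eq_iff norm_vec_def L2_set_def sum_nonneg power2_eq_square)
  then show ?thesis by (simp add: C_k_sum C_k_mult C_k_component)
qed

lemma C_k_exp:
  assumes "C_k k (\<lambda>x. complex_of_real (q x))"
  shows "C_k k (\<lambda>x. complex_of_real (exp (q x)))"
  using C_k_compose[where hs="\<lambda>_. exp" and S=UNIV and q=q] assms DERIV_exp by auto

lemma C_k_powr:
  assumes "C_k k (\<lambda>x. complex_of_real (q x))" and "\<And>x. q x > 0"
  shows "C_k k (\<lambda>x. complex_of_real (q x powr r))"
proof -
  define hs where "hs n s = (\<Prod>i<n. r - real i) * s powr (r - real n)" for n s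
  have "(hs n has_real_derivative hs (Suc n) s) (at s)" if "s > 0" for n s
    unfolding hs_def using that
    by (auto intro!: derivative_eq_intros simp: algebra_simps)
  then have "C_k k (\<lambda>x. complex_of_real (hs 0 (q x)))"
    by (rule C_k_compose[where S="{0<..}" and hs=hs]) (use assms in auto)
  then show ?thesis by (simp add: hs_def)
qed

section \<open>A smooth function on the line that vanishes exactly on the nonpositive
  half-line\<close>

definition bump :: "real \<Rightarrow> real" where
  "bump s = (if s > 0 then exp (- 1 / s) else 0)"

definition bump' :: "real \<Rightarrow> real" where
  "bump' s = (if s > 0 then 1 / s\<^sup>2 * exp (- 1 / s) else 0)"

text \<open>On s > 0 the n-th derivative of exp (-1 / s) is P(y) exp (-y) with y = 1 / s and a
  polynomial P. Since dy/ds = - y^2, one more differentiation turns P into y^2 (P - P'), which is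
  the recursion.\<close>

primrec bump_poly :: "nat \<Rightarrow> real poly" where
  "bump_poly 0 = 1"
| "bump_poly (Suc n) = monom 1 2 * (bump_poly n - pderiv (bump_poly n))"

definition bump_deriv :: "nat \<Rightarrow> real \<Rightarrow> real" where
  "bump_deriv n s = (if s > 0 then poly (bump_poly n) (1 / s) * exp (- 1 / s) else 0)"

lemma tendsto_poly_div_exp: "((\<lambda>y::real. poly p y / exp y) \<longlongrightarrow> 0) at_top"
proof -
  have "((\<lambda>y::real. \<Sum>i\<le>degree p. coeff p i * (y ^ i / exp y)) \<longlongrightarrow> (\<Sum>i\<le>degree p. coeff p i * 0)) at_top"
    by (intro tendsto_intros tendsto_power_div_exp_0)
  then show ?thesis by (simp add: poly_altdef sum_divide_distrib)
qed

lemma bump_deriv_has_derivative: "(bump_deriv n has_real_derivative bump_deriv (Suc n) s) (at s)"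
proof -
  consider "s > 0" | "s < 0" | "s = 0" by linarith
  then show ?thesis
  proof cases
    case 1
    have "((\<lambda>s. poly (bump_poly n) (1 / s) * exp (- 1 / s)) has_real_derivative bump_deriv (Suc n) s) (at s)"
      unfolding bump_deriv_def using 1
      by (auto intro!: derivative_eq_intros simp: poly_monom field_simps power2_eq_square)
    then show ?thesis
      by (rule has_field_derivative_transform_within_open[of _ _ _ "{0<..}"])
         (use 1 in \<open>auto simp: bump_deriv_def\<close>)
  next
    case 2
    have "((\<lambda>s. 0) has_real_derivative bump_deriv (Suc n) s) (at s)"
      using 2 by (simp add: bump_deriv_def)
    then show ?thesis
      by (rule has_field_derivative_transform_within_open[of _ _ _ "{..<0}"])
         (use 2 in \<open>auto simp: bump_deriv_def\<close>)
  next
    case 3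
    \<comment> \<open>With y = 1 / h the right difference quotient at 0 is a polynomial in y over
      exp y; \<open>pCons 0\<close> supplies the extra factor y that comes from dividing by
      h.\<close>
    have "((\<lambda>y::real. poly (pCons 0 (bump_poly n)) y / exp y) \<longlongrightarrow> 0) at_top"
      by (rule tendsto_poly_div_exp)
    then have "((\<lambda>h::real. poly (pCons 0 (bump_poly n)) (inverse h) / exp (inverse h)) \<longlongrightarrow> 0) (at_right 0)"
      by (rule filterlim_compose[OF _ filterlim_inverse_at_top_right])
    then have r: "((\<lambda>h. bump_deriv n h / h) \<longlongrightarrow> 0) (at_right 0)"
      by (rule Lim_transform_eventually)
         (auto simp: eventually_at_filter bump_deriv_def exp_minus field_simps)
    have l: "((\<lambda>h. bump_deriv n h / h) \<longlongrightarrow> 0) (at_left 0)"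
      by (rule Lim_transform_eventually[of "\<lambda>_. 0"])
         (auto simp: eventually_at_filter bump_deriv_def)
    have "((\<lambda>h. bump_deriv n h / h) \<longlongrightarrow> 0) (at 0)"
      using l r filterlim_split_at_real by blast
    then show ?thesis using 3 by (simp add: DERIV_def bump_deriv_def)
  qed
qed

lemma bump_eq_bump_deriv: "bump = bump_deriv 0"
  by (auto simp: fun_eq_iff bump_def bump_deriv_def)

lemma bump'_eq_bump_deriv: "bump' = bump_deriv (Suc 0)"
  by (auto simp: fun_eq_iff bump_deriv_def bump'_def poly_monom power_divide)

lemma bump_has_derivative: "(bump has_real_derivative bump' s) (at s)"
  using bump_deriv_has_derivative[of 0 s] by (simp add: bump_eq_bump_deriv bump'_eq_bump_deriv del: bump_poly.simps)

lemma C_k_bump: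
  assumes "C_k k (\<lambda>x. complex_of_real (q x))"
  shows "C_k k (\<lambda>x. complex_of_real (bump (q x)))"
  unfolding bump_eq_bump_deriv
  by (rule C_k_compose[where S=UNIV and hs=bump_deriv]) (use bump_deriv_has_derivative assms in auto)

lemma bump_bounds: "0 \<le> bump s" "bump s \<le> 1"
  by (auto simp: bump_def)

lemma bump'_bounds: "0 \<le> bump' s" "bump' s \<le> 2"
proof -
  show "0 \<le> bump' s" by (auto simp: bump'_def)
  show "bump' s \<le> 2"
  proof (cases "s > 0")
    case True
    \<comment> \<open>With y = 1 / s the bound reads y^2 \<le> 2 exp y, which is the quadratic term
      of the exponential series.\<close>
    have "1 + 1 / s + (1 / s)\<^sup>2 / 2 \<le> exp (1 / s)"
      using True by (intro exp_lower_Taylor_quadratic) auto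
    moreover have "1 / s > 0" using True by simp
    ultimately have "(1 / s)\<^sup>2 \<le> 2 * exp (1 / s)" by linarith
    then show ?thesis using True
      by (simp add: bump'_def exp_minus field_simps power_divide)
  qed (simp add: bump'_def)
qed

lemma bump_le_0 [simp]: "s \<le> 0 \<Longrightarrow> bump s = 0" by (simp add: bump_def)

text \<open>Products of such functions, one pair for each coordinate, will approximate the indicator
  of an open box by test functions supported in that box.\<close>

lemma bump_scaled_tendsto: "(\<lambda>n. bump (real n * s)) \<longlonglongrightarrow> indicator {0<..} s"
proof (cases "s > 0")
  case True
  have "(\<lambda>n. exp (- 1 / (real n * s))) \<longlonglongrightarrow> 1"
    using True by real_asymp
  then have "(\<lambda>n. bump (real n * s)) \<longlonglongrightarrow> 1"
    by (rule Lim_transform_eventually)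
       (use True in \<open>auto simp: bump_def intro!: eventually_sequentiallyI[of 1]\<close>)
  then show ?thesis using True by simp
next
  case False
  then have "real n * s \<le> 0" for n by (simp add: mult_le_0_iff)
  then show ?thesis using False by (simp add: indicator_def)
qed

section \<open>Test functions: support, bounds, translations and dilations\<close>

lemma test_functionI:
  assumes "\<And>k. C_k k \<eta>" and "bounded S" and "\<And>x. x \<notin> S \<Longrightarrow> \<eta> x = 0"
  shows "test_function \<eta>"
proof -
  have "{x. \<eta> x \<noteq> 0} \<subseteq> S" using assms(3) by auto
  then show ?thesis unfolding test_function_def using assms(1,2)
    by (auto simp: compact_closure intro: bounded_subset)
qed

lemma test_functionD:
  assumes "test_function \<eta>"
  shows "C_k k \<eta>" "\<eta> differentiable (at x)" "continuous_on UNIV \<eta>" "\<eta> \<in> borel_measurable borel"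
    "\<eta> \<in> borel_measurable lborel"
proof -
  show 1: "C_k k \<eta>" for k using assms by (simp add: test_function_def)
  show "\<eta> differentiable (at x)" using 1[of "Suc 0"] by simp
  show 3: "continuous_on UNIV \<eta>" using 1[of 0] by simp
  show "\<eta> \<in> borel_measurable borel" by (rule borel_measurable_continuous_onI[OF 3])
  then show "\<eta> \<in> borel_measurable lborel" by simp
qed

lemma test_function_bounded_support:
  assumes "test_function \<eta>"
  obtains R where "R > 0" "\<And>x. norm x > R \<Longrightarrow> \<eta> x = 0"
proof -
  have "bounded {x. \<eta> x \<noteq> 0}" using assms by (simp add: test_function_def compact_closure)
  then obtain R where "R > 0" "\<forall>x\<in>{x. \<eta> x \<noteq> 0}. norm x \<le> R" by (meson bounded_pos)
  then show ?thesis using that[of R] by force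
qed

lemma test_function_partial:
  assumes \<eta>: "test_function \<eta>"
  shows "test_function (partial i \<eta>)"
proof -
  obtain R where R: "R > 0" "\<And>x. norm x > R \<Longrightarrow> \<eta> x = 0"
    using test_function_bounded_support[OF \<eta>] by blast
  show ?thesis
  proof (rule test_functionI[where S="cball 0 R"])
    show "C_k k (partial i \<eta>)" for k using test_functionD(1)[OF \<eta>, of "Suc k"] by simp
    fix x :: "real^3" assume x: "x \<notin> cball 0 R"
    have "((\<lambda>_. 0) has_derivative (\<lambda>_. 0)) (at x)" by simp
    then have "(\<eta> has_derivative (\<lambda>_. 0)) (at x)"
      by (rule has_derivative_transform_within_open[where s="- cball 0 R"]) (use x R in auto)
    from partial_eq[OF this] show "partial i \<eta> x = 0" .
  qed auto
qed

lemma test_function_bounded: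
  assumes \<eta>: "test_function \<eta>"
  obtains M where "M > 0" "\<And>x. cmod (\<eta> x) \<le> M"
proof -
  obtain R where R: "R > 0" "\<And>x. norm x > R \<Longrightarrow> \<eta> x = 0"
    using test_function_bounded_support[OF \<eta>] by blast
  have "compact (\<eta> ` cball 0 R)"
    using test_functionD(3)[OF \<eta>] by (intro compact_continuous_image) (auto intro: continuous_on_subset)
  then obtain M where M: "M > 0" "\<And>y. y \<in> \<eta> ` cball 0 R \<Longrightarrow> cmod y \<le> M"
    using compact_imp_bounded bounded_pos by metis
  have "cmod (\<eta> x) \<le> M" for x
  proof (cases "norm x \<le> R")
    case True then show ?thesis using M(2)[of "\<eta> x"] by auto
  next
    case False then show ?thesis using M R by simp
  qed
  then show ?thesis using M(1) that by blast
qed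

lemma has_vector_derivative_along_axis:
  assumes "\<eta> differentiable (at (x + t *\<^sub>R axis i 1))"
  shows "((\<lambda>t. \<eta> (x + t *\<^sub>R axis i 1)) has_vector_derivative partial i \<eta> (x + t *\<^sub>R axis i 1)) (at t)"
proof -
  let ?D = "frechet_derivative \<eta> (at (x + t *\<^sub>R axis i 1))"
  have D: "(\<eta> has_derivative ?D) (at (x + t *\<^sub>R axis i 1))"
    using assms frechet_derivative_works by blast
  have "((\<lambda>t. x + t *\<^sub>R axis i 1) has_derivative (\<lambda>s. s *\<^sub>R axis i 1)) (at t)"
    by (auto intro!: derivative_eq_intros)
  from has_derivative_compose[OF this D]
  have "((\<lambda>t. \<eta> (x + t *\<^sub>R axis i 1)) has_derivative (\<lambda>s. ?D (s *\<^sub>R axis i 1))) (at t)" .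
  moreover have "?D (s *\<^sub>R axis i 1) = s *\<^sub>R ?D (axis i 1)" for s
    by (rule linear_scale[OF bounded_linear.linear[OF has_derivative_bounded_linear[OF D]]])
  ultimately show ?thesis by (simp add: has_vector_derivative_def partial_def)
qed

text \<open>Bounds the difference quotients of a test function uniformly in the step, as dominated
  convergence will require.\<close>

lemma test_function_Lipschitz_along_axis:
  assumes \<eta>: "test_function \<eta>" and M: "\<And>x. cmod (partial i \<eta> x) \<le> M"
  shows "cmod (\<eta> (x + t *\<^sub>R axis i 1) - \<eta> x) \<le> M * \<bar>t\<bar>"
proof -
  have "norm (\<eta> (x + t *\<^sub>R axis i 1) - \<eta> (x + 0 *\<^sub>R axis i 1)) \<le> M * norm (t - 0)"
  proof (rule differentiable_bound[where S=UNIV])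
    show "((\<lambda>t. \<eta> (x + t *\<^sub>R axis i 1)) has_derivative (\<lambda>s. s *\<^sub>R partial i \<eta> (x + r *\<^sub>R axis i 1)))
        (at r within UNIV)" for r
      using has_vector_derivative_along_axis[OF test_functionD(2)[OF \<eta>]]
      by (simp add: has_vector_derivative_def)
    show "onorm (\<lambda>s. s *\<^sub>R partial i \<eta> (x + r *\<^sub>R axis i 1)) \<le> M" for r
      using M by (intro onorm_le) (auto simp: mult.commute[of M] intro!: mult_left_mono)
  qed auto
  then show ?thesis by simp
qed

lemma C_k_translate: "C_k k f \<Longrightarrow> C_k k (\<lambda>x. f (x + v))"
proof -
  have der: "((\<lambda>x. g (x + v)) has_derivative frechet_derivative g (at (x + v))) (at x)"
    if "g differentiable (at (x + v))" for g :: "real^3 \<Rightarrow> complex" and x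
  proof -
    have 1: "((\<lambda>x. x + v) has_derivative (\<lambda>h. h)) (at x)" by (auto intro!: derivative_eq_intros)
    show ?thesis
      using has_derivative_compose[OF 1 that[unfolded frechet_derivative_works]] .
  qed
  have p: "partial i (\<lambda>x. f (x + v)) x = partial i f (x + v)" if "f differentiable (at (x + v))" for x f i
    using partial_eq[OF der[OF that]] by (simp add: partial_def)
  show "C_k k f \<Longrightarrow> C_k k (\<lambda>x. f (x + v))"
  proof (induction k arbitrary: f)
    case 0
    then show ?case
      by (simp, intro continuous_on_compose2[of UNIV f UNIV "\<lambda>x. x + v"]) (auto intro: continuous_intros)
  next
    case (Suc k)
    have "partial i (\<lambda>x. f (x + v)) = (\<lambda>x. partial i f (x + v))" for i
      using Suc.prems by (auto simp: fun_eq_iff p)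
    then show ?case using Suc der[THEN differentiableI] by auto
  qed
qed

lemma test_function_translate:
  assumes \<eta>: "test_function \<eta>"
  shows "test_function (\<lambda>x. \<eta> (x + v))"
proof -
  obtain R where R: "R > 0" "\<And>x. norm x > R \<Longrightarrow> \<eta> x = 0"
    using test_function_bounded_support[OF \<eta>] by blast
  show ?thesis
  proof (rule test_functionI[where S="cball (- v) R"])
    show "\<eta> (x + v) = 0" if "x \<notin> cball (- v) R" for x
    proof (rule R)
      have "norm (x + v) = dist (- v) x"
        by (simp only: dist_norm norm_minus_cancel[of "x + v", symmetric] minus_add_distrib add.commute[of "- x"] diff_conv_add_uminus)
      then show "R < norm (x + v)" using that by simp
    qed
  qed (auto intro: C_k_translate test_functionD[OF \<eta>])
qed

lemma C_k_scale: "C_k k f \<Longrightarrow> C_k k (\<lambda>x. f (t *\<^sub>R x))"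
  and partial_scale: "f differentiable (at (t *\<^sub>R x)) \<Longrightarrow> partial i (\<lambda>x. f (t *\<^sub>R x)) x = of_real t * partial i f (t *\<^sub>R x)"
proof -
  have der: "((\<lambda>x. g (t *\<^sub>R x)) has_derivative (\<lambda>h. frechet_derivative g (at (t *\<^sub>R x)) (t *\<^sub>R h))) (at x)"
    if "g differentiable (at (t *\<^sub>R x))" for g :: "real^3 \<Rightarrow> complex" and x
  proof -
    have 1: "((\<lambda>x. t *\<^sub>R x) has_derivative (\<lambda>h. t *\<^sub>R h)) (at x)" by (auto intro!: derivative_eq_intros)
    show ?thesis
      using has_derivative_compose[OF 1 that[unfolded frechet_derivative_works]] .
  qed
  show p: "partial i (\<lambda>x. f (t *\<^sub>R x)) x = of_real t * partial i f (t *\<^sub>R x)"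
    if "f differentiable (at (t *\<^sub>R x))" for x f i
  proof -
    have "linear (frechet_derivative f (at (t *\<^sub>R x)))"
      using that linear_frechet_derivative by blast
    then show ?thesis
      using partial_eq[OF der[OF that], of i]
      by (simp only: partial_def linear_scale scaleR_conv_of_real[where 'a=complex])
  qed
  show "C_k k f \<Longrightarrow> C_k k (\<lambda>x. f (t *\<^sub>R x))"
  proof (induction k arbitrary: f)
    case 0
    then show ?case
      by (simp, intro continuous_on_compose2[of UNIV f UNIV "\<lambda>x. t *\<^sub>R x"]) (auto intro: continuous_intros)
  next
    case (Suc k)
    have "partial i (\<lambda>x. f (t *\<^sub>R x)) = (\<lambda>x. of_real t * partial i f (t *\<^sub>R x))" for i
      using Suc.prems by (auto simp: fun_eq_iff p)
    then show ?case using Suc der[THEN differentiableI] by (auto intro!: C_k_mult C_k_const)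
  qed
qed

lemma test_function_scale:
  assumes \<eta>: "test_function \<eta>" and t: "t > 0"
  shows "test_function (\<lambda>x. \<eta> (t *\<^sub>R x))"
proof -
  obtain R where R: "R > 0" "\<And>x. norm x > R \<Longrightarrow> \<eta> x = 0"
    using test_function_bounded_support[OF \<eta>] by blast
  show ?thesis
  proof (rule test_functionI[where S="cball 0 (R / t)"])
    show "\<eta> (t *\<^sub>R x) = 0" if "x \<notin> cball 0 (R / t)" for x
      using that t by (intro R) (simp add: field_simps)
  qed (auto intro: C_k_scale test_functionD[OF \<eta>])
qed

section \<open>Square-integrable functions and weak gradients\<close>

lemma L2_I:
  assumes "f \<in> borel_measurable lborel" "integrable lborel (\<lambda>x. (norm (f x))\<^sup>2)"
  shows "f \<in> L2"
  using assms by (simp add: L2_def)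

lemma L2_D:
  assumes "f \<in> L2"
  shows "f \<in> borel_measurable lborel" "f \<in> borel_measurable borel" "integrable lborel (\<lambda>x. (norm (f x))\<^sup>2)"
  using assms by (auto simp: L2_def)

lemma L2_dominated:
  fixes f :: "real^3 \<Rightarrow> 'b::euclidean_space" and g :: "real^3 \<Rightarrow> 'c::euclidean_space"
  assumes f: "f \<in> borel_measurable lborel" and g: "g \<in> L2" and le: "AE x in lborel. norm (f x) \<le> norm (g x)"
  shows "f \<in> L2"
proof (rule L2_I[OF f])
  show "integrable lborel (\<lambda>x. (norm (f x))\<^sup>2)"
  proof (rule Bochner_Integration.integrable_bound[OF L2_D(3)[OF g]])
    show "AE x in lborel. norm ((norm (f x))\<^sup>2) \<le> norm ((norm (g x))\<^sup>2)"
      using le by eventually_elim (simp add: power_mono)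
  qed (use f in measurable)
qed

lemma L2_mult_integrable_norm:
  fixes f :: "real^3 \<Rightarrow> 'b::euclidean_space" and g :: "real^3 \<Rightarrow> 'c::euclidean_space"
  assumes f: "f \<in> L2" and g: "g \<in> L2"
  shows "integrable lborel (\<lambda>x. norm (f x) * norm (g x))"
proof (rule Bochner_Integration.integrable_bound)
  show "integrable lborel (\<lambda>x. (norm (f x))\<^sup>2 + (norm (g x))\<^sup>2)"
    using L2_D(3)[OF f] L2_D(3)[OF g] by simp
  show "(\<lambda>x. norm (f x) * norm (g x)) \<in> borel_measurable lborel"
    using L2_D(1)[OF f] L2_D(1)[OF g] by measurable
  show "AE x in lborel. norm (norm (f x) * norm (g x)) \<le> norm ((norm (f x))\<^sup>2 + (norm (g x))\<^sup>2)"
  proof (rule AE_I2)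
    fix x :: "real^3"
    have "0 \<le> (norm (f x) - norm (g x))\<^sup>2" by simp
    then have "2 * (norm (f x) * norm (g x)) \<le> (norm (f x))\<^sup>2 + (norm (g x))\<^sup>2"
      by (simp add: power2_diff)
    moreover have "0 \<le> norm (f x) * norm (g x)" by simp
    ultimately have "norm (f x) * norm (g x) \<le> (norm (f x))\<^sup>2 + (norm (g x))\<^sup>2" by linarith
    then show "norm (norm (f x) * norm (g x)) \<le> norm ((norm (f x))\<^sup>2 + (norm (g x))\<^sup>2)"
      by simp
  qed
qed

lemma L2_mult_integrable:
  fixes f g :: "real^3 \<Rightarrow> complex"
  assumes f: "f \<in> L2" and g: "g \<in> L2"
  shows "integrable lborel (\<lambda>x. f x * g x)"
  using L2_D(1)[OF f] L2_D(1)[OF g]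
  by (intro Bochner_Integration.integrable_bound[OF L2_mult_integrable_norm[OF f g]])
     (auto simp: norm_mult)

lemma L2_norm_power2:
  "(L2_norm f)\<^sup>2 = (\<integral>x. (norm (f x))\<^sup>2 \<partial>lborel)"
  unfolding L2_norm_def by (simp add: integral_nonneg_AE)

lemma L2_norm_nonneg: "0 \<le> L2_norm f"
  unfolding L2_norm_def by (simp add: integral_nonneg_AE)

lemma L2_Cauchy_Schwarz_norm:
  fixes f :: "real^3 \<Rightarrow> 'b::euclidean_space" and g :: "real^3 \<Rightarrow> 'c::euclidean_space"
  assumes f: "f \<in> L2" and g: "g \<in> L2"
  shows "(\<integral>x. norm (f x) * norm (g x) \<partial>lborel) \<le> L2_norm f * L2_norm g"
proof -
  define A where "A = (L2_norm f)\<^sup>2"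
  define B where "B = (L2_norm g)\<^sup>2"
  define C where "C = (\<integral>x. norm (f x) * norm (g x) \<partial>lborel)"
  note int = L2_D(3)[OF f] L2_D(3)[OF g] L2_mult_integrable_norm[OF f g]
  have quad: "0 \<le> A - 2 * k * C + k\<^sup>2 * B" for k
  proof -
    have "0 \<le> (\<integral>x. (norm (f x) - k * norm (g x))\<^sup>2 \<partial>lborel)" by simp
    also have "\<dots> = (\<integral>x. (norm (f x))\<^sup>2 - 2 * k * (norm (f x) * norm (g x)) + k\<^sup>2 * (norm (g x))\<^sup>2 \<partial>lborel)"
      by (intro Bochner_Integration.integral_cong) (auto simp: power2_diff power_mult_distrib mult_ac)
    also have "\<dots> = A - 2 * k * C + k\<^sup>2 * B"
      using int unfolding A_def B_def C_def L2_norm_power2 by simp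
    finally show ?thesis .
  qed
  have AB: "0 \<le> A" "0 \<le> B" by (auto simp: A_def B_def)
  have "C\<^sup>2 \<le> A * B"
  proof (cases "B = 0")
    case True
    have "C \<le> 0"
    proof (rule ccontr)
      assume "\<not> C \<le> 0"
      \<comment> \<open>For B = 0 the quadratic is affine in k; this k makes its value - A - 2,
        which is negative. For B > 0 the minimiser C / B is used instead.\<close>
      then have "2 * ((A + 1) / C) * C = 2 * (A + 1)" by simp
      then show False using quad[of "(A + 1) / C"] True AB by simp
    qed
    moreover have "0 \<le> C" unfolding C_def by simp
    ultimately show ?thesis using True by simp
  next
    case False
    then have "B > 0" using AB by simp
    then show ?thesis using quad[of "C / B"] by (simp add: field_simps power2_eq_square)
  qed
  also have "A * B = (L2_norm f * L2_norm g)\<^sup>2" by (simp add: A_def B_def power_mult_distrib)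
  finally show ?thesis unfolding C_def
    by (rule power2_le_imp_le) (simp add: L2_norm_nonneg)
qed

lemma L2_Cauchy_Schwarz:
  fixes f g :: "real^3 \<Rightarrow> complex"
  assumes f: "f \<in> L2" and g: "g \<in> L2"
  shows "cmod (\<integral>x. f x * g x \<partial>lborel) \<le> L2_norm f * L2_norm g"
  using integral_norm_bound[of lborel "\<lambda>x. f x * g x"] L2_Cauchy_Schwarz_norm[OF f g]
  by (simp add: norm_mult)

lemma L2_add:
  fixes f g :: "real^3 \<Rightarrow> 'b::euclidean_space"
  assumes f: "f \<in> L2" and g: "g \<in> L2"
  shows "(\<lambda>x. f x + g x) \<in> L2"
proof (rule L2_I)
  note [measurable] = L2_D(1)[OF f] L2_D(1)[OF g]
  show "(\<lambda>x. f x + g x) \<in> borel_measurable lborel" by measurable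
  show "integrable lborel (\<lambda>x. (norm (f x + g x))\<^sup>2)"
  proof (rule Bochner_Integration.integrable_bound)
    show "integrable lborel (\<lambda>x. 2 * (norm (f x))\<^sup>2 + 2 * (norm (g x))\<^sup>2)"
      using L2_D(3)[OF f] L2_D(3)[OF g] by simp
    show "AE x in lborel. norm ((norm (f x + g x))\<^sup>2) \<le> norm (2 * (norm (f x))\<^sup>2 + 2 * (norm (g x))\<^sup>2)"
    proof (rule AE_I2)
      fix x :: "real^3"
      have "(norm (f x + g x))\<^sup>2 \<le> (norm (f x) + norm (g x))\<^sup>2"
        by (intro power_mono norm_triangle_ineq) simp
      moreover have "0 \<le> (norm (f x) - norm (g x))\<^sup>2" by simp
      ultimately show "norm ((norm (f x + g x))\<^sup>2) \<le> norm (2 * (norm (f x))\<^sup>2 + 2 * (norm (g x))\<^sup>2)"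
        by (simp add: power2_diff power2_sum)
    qed
  qed measurable
qed

lemma L2_scaleR:
  fixes f :: "real^3 \<Rightarrow> 'b::euclidean_space"
  assumes "f \<in> L2"
  shows "(\<lambda>x. c *\<^sub>R f x) \<in> L2"
  using L2_D[OF assms] by (intro L2_I) (auto simp: power_mult_distrib)

lemma L2_cmult:
  fixes f :: "real^3 \<Rightarrow> complex"
  assumes "f \<in> L2"
  shows "(\<lambda>x. c * f x) \<in> L2"
  using L2_D[OF assms] by (intro L2_I) (auto simp: power_mult_distrib norm_mult)

lemma norm_vec3_power2: "(norm v)\<^sup>2 = (\<Sum>i\<in>UNIV. (cmod (v $ i))\<^sup>2)" for v :: "complex^3"
  by (simp add: norm_vec_def L2_set_def sum_nonneg)

lemma borel_measurable_vec_nth':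
  fixes g :: "real^3 \<Rightarrow> complex^3"
  assumes "g \<in> borel_measurable M"
  shows "(\<lambda>x. g x $ i) \<in> borel_measurable M"
  using assms by (rule borel_measurable_continuous_on[rotated]) (auto intro!: continuous_intros)

lemma L2_component:
  fixes g :: "real^3 \<Rightarrow> complex^3"
  assumes g: "g \<in> L2"
  shows "(\<lambda>x. g x $ i) \<in> L2"
  by (rule L2_dominated[OF borel_measurable_vec_nth'[OF L2_D(1)[OF g]] g])
     (simp add: Finite_Cartesian_Product.norm_nth_le)

lemma borel_measurable_vec_lambda:
  fixes g :: "'a \<Rightarrow> complex^3"
  assumes "\<And>i. (\<lambda>x. g x $ i) \<in> borel_measurable M"
  shows "g \<in> borel_measurable M"
proof (subst borel_measurable_euclidean_space, rule ballI)
  fix b :: "complex^3" assume "b \<in> Basis"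
  then obtain i c where b: "b = axis i c" by (auto simp: Basis_vec_def)
  show "(\<lambda>x. g x \<bullet> b) \<in> borel_measurable M"
    using assms by (simp add: b inner_axis)
qed

lemma L2_vec:
  fixes g :: "real^3 \<Rightarrow> complex^3"
  assumes g: "\<And>i. (\<lambda>x. g x $ i) \<in> L2"
  shows "g \<in> L2"
proof (rule L2_I)
  show "g \<in> borel_measurable lborel"
    using L2_D(1)[OF g] by (rule borel_measurable_vec_lambda)
  show "integrable lborel (\<lambda>x. (norm (g x))\<^sup>2)"
    unfolding norm_vec3_power2 using L2_D(3)[OF g] by simp
qed

section \<open>Local integrability, difference quotients and vanishing criteria\<close>

definition locally_integrable :: "(real^3 \<Rightarrow> complex) \<Rightarrow> bool" where
  "locally_integrable v \<longleftrightarrow> v \<in> borel_measurable lborel \<and>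
     (\<forall>R. integrable lborel (\<lambda>x. indicator (cball 0 R) x *\<^sub>R v x))"

lemma indicator_cball_L2: "(\<lambda>x. indicator (cball 0 R) x :: real) \<in> L2"
proof (rule L2_I)
  have "integrable lborel (\<lambda>x::real^3. indicator (cball 0 R) x :: real)"
    by (intro integrable_real_indicator emeasure_bounded_finite) auto
  moreover have "(\<lambda>x::real^3. (norm (indicator (cball 0 R) x :: real))\<^sup>2) = indicator (cball 0 R)"
    by (auto simp: fun_eq_iff indicator_def)
  ultimately show "integrable lborel (\<lambda>x::real^3. (norm (indicator (cball 0 R) x :: real))\<^sup>2)"
    by simp
  show "(\<lambda>x::real^3. indicator (cball 0 R) x :: real) \<in> borel_measurable lborel"
    by (intro borel_measurable_indicator) auto
qed

lemma L2_locally_integrable: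
  assumes v: "v \<in> L2"
  shows "locally_integrable v"
  unfolding locally_integrable_def
proof (intro conjI allI)
  note [measurable] = L2_D(1)[OF v]
  show "v \<in> borel_measurable lborel" by measurable
  fix R
  from L2_mult_integrable_norm[OF indicator_cball_L2 v]
  show "integrable lborel (\<lambda>x. indicator (cball 0 R) x *\<^sub>R v x)"
  proof (rule Bochner_Integration.integrable_bound)
    show "(\<lambda>x. indicator (cball 0 R) x *\<^sub>R v x) \<in> borel_measurable lborel"
      by (intro borel_measurable_scaleR borel_measurable_indicator) auto
  qed auto
qed

lemma locally_integrable_mult_integrable:
  assumes v: "locally_integrable v" and \<eta>: "\<eta> \<in> borel_measurable lborel"
    and M: "\<And>x. cmod (\<eta> x) \<le> M" and R: "\<And>x. norm x > R \<Longrightarrow> \<eta> x = 0"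
  shows "integrable lborel (\<lambda>x. v x * \<eta> x)"
proof (rule Bochner_Integration.integrable_bound)
  show "integrable lborel (\<lambda>x. M * norm (indicator (cball 0 R) x *\<^sub>R v x))"
    using v unfolding locally_integrable_def by (intro integrable_mult_right integrable_norm) auto
  show "(\<lambda>x. v x * \<eta> x) \<in> borel_measurable lborel"
    using v \<eta> unfolding locally_integrable_def by (intro borel_measurable_times) auto
  have "M \<ge> 0" using M[of 0] norm_ge_zero order_trans by blast
  show "AE x in lborel. norm (v x * \<eta> x) \<le> norm (M * norm (indicator (cball 0 R) x *\<^sub>R v x))"
  proof (rule AE_I2)
    fix x :: "real^3"
    show "norm (v x * \<eta> x) \<le> norm (M * norm (indicator (cball 0 R) x *\<^sub>R v x))"
      using M[of x] R[of x] \<open>M \<ge> 0\<close>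
      by (cases "norm x \<le> R") (auto simp: norm_mult mult.commute[of M] intro!: mult_left_mono)
  qed
qed

lemma locally_integrable_test_integrable:
  assumes v: "locally_integrable v" and \<eta>: "test_function \<eta>"
  shows "integrable lborel (\<lambda>x. v x * \<eta> x)"
proof -
  obtain R where R: "R > 0" "\<And>x. norm x > R \<Longrightarrow> \<eta> x = 0"
    using test_function_bounded_support[OF \<eta>] by blast
  obtain M where "M > 0" "\<And>x. cmod (\<eta> x) \<le> M" using test_function_bounded[OF \<eta>] by blast
  with R v test_functionD(5)[OF \<eta>] show ?thesis
    by (intro locally_integrable_mult_integrable) auto
qed

lemma test_function_L2:
  assumes \<eta>: "test_function \<eta>"
  shows "\<eta> \<in> L2"
proof -
  obtain R where R: "R > 0" "\<And>x. norm x > R \<Longrightarrow> \<eta> x = 0"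
    using test_function_bounded_support[OF \<eta>] by blast
  obtain M where M: "M > 0" "\<And>x. cmod (\<eta> x) \<le> M" using test_function_bounded[OF \<eta>] by blast
  have "(\<lambda>x. M *\<^sub>R (indicator (cball 0 R) x :: real)) \<in> L2"
    by (rule L2_scaleR[OF indicator_cball_L2])
  moreover have "AE x in lborel. norm (\<eta> x) \<le> norm (M *\<^sub>R (indicator (cball 0 R) x :: real))"
  proof (rule AE_I2)
    fix x :: "real^3"
    show "norm (\<eta> x) \<le> norm (M *\<^sub>R (indicator (cball 0 R) x :: real))"
      using M(1) M(2)[of x] R(2)[of x] by (cases "norm x \<le> R") auto
  qed
  ultimately show ?thesis using test_functionD(5)[OF \<eta>] by (rule_tac L2_dominated) auto
qed

lemma has_vector_derivative_imp_quotient_tendsto: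
  fixes f :: "real \<Rightarrow> complex"
  assumes f: "(f has_vector_derivative D) (at 0)" and s: "s \<longlonglongrightarrow> 0" "\<And>n. s n \<noteq> 0"
  shows "(\<lambda>n. (f (s n) - f 0) / of_real (s n)) \<longlonglongrightarrow> D"
proof -
  have "((\<lambda>h. norm (f (0 + h) - f 0 - h *\<^sub>R D) / norm h) \<longlongrightarrow> 0) (at 0)"
    using f unfolding has_vector_derivative_def has_derivative_at by simp
  moreover have "filterlim s (at 0) sequentially"
    using s by (auto simp: filterlim_at)
  ultimately have "(\<lambda>n. norm (f (0 + s n) - f 0 - s n *\<^sub>R D) / norm (s n)) \<longlonglongrightarrow> 0"
    by (rule filterlim_compose)
  moreover have "norm (f (0 + s n) - f 0 - s n *\<^sub>R D) / norm (s n) = norm ((f (s n) - f 0) / of_real (s n) - D)" for n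
  proof -
    have "(f (s n) - f 0) / of_real (s n) - D = (f (s n) - f 0 - s n *\<^sub>R D) / of_real (s n)"
      using s(2)[of n] by (simp add: field_simps scaleR_conv_of_real)
    then show ?thesis by (simp add: norm_divide)
  qed
  ultimately show ?thesis by (simp add: LIM_zero_iff tendsto_norm_zero_iff)
qed

text \<open>Dominated convergence: steps of size at most 1 keep the support of every difference
  quotient in the ball of radius R + 1, and a bound M on the partial derivative bounds the
  quotients, so M |v| on that ball is an integrable majorant.\<close>

lemma tendsto_integral_difference_quotient:
  assumes v: "locally_integrable v" and \<eta>: "test_function \<eta>"
    and s: "s \<longlonglongrightarrow> 0" "\<And>n. s n \<noteq> 0" "\<And>n. \<bar>s n\<bar> \<le> 1"
  shows "(\<lambda>n. \<integral>x. v x * ((\<eta> (x + s n *\<^sub>R axis i 1) - \<eta> x) / of_real (s n)) \<partial>lborel)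
    \<longlonglongrightarrow> (\<integral>x. v x * partial i \<eta> x \<partial>lborel)"
proof -
  obtain R where R: "R > 0" "\<And>x. norm x > R \<Longrightarrow> \<eta> x = 0"
    using test_function_bounded_support[OF \<eta>] by blast
  obtain M where M: "M > 0" "\<And>x. cmod (partial i \<eta> x) \<le> M"
    using test_function_bounded[OF test_function_partial[OF \<eta>]] by blast
  have [measurable]: "v \<in> borel_measurable borel" using v by (simp add: locally_integrable_def)
  note [measurable] = test_functionD(4)[OF \<eta>] test_functionD(4)[OF test_function_partial[OF \<eta>]]
  show ?thesis
  proof (rule integral_dominated_convergence[where w="\<lambda>x. M * norm (indicator (cball 0 (R + 1)) x *\<^sub>R v x)"])
    show "integrable lborel (\<lambda>x. M * norm (indicator (cball 0 (R + 1)) x *\<^sub>R v x))"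
      using v unfolding locally_integrable_def by (intro integrable_mult_right integrable_norm) auto
    show "AE x in lborel. (\<lambda>n. v x * ((\<eta> (x + s n *\<^sub>R axis i 1) - \<eta> x) / of_real (s n)))
        \<longlonglongrightarrow> v x * partial i \<eta> x"
    proof (intro AE_I2 tendsto_mult_left)
      fix x :: "real^3"
      have "((\<lambda>t. \<eta> (x + t *\<^sub>R axis i 1)) has_vector_derivative partial i \<eta> x) (at 0)"
        using has_vector_derivative_along_axis[OF test_functionD(2)[OF \<eta>], of x i 0] by simp
      from has_vector_derivative_imp_quotient_tendsto[OF this s(1,2)]
      show "(\<lambda>n. (\<eta> (x + s n *\<^sub>R axis i 1) - \<eta> x) / of_real (s n)) \<longlonglongrightarrow> partial i \<eta> x"
        by simp
    qed
    show "AE x in lborel. norm (v x * ((\<eta> (x + s n *\<^sub>R axis i 1) - \<eta> x) / of_real (s n)))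
        \<le> M * norm (indicator (cball 0 (R + 1)) x *\<^sub>R v x)" for n
    proof (rule AE_I2)
      fix x :: "real^3"
      show "norm (v x * ((\<eta> (x + s n *\<^sub>R axis i 1) - \<eta> x) / of_real (s n)))
        \<le> M * norm (indicator (cball 0 (R + 1)) x *\<^sub>R v x)"
      proof (cases "norm x \<le> R + 1")
        case True
        have "cmod ((\<eta> (x + s n *\<^sub>R axis i 1) - \<eta> x) / of_real (s n)) \<le> M"
          using test_function_Lipschitz_along_axis[OF \<eta> M(2), of x "s n"] s(2)[of n]
          by (simp add: norm_divide field_simps)
        then have "cmod (v x) * cmod ((\<eta> (x + s n *\<^sub>R axis i 1) - \<eta> x) / of_real (s n)) \<le> cmod (v x) * M"
          by (intro mult_left_mono) auto
        then show ?thesis using True by (simp only: norm_mult) (simp add: mult.commute[of M])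
      next
        case False
        have "norm x \<le> norm (x + s n *\<^sub>R axis i 1) + norm (s n *\<^sub>R axis i 1 :: real^3)"
          using norm_triangle_ineq4[of "x + s n *\<^sub>R axis i 1" "s n *\<^sub>R axis i 1"] by simp
        then have "norm x \<le> norm (x + s n *\<^sub>R axis i 1) + 1"
          using s(3)[of n] by (simp add: norm_axis_1)
        then have "\<eta> (x + s n *\<^sub>R axis i 1) = 0" "\<eta> x = 0" using False by (auto intro!: R(2))
        then show ?thesis using False by simp
      qed
    qed
  qed measurable
qed

text \<open>The fundamental lemma of the calculus of variations, obtained from explicit functions
  instead of mollification: products of \<open>bump (n * (x $ i - a $ i))\<close> and
  \<open>bump (n * (b $ i - x $ i))\<close> are test functions between 0 and 1 that converge
  pointwise to the indicator of the open box, so the integrals of v over boxes vanish.\<close>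

lemma AE_zero_if_test_integrals_zero:
  assumes v: "locally_integrable v" and zero: "\<And>\<eta>. test_function \<eta> \<Longrightarrow> (\<integral>x. v x * \<eta> x \<partial>lborel) = 0"
  shows "AE x in lborel. v x = 0"
proof (rule AE_zero_if_box_integrals_zero)
  fix a b :: "real^3"
  have [measurable]: "v \<in> borel_measurable borel" using v by (simp add: locally_integrable_def)
  obtain R where R: "box a b \<subseteq> cball 0 R"
    using bounded_box[of a b] unfolding bounded_iff by (auto simp: subset_iff)
  have "integrable lborel (\<lambda>x. indicator (cball 0 R) x *\<^sub>R v x)"
    using v by (simp add: locally_integrable_def)
  from integrable_mult_indicator[OF _ this, of "box a b"]
  have "integrable lborel (\<lambda>x. indicator (box a b) x *\<^sub>R (indicator (cball 0 R) x *\<^sub>R v x))" by simp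
  also have "(\<lambda>x. indicator (box a b) x *\<^sub>R (indicator (cball 0 R) x *\<^sub>R v x)) = (\<lambda>x. indicator (box a b) x *\<^sub>R v x)"
    using R by (auto simp: fun_eq_iff indicator_def)
  finally show int: "integrable lborel (\<lambda>x. indicator (box a b) x *\<^sub>R v x)" .
  define \<eta> where "\<eta> n x = (\<Prod>i\<in>UNIV. complex_of_real (bump (real n * (x $ i - a $ i))) * of_real (bump (real n * (b $ i - x $ i))))"
    for n and x :: "real^3"
  have aff: "C_k k (\<lambda>x. complex_of_real (real n * (x $ i - c)))" "C_k k (\<lambda>x. complex_of_real (real n * (c - x $ i)))" for k n i c
  proof -
    have "(\<lambda>x::real^3. complex_of_real (real n * (x $ i - c))) = (\<lambda>x. of_real (real n) * (of_real (x $ i) + of_real (- c)))"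
      "(\<lambda>x::real^3. complex_of_real (real n * (c - x $ i))) = (\<lambda>x. of_real (real n) * (of_real (-1) * of_real (x $ i) + of_real c))"
      by (auto simp: fun_eq_iff)
    then show "C_k k (\<lambda>x. complex_of_real (real n * (x $ i - c)))" "C_k k (\<lambda>x. complex_of_real (real n * (c - x $ i)))"
      by (simp_all only:) (intro C_k_mult C_k_add C_k_const C_k_component)+
  qed
  have out: "\<eta> n x = 0" if "x \<notin> box a b" for n x
  proof -
    obtain i where "\<not> (a $ i < x $ i \<and> x $ i < b $ i)" using \<open>x \<notin> box a b\<close> by (auto simp: mem_box_cart)
    then have "real n * (x $ i - a $ i) \<le> 0 \<or> real n * (b $ i - x $ i) \<le> 0"
      by (auto simp: mult_le_0_iff)
    then have "complex_of_real (bump (real n * (x $ i - a $ i))) * of_real (bump (real n * (b $ i - x $ i))) = 0"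
      by auto
    then show ?thesis unfolding \<eta>_def by (intro prod_zero) auto
  qed
  have test: "test_function (\<eta> n)" for n
  proof (rule test_functionI[of _ "box a b"])
    show "C_k k (\<eta> n)" for k
      unfolding \<eta>_def[abs_def] by (intro C_k_prod C_k_mult C_k_bump aff)
  qed (use out in auto)
  have le1: "cmod (\<eta> n x) \<le> 1" for n x
    unfolding \<eta>_def prod_norm[symmetric]
    by (rule prod_le_1) (auto simp: norm_mult bump_bounds intro!: mult_le_one)
  have lim: "(\<lambda>n. \<eta> n x) \<longlonglongrightarrow> indicator (box a b) x" for x
  proof -
    have "(\<lambda>n. \<eta> n x) \<longlonglongrightarrow> (\<Prod>i\<in>UNIV. complex_of_real (indicator {0<..} (x $ i - a $ i)) * of_real (indicator {0<..} (b $ i - x $ i)))"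
      unfolding \<eta>_def by (intro tendsto_intros bump_scaled_tendsto)
    also have "(\<Prod>i\<in>UNIV. complex_of_real (indicator {0<..} (x $ i - a $ i)) * of_real (indicator {0<..} (b $ i - x $ i))) = indicator (box a b) x"
      by (auto simp: indicator_def mem_box_cart)
    finally show ?thesis .
  qed
  have "(\<lambda>n. \<integral>x. v x * \<eta> n x \<partial>lborel) \<longlonglongrightarrow> (\<integral>x. v x * indicator (box a b) x \<partial>lborel)"
  proof (rule integral_dominated_convergence[where w="\<lambda>x. norm (indicator (box a b) x *\<^sub>R v x)"])
    show "(\<lambda>x. v x * \<eta> n x) \<in> borel_measurable lborel" for n
      using test_functionD(4)[OF test, of n] by measurable
    show "integrable lborel (\<lambda>x. norm (indicator (box a b) x *\<^sub>R v x))" by (rule integrable_norm[OF int])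
    show "AE x in lborel. (\<lambda>n. v x * \<eta> n x) \<longlonglongrightarrow> v x * indicator (box a b) x"
      by (intro AE_I2 tendsto_mult_left lim)
    show "AE x in lborel. norm (v x * \<eta> n x) \<le> norm (indicator (box a b) x *\<^sub>R v x)" for n
    proof (rule AE_I2)
      show "norm (v x * \<eta> n x) \<le> norm (indicator (box a b) x *\<^sub>R v x)" for x
        using le1[of n x] out[of x n] by (cases "x \<in> box a b") (auto simp: norm_mult mult_left_le)
    qed
  qed measurable
  then have "(\<integral>x. v x * indicator (box a b) x \<partial>lborel) = 0"
    using zero[OF test] by (simp add: LIMSEQ_const_iff)
  also have "(\<lambda>x. v x * indicator (box a b) x) = (\<lambda>x. indicator (box a b) x *\<^sub>R v x)"
    by (auto simp: fun_eq_iff indicator_def)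
  finally show "(\<integral>x. indicator (box a b) x *\<^sub>R v x \<partial>lborel) = 0" .
qed

text \<open>The hypothesis says that the pairing of u with a test function does not change when the
  test function is translated along the axis. Pushed far out, the test function sees only the tail
  of u, and by Cauchy-Schwarz the pairing tends to 0; being constant, it is 0 from the
  start.\<close>

lemma L2_zero_if_weak_partial_zero:
  assumes u: "u \<in> L2" and zero: "\<And>\<eta>. test_function \<eta> \<Longrightarrow> (\<integral>x. u x * partial i \<eta> x \<partial>lborel) = 0"
  shows "AE x in lborel. u x = 0"
proof (rule AE_zero_if_test_integrals_zero[OF L2_locally_integrable[OF u]])
  fix \<eta> assume \<eta>: "test_function \<eta>"
  note li = L2_locally_integrable[OF u]
  have [measurable]: "u \<in> borel_measurable borel" using L2_D[OF u] by simp
  define D where "D t = (\<integral>x. u x * \<eta> (x + t *\<^sub>R axis i 1) \<partial>lborel)" for t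
  have "(D has_derivative (\<lambda>_. 0)) (at t)" for t
  proof -
    define \<xi> where "\<xi> = (\<lambda>x. \<eta> (x + t *\<^sub>R axis i 1))"
    have \<xi>: "test_function \<xi>" unfolding \<xi>_def by (rule test_function_translate[OF \<eta>])
    \<comment> \<open>Restricting the filter to {-1..1} leaves the limit at 0 unchanged, and makes
      every test sequence satisfy the bound |s n| \<le> 1 of
      \<open>tendsto_integral_difference_quotient\<close>.\<close>
    have "((\<lambda>h. norm (D (t + h) - D t - 0) / norm h) \<longlongrightarrow> 0) (at 0 within {-1..1})"
      unfolding tendsto_at_iff_sequentially
    proof (intro allI impI)
      fix s :: "nat \<Rightarrow> real" assume s1: "\<forall>n. s n \<in> {-1..1} - {0}" and s0: "s \<longlonglongrightarrow> 0"
      have s2: "s n \<noteq> 0" "\<bar>s n\<bar> \<le> 1" for n using s1 by (auto simp: abs_le_iff)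
      have eq: "(\<integral>x. u x * ((\<xi> (x + s n *\<^sub>R axis i 1) - \<xi> x) / of_real (s n)) \<partial>lborel) = (D (t + s n) - D t) / of_real (s n)" for n
      proof -
        have "(\<integral>x. u x * ((\<xi> (x + s n *\<^sub>R axis i 1) - \<xi> x) / of_real (s n)) \<partial>lborel)
          = (\<integral>x. (u x * \<xi> (x + s n *\<^sub>R axis i 1) - u x * \<xi> x) / of_real (s n) \<partial>lborel)"
          by (simp add: algebra_simps)
        also have "\<dots> = ((\<integral>x. u x * \<xi> (x + s n *\<^sub>R axis i 1) \<partial>lborel) - (\<integral>x. u x * \<xi> x \<partial>lborel)) / of_real (s n)"
          using locally_integrable_test_integrable[OF li \<xi>]
            locally_integrable_test_integrable[OF li test_function_translate[OF \<xi>]]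
          by (subst Bochner_Integration.integral_divide_zero) simp
        also have "\<dots> = (D (t + s n) - D t) / of_real (s n)"
          by (simp add: D_def \<xi>_def algebra_simps)
        finally show ?thesis .
      qed
      have "(\<lambda>n. (D (t + s n) - D t) / of_real (s n)) \<longlonglongrightarrow> 0"
        using tendsto_integral_difference_quotient[OF li \<xi> s0 s2, of i] by (simp only: eq zero[OF \<xi>])
      then have "(\<lambda>n. norm ((D (t + s n) - D t) / of_real (s n))) \<longlonglongrightarrow> 0"
        by (rule tendsto_norm_zero)
      then show "((\<lambda>h. norm (D (t + h) - D t - 0) / norm h) \<circ> s) \<longlonglongrightarrow> 0"
        by (simp add: norm_divide o_def)
    qed
    moreover have "at 0 within {-1..1} = at (0::real)" by (rule at_within_Icc_at) auto
    ultimately show ?thesis unfolding has_derivative_at by simp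
  qed
  then obtain c where c: "\<And>t. D t = c"
    using has_derivative_zero_constant[of UNIV D] by auto
  obtain R where R: "R > 0" "\<And>x. norm x > R \<Longrightarrow> \<eta> x = 0"
    using test_function_bounded_support[OF \<eta>] by blast
  \<comment> \<open>Where the test function translated by n does not vanish, |x + n e| \<le> R for
    the unit vector e of the axis, hence |x| \<ge> n - R: only this tail of u enters
    \<open>D n\<close>.\<close>
  define w where "w n = (\<lambda>x. indicator {x. real n - R \<le> norm x} x *\<^sub>R u x)" for n
  have [measurable]: "{x::real^3. real n - R \<le> norm x} \<in> sets borel" for n
    by measurable
  have w: "w n \<in> L2" for n
    by (rule L2_dominated[OF _ u]) (auto simp: w_def indicator_def)
  have "norm c \<le> L2_norm (w n) * L2_norm \<eta>" for n
  proof -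
    have "D n = (\<integral>x. w n x * \<eta> (x + real n *\<^sub>R axis i 1) \<partial>lborel)"
      unfolding D_def
    proof (rule Bochner_Integration.integral_cong[OF refl])
      fix x :: "real^3"
      have "real n \<le> norm (x + real n *\<^sub>R axis i 1) + norm x"
        using norm_triangle_ineq4[of "x + real n *\<^sub>R axis i 1" x] by (simp add: norm_axis_1)
      then show "u x * \<eta> (x + real n *\<^sub>R axis i 1) = w n x * \<eta> (x + real n *\<^sub>R axis i 1)"
        using R(2)[of "x + real n *\<^sub>R axis i 1"] by (auto simp: w_def indicator_def)
    qed
    then have "norm c \<le> L2_norm (w n) * L2_norm (\<lambda>x. \<eta> (x + real n *\<^sub>R axis i 1))"
      using L2_Cauchy_Schwarz[OF w test_function_L2[OF test_function_translate[OF \<eta>]]] c by metis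
    also have "L2_norm (\<lambda>x. \<eta> (x + real n *\<^sub>R axis i 1)) = L2_norm \<eta>"
      unfolding L2_norm_def using integral_translate[of "\<lambda>x. (norm (\<eta> x))\<^sup>2"] by simp
    finally show ?thesis .
  qed
  moreover have "(\<lambda>n. L2_norm (w n) * L2_norm \<eta>) \<longlonglongrightarrow> sqrt 0 * L2_norm \<eta>"
    unfolding L2_norm_def[of "w _"]
  proof (intro tendsto_intros)
    have "(\<lambda>n. \<integral>x. (norm (w n x))\<^sup>2 \<partial>lborel) \<longlonglongrightarrow> (\<integral>x. 0 \<partial>(lborel :: (real^3) measure))"
    proof (rule integral_dominated_convergence[where w="\<lambda>x. (norm (u x))\<^sup>2"])
      show "AE x in lborel. (\<lambda>n. (norm (w n x))\<^sup>2) \<longlonglongrightarrow> 0"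
      proof (rule AE_I2)
        fix x :: "real^3"
        obtain N where N: "norm x + R < real N" using reals_Archimedean2 by blast
        have "eventually (\<lambda>n. (norm (w n x))\<^sup>2 = 0) sequentially"
          by (rule eventually_sequentiallyI[of N]) (use N in \<open>auto simp: w_def indicator_def\<close>)
        then show "(\<lambda>n. (norm (w n x))\<^sup>2) \<longlonglongrightarrow> 0" by (rule tendsto_eventually)
      qed
    qed (use L2_D[OF u] in \<open>auto simp: w_def indicator_def\<close>)
    then show "(\<lambda>n. \<integral>x. (norm (w n x))\<^sup>2 \<partial>lborel) \<longlonglongrightarrow> 0" by simp
  qed
  ultimately have "norm c \<le> sqrt 0 * L2_norm \<eta>"
    by (rule_tac LIMSEQ_le_const) auto
  then show "(\<integral>x. u x * \<eta> x \<partial>lborel) = 0" using c[of 0] by (simp add: D_def)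
qed

section \<open>Linearity and uniqueness of weak gradients\<close>

lemma weak_gradient_add:
  assumes "u \<in> L2" "g \<in> L2" "weak_gradient u g" "v \<in> L2" "h \<in> L2" "weak_gradient v h"
  shows "weak_gradient (\<lambda>x. u x + v x) (\<lambda>x. g x + h x)"
  unfolding weak_gradient_def
proof (intro allI impI)
  fix \<eta> i assume \<eta>: "test_function \<eta>"
  note L = L2_mult_integrable[OF _ test_function_L2[OF \<eta>]] L2_mult_integrable[OF _ test_function_L2[OF test_function_partial[OF \<eta>]]]
  show "(\<integral>x. (u x + v x) * partial i \<eta> x \<partial>lborel) = - (\<integral>x. (g x + h x) $ i * \<eta> x \<partial>lborel)"
    using assms(3,6)[unfolded weak_gradient_def, rule_format, OF \<eta>, of i]
      L(2)[OF assms(1)] L(2)[OF assms(4)] L(1)[OF L2_component[OF assms(2)]] L(1)[OF L2_component[OF assms(5)]]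
    by (simp add: distrib_right)
qed

lemma weak_gradient_cmult:
  assumes "weak_gradient u g"
  shows "weak_gradient (\<lambda>x. c * u x) (\<lambda>x. \<chi> i. c * g x $ i)"
  using assms unfolding weak_gradient_def by (simp add: mult.assoc)

lemma L2_cmult_vec:
  assumes "g \<in> L2"
  shows "(\<lambda>x. \<chi> i. c * g x $ i) \<in> (L2 :: (real^3 \<Rightarrow> complex^3) set)"
  by (rule L2_vec) (simp add: L2_cmult L2_component assms)

lemma weak_gradient_unique:
  assumes g: "g \<in> L2" "weak_gradient u g" and h: "h \<in> L2" "weak_gradient u h"
  shows "AE x in lborel. g x = h x"
proof -
  have "AE x in lborel. g x $ i - h x $ i = 0" for i
  proof (rule AE_zero_if_test_integrals_zero)
    have "(\<lambda>x. g x $ i + (- 1) * h x $ i) \<in> L2"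
      by (intro L2_add L2_cmult L2_component g h)
    then show "locally_integrable (\<lambda>x. g x $ i - h x $ i)" by (simp add: L2_locally_integrable)
    fix \<eta> assume \<eta>: "test_function \<eta>"
    show "(\<integral>x. (g x $ i - h x $ i) * \<eta> x \<partial>lborel) = 0"
      using g(2)[unfolded weak_gradient_def, rule_format, OF \<eta>, of i]
        h(2)[unfolded weak_gradient_def, rule_format, OF \<eta>, of i]
        L2_mult_integrable[OF L2_component[OF g(1)] test_function_L2[OF \<eta>], of i]
        L2_mult_integrable[OF L2_component[OF h(1)] test_function_L2[OF \<eta>], of i]
      by (simp add: left_diff_distrib)
  qed
  then have "AE x in lborel. \<forall>i\<in>UNIV. g x $ i - h x $ i = 0"
    by (intro AE_finite_allI) auto
  then show ?thesis by eventually_elim (simp add: vec_eq_iff)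
qed

text \<open>\<open>grad\<close> is a choice among functions that agree almost everywhere, so its
  norm may be computed from any explicit weak gradient.\<close>

lemma L2_norm_grad_eq:
  assumes "g \<in> L2" "weak_gradient u g"
  shows "L2_norm (grad u) = L2_norm g"
proof -
  have "grad u \<in> L2 \<and> weak_gradient u (grad u)"
    unfolding grad_def by (rule someI[of _ g]) (use assms in auto)
  then have "AE x in lborel. grad u x = g x" using assms weak_gradient_unique by blast
  then show ?thesis unfolding L2_norm_def
    using assms(1) \<open>grad u \<in> L2 \<and> _\<close>
    by (intro arg_cong[where f=sqrt] integral_cong_AE) (auto dest: L2_D(1))
qed

lemma H1_I: "u \<in> L2 \<Longrightarrow> g \<in> L2 \<Longrightarrow> weak_gradient u g \<Longrightarrow> u \<in> H1"
  unfolding H1_def by auto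

lemma H1_E:
  assumes "u \<in> H1"
  obtains g where "u \<in> L2" "g \<in> L2" "weak_gradient u g"
  using assms unfolding H1_def by auto

section \<open>Differences of Green functions\<close>

lemma exp_div_norm_L2:
  fixes c :: real
  assumes "0 < c"
  shows "(\<lambda>x::real^3. exp (- c * norm x) / norm x) \<in> L2"
proof (rule L2_I)
  have "(\<lambda>x::real^3. (norm (exp (- c * norm x) / norm x))\<^sup>2) = (\<lambda>x. exp (- (2 * c) * norm x) / (norm x)\<^sup>2)"
    by (simp add: fun_eq_iff power_divide exp_double[symmetric] mult.assoc[symmetric])
  then show "integrable lborel (\<lambda>x::real^3. (norm (exp (- c * norm x) / norm x))\<^sup>2)"
    using integral_exp_over_norm_square(1)[of "2 * c"] assms by simp
qed measurable

lemma times_exp_le: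
  fixes c r :: real
  assumes "0 < c"
  shows "r * exp (- c * r) \<le> 1 / c"
proof -
  have "c * r \<le> exp (c * r)" using exp_ge_add_one_self[of "c * r"] by linarith
  then show ?thesis using assms by (simp add: exp_minus field_simps)
qed

text \<open>Half of the decay pays for a factor 1 / r, because r exp (- c r / 2) \<le> 2 / c. This
  reduces the claim to the function \<open>exp (- (c / 2) * norm x) / norm x\<close>, whose square
  has already been integrated.\<close>

lemma exp_norm_L2:
  fixes c :: real
  assumes c: "0 < c"
  shows "(\<lambda>x::real^3. exp (- c * norm x)) \<in> L2"
proof (rule L2_dominated)
  show "(\<lambda>x::real^3. (2 / c) *\<^sub>R (exp (- (c / 2) * norm x) / norm x)) \<in> L2"
    using c by (intro L2_scaleR exp_div_norm_L2) simp
  show "AE x in lborel. norm (exp (- c * norm (x::real^3))) \<le> norm ((2 / c) *\<^sub>R (exp (- (c / 2) * norm x) / norm x))"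
  proof (rule AE_mp[OF AE_lborel_singleton[of 0]], intro AE_I2 impI)
    fix x :: "real^3" assume "x \<noteq> 0"
    then have x: "norm x > 0" by simp
    have "exp (- c * norm x) = exp (- (c / 2) * norm x) * exp (- (c / 2) * norm x)"
      by (simp add: exp_add[symmetric])
    also have "\<dots> \<le> (2 / c) / norm x * exp (- (c / 2) * norm x)"
      using times_exp_le[of "c / 2" "norm x"] x c
      by (intro mult_right_mono) (simp_all add: field_simps)
    finally show "norm (exp (- c * norm x)) \<le> norm ((2 / c) *\<^sub>R (exp (- (c / 2) * norm x) / norm x))"
      using x c by simp
  qed
qed measurable

section \<open>Kernels parametrised by the square root of \<lambda>, and the radial profile of their
  differences\<close>

definition yukawa :: "real \<Rightarrow> real^3 \<Rightarrow> real" where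
  "yukawa a x = exp (- a * norm x) / (4 * pi * norm x)"

abbreviation cyukawa :: "real \<Rightarrow> real^3 \<Rightarrow> complex" where
  "cyukawa a x \<equiv> complex_of_real (yukawa a x)"

lemma green_eq_cyukawa: "green lam x = cyukawa (sqrt lam) x"
  by (simp add: green_def yukawa_def)

lemma yukawa_measurable [measurable]: "yukawa a \<in> borel_measurable borel"
  unfolding yukawa_def[abs_def] by measurable

lemma cyukawa_L2: "0 < a \<Longrightarrow> cyukawa a \<in> L2"
proof (rule L2_dominated[where g="\<lambda>x. (1 / (4 * pi)) *\<^sub>R (exp (- a * norm x) / norm x)"])
  show "0 < a \<Longrightarrow> (\<lambda>x::real^3. (1 / (4 * pi)) *\<^sub>R (exp (- a * norm x) / norm x)) \<in> L2"
    by (intro L2_scaleR exp_div_norm_L2)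
  show "AE x in lborel. norm (cyukawa a x) \<le> norm ((1 / (4 * pi)) *\<^sub>R (exp (- a * norm x) / norm x))"
    unfolding norm_of_real by (simp add: yukawa_def abs_mult)
qed measurable

text \<open>The product is again of the form exp (- c |x|) / |x|^2, with c = a + b and the factor 1
  / (4 \<pi>)^2. All norms and pairings of kernels below are therefore rational in a and b up to
  \<pi>.\<close>

lemma yukawa_mult_integral:
  assumes "0 < a" "0 < b"
  shows "integrable lborel (\<lambda>x. yukawa a x * yukawa b x)"
    and "(\<integral>x. yukawa a x * yukawa b x \<partial>lborel) = 1 / (4 * pi * (a + b))"
proof -
  have eq: "(\<lambda>x. yukawa a x * yukawa b x) = (\<lambda>x. (1 / (4 * pi)\<^sup>2) * (exp (- (a + b) * norm x) / (norm x)\<^sup>2))"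
    by (simp add: fun_eq_iff yukawa_def exp_add[symmetric] power2_eq_square algebra_simps)
  show "integrable lborel (\<lambda>x. yukawa a x * yukawa b x)"
    unfolding eq using assms by (intro integrable_mult_right integral_exp_over_norm_square(1)) simp
  show "(\<integral>x. yukawa a x * yukawa b x \<partial>lborel) = 1 / (4 * pi * (a + b))"
    unfolding eq integral_mult_right_zero using assms
    by (subst integral_exp_over_norm_square(2)) (simp_all add: power2_eq_square)
qed

text \<open>\<open>f' r / r\<close> for the radial profile \<open>f\<close> of \<open>yukawa a - yukawa b\<close>.\<close>

definition yukawa_slope :: "real \<Rightarrow> real \<Rightarrow> real \<Rightarrow> real" where
  "yukawa_slope a b r = - ((a * r + 1) * exp (- a * r) - (b * r + 1) * exp (- b * r)) / (4 * pi * r ^ 3)"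

definition yukawa_slope' :: "real \<Rightarrow> real \<Rightarrow> real \<Rightarrow> real" where
  "yukawa_slope' a b r = (((a * r)\<^sup>2 + 3 * (a * r) + 3) * exp (- a * r) - ((b * r)\<^sup>2 + 3 * (b * r) + 3) * exp (- b * r)) / (4 * pi * r ^ 4)"

lemma yukawa_slope_has_derivative:
  assumes "r > 0"
  shows "(yukawa_slope a b has_real_derivative yukawa_slope' a b r) (at r)"
  unfolding yukawa_slope_def[abs_def] yukawa_slope'_def using assms
  by (auto intro!: derivative_eq_intros simp: divide_simps) (simp add: algebra_simps eval_nat_numeral)

lemma yukawa_difference_profile_has_derivative:
  assumes "r > 0"
  shows "((\<lambda>r. (exp (- a * r) - exp (- b * r)) / (4 * pi * r)) has_real_derivative r * yukawa_slope a b r) (at r)"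
  unfolding yukawa_slope_def using assms
  by (auto intro!: derivative_eq_intros simp: divide_simps) (simp add: algebra_simps power2_eq_square power3_eq_cube)

text \<open>The gradient of the difference is x k(|x|) with k the slope, and such a field has
  divergence 3 k + r k'. This is thus the Laplacian of the difference away from the origin: each
  kernel satisfies \<Delta> G_a = a^2 G_a there.\<close>

lemma yukawa_slope_sum:
  assumes "r > 0"
  shows "3 * yukawa_slope a b r + r * yukawa_slope' a b r = (a\<^sup>2 * exp (- a * r) - b\<^sup>2 * exp (- b * r)) / (4 * pi * r)"
  unfolding yukawa_slope_def yukawa_slope'_def using assms
  by (simp add: divide_simps) (simp add: algebra_simps eval_nat_numeral)

text \<open>Mean value theorem in the parameter t between a and b, not in r: the t-derivative of (t
  r + 1) exp (- t r) is - t r^2 exp (- t r), and its factor r^2 cancels two of the three powers of r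
  in the denominator. This cancellation is what puts the difference of two kernels into H^1.\<close>

lemma yukawa_slope_bound:
  assumes a: "0 < a" "0 < b" and r: "r > 0"
  shows "\<bar>yukawa_slope a b r\<bar> \<le> \<bar>a - b\<bar> * max a b * exp (- min a b * r) / r"
proof -
  have "norm ((a * r + 1) * exp (- a * r) - (b * r + 1) * exp (- b * r))
      \<le> (max a b * r\<^sup>2 * exp (- min a b * r)) * norm (a - b)"
  proof (rule field_differentiable_bound[where S="{min a b..max a b}" and f'="\<lambda>t. - t * r\<^sup>2 * exp (- t * r)"])
    show "((\<lambda>t. (t * r + 1) * exp (- t * r)) has_field_derivative - t * r\<^sup>2 * exp (- t * r)) (at t within {min a b..max a b})" for t
      by (auto intro!: derivative_eq_intros simp: algebra_simps power2_eq_square)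
    fix t assume t: "t \<in> {min a b..max a b}"
    then have "t > 0" using a by auto
    then have "norm (- t * r\<^sup>2 * exp (- t * r)) = t * r\<^sup>2 * exp (- t * r)" by (simp add: abs_mult)
    also have "\<dots> \<le> max a b * r\<^sup>2 * exp (- min a b * r)"
      using t r a \<open>t > 0\<close> by (intro mult_mono) auto
    finally show "norm (- t * r\<^sup>2 * exp (- t * r)) \<le> max a b * r\<^sup>2 * exp (- min a b * r)" .
  qed auto
  then have "\<bar>(a * r + 1) * exp (- a * r) - (b * r + 1) * exp (- b * r)\<bar> / (4 * pi * r ^ 3)
     \<le> (max a b * r\<^sup>2 * exp (- min a b * r)) * \<bar>a - b\<bar> / (4 * pi * r ^ 3)"
    using r by (intro divide_right_mono) auto
  also have "\<dots> \<le> (max a b * r\<^sup>2 * exp (- min a b * r)) * \<bar>a - b\<bar> / (1 * r ^ 3)"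
    using r a pi_gt3 by (intro divide_left_mono mult_right_mono mult_nonneg_nonneg mult_pos_pos) auto
  also have "\<dots> = \<bar>a - b\<bar> * max a b * exp (- min a b * r) / r"
    using r by (simp add: field_simps power2_eq_square power3_eq_cube)
  finally show ?thesis using r unfolding yukawa_slope_def by (simp add: abs_divide abs_minus_commute)
qed

lemma yukawa_slope'_bound:
  assumes a: "0 < a" "0 < b" and r: "r > 0"
  shows "\<bar>yukawa_slope' a b r\<bar> \<le> 2 * \<bar>a - b\<bar> * max a b * exp (- min a b * r / 2) / r\<^sup>2"
proof -
  have "norm (((a * r)\<^sup>2 + 3 * (a * r) + 3) * exp (- a * r) - ((b * r)\<^sup>2 + 3 * (b * r) + 3) * exp (- b * r))
      \<le> (max a b * r\<^sup>2 * (2 * exp (- min a b * r / 2))) * norm (a - b)"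
  proof (rule field_differentiable_bound[where S="{min a b..max a b}" and f'="\<lambda>t. - (t * r\<^sup>2 * ((t * r + 1) * exp (- t * r)))"])
    show "((\<lambda>t. ((t * r)\<^sup>2 + 3 * (t * r) + 3) * exp (- t * r)) has_field_derivative - (t * r\<^sup>2 * ((t * r + 1) * exp (- t * r)))) (at t within {min a b..max a b})" for t
      by (auto intro!: derivative_eq_intros simp: algebra_simps power2_eq_square)
    fix t assume t: "t \<in> {min a b..max a b}"
    then have t0: "t > 0" using a by auto
    \<comment> \<open>The linear factor is absorbed into half of the exponential decay; hence the
      halved rate and the constant 2 in the bound.\<close>
    have "t * r + 1 \<le> 2 * exp (t * r / 2)"
      using exp_ge_add_one_self[of "t * r / 2"] by linarith
    then have "(t * r + 1) * exp (- t * r) \<le> 2 * exp (t * r / 2) * exp (- t * r)"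
      by (intro mult_right_mono) auto
    also have "\<dots> = 2 * exp (- t * r / 2)" by (simp add: mult.assoc exp_add[symmetric])
    also have "\<dots> \<le> 2 * exp (- min a b * r / 2)"
      using t r by (simp add: min_def split: if_splits)
    finally have 1: "(t * r + 1) * exp (- t * r) \<le> 2 * exp (- min a b * r / 2)" .
    have "norm (- (t * r\<^sup>2 * ((t * r + 1) * exp (- t * r)))) = t * r\<^sup>2 * ((t * r + 1) * exp (- t * r))"
      using t0 r by (simp add: abs_mult)
    also have "\<dots> \<le> max a b * r\<^sup>2 * (2 * exp (- min a b * r / 2))"
    proof (rule mult_mono)
      show "t * r\<^sup>2 \<le> max a b * r\<^sup>2" using t by (intro mult_right_mono) auto
      show "0 \<le> (t * r + 1) * exp (- t * r)" using t0 r by simp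
    qed (use a 1 in auto)
    finally show "norm (- (t * r\<^sup>2 * ((t * r + 1) * exp (- t * r)))) \<le> max a b * r\<^sup>2 * (2 * exp (- min a b * r / 2))" .
  qed auto
  then have "\<bar>((a * r)\<^sup>2 + 3 * (a * r) + 3) * exp (- a * r) - ((b * r)\<^sup>2 + 3 * (b * r) + 3) * exp (- b * r)\<bar> / (4 * pi * r ^ 4)
     \<le> (max a b * r\<^sup>2 * (2 * exp (- min a b * r / 2))) * \<bar>a - b\<bar> / (4 * pi * r ^ 4)"
    using r by (intro divide_right_mono) auto
  also have "\<dots> \<le> (max a b * r\<^sup>2 * (2 * exp (- min a b * r / 2))) * \<bar>a - b\<bar> / (1 * r ^ 4)"
    using r a pi_gt3 by (intro divide_left_mono mult_right_mono mult_nonneg_nonneg mult_pos_pos) auto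
  also have "\<dots> = 2 * \<bar>a - b\<bar> * max a b * exp (- min a b * r / 2) / r\<^sup>2"
    using r by (simp add: field_simps power2_eq_square power4_eq_xxxx)
  finally show ?thesis using r unfolding yukawa_slope'_def by (simp add: abs_divide)
qed

section \<open>The difference of two kernels and its weak gradient\<close>

definition yukawa_diff :: "real \<Rightarrow> real \<Rightarrow> real^3 \<Rightarrow> complex" where
  "yukawa_diff a b x = of_real (yukawa a x - yukawa b x)"

definition yukawa_diff_grad :: "real \<Rightarrow> real \<Rightarrow> real^3 \<Rightarrow> complex^3" where
  "yukawa_diff_grad a b x = (\<chi> i. of_real (x $ i * yukawa_slope a b (norm x)))"

lemma yukawa_diff_L2:
  assumes "0 < a" "0 < b"
  shows "yukawa_diff a b \<in> L2"
  using L2_add[OF cyukawa_L2[OF assms(1)] L2_cmult[OF cyukawa_L2[OF assms(2)], of "-1"]]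
  by (simp add: yukawa_diff_def[abs_def])

lemma yukawa_slope_measurable [measurable]: "yukawa_slope a b \<in> borel_measurable borel"
  unfolding yukawa_slope_def[abs_def] by measurable

lemma yukawa_slope'_measurable [measurable]: "yukawa_slope' a b \<in> borel_measurable borel"
  unfolding yukawa_slope'_def[abs_def] by measurable

lemma component_measurable [measurable]: "(\<lambda>x::real^3. x $ i) \<in> borel_measurable borel"
  by (intro borel_measurable_continuous_onI continuous_intros)

lemma yukawa_diff_grad_component_bound:
  assumes "0 < a" "0 < b"
  shows "cmod (yukawa_diff_grad a b x $ i) \<le> \<bar>a - b\<bar> * max a b * exp (- min a b * norm x)"
proof (cases "x = 0")
  case True
  then show ?thesis using assms by (simp add: yukawa_diff_grad_def)
next
  case False
  have "\<bar>x $ i\<bar> * \<bar>yukawa_slope a b (norm x)\<bar> \<le> norm x * (\<bar>a - b\<bar> * max a b * exp (- min a b * norm x) / norm x)"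
    using yukawa_slope_bound[OF assms, of "norm x"] False by (intro mult_mono component_le_norm_cart) auto
  then show ?thesis using False by (simp add: yukawa_diff_grad_def abs_mult norm_mult)
qed

lemma yukawa_diff_grad_L2:
  assumes "0 < a" "0 < b"
  shows "yukawa_diff_grad a b \<in> L2"
proof (rule L2_vec)
  fix i
  show "(\<lambda>x. yukawa_diff_grad a b x $ i) \<in> L2"
  proof (rule L2_dominated)
    show "(\<lambda>x::real^3. (\<bar>a - b\<bar> * max a b) *\<^sub>R exp (- min a b * norm x)) \<in> L2"
      using assms by (intro L2_scaleR exp_norm_L2) auto
    show "AE x in lborel. norm (yukawa_diff_grad a b x $ i) \<le> norm ((\<bar>a - b\<bar> * max a b) *\<^sub>R exp (- min a b * norm x))"
      using yukawa_diff_grad_component_bound[OF assms] assms by (intro AE_I2) (auto simp: abs_mult)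
    show "(\<lambda>x. yukawa_diff_grad a b x $ i) \<in> borel_measurable lborel"
      unfolding yukawa_diff_grad_def by simp measurable
  qed
qed

lemma norm_along_axis_has_derivative:
  fixes x :: "real^3"
  assumes "x \<noteq> 0"
  shows "((\<lambda>t. norm (x + t *\<^sub>R axis i 1)) has_real_derivative x $ i / norm x) (at 0)"
proof -
  have "(norm has_derivative (\<lambda>v. v \<bullet> sgn x)) (at (x + 0 *\<^sub>R axis i 1))"
    using has_derivative_norm[OF assms] by simp
  moreover have "((\<lambda>t. x + t *\<^sub>R axis i 1) has_derivative (\<lambda>s. s *\<^sub>R axis i 1)) (at 0)"
    by (auto intro!: derivative_eq_intros)
  ultimately have "((\<lambda>t. norm (x + t *\<^sub>R axis i 1)) has_derivative (\<lambda>s. (s *\<^sub>R axis i 1) \<bullet> sgn x)) (at 0)"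
    by (rule has_derivative_compose[rotated])
  moreover have "(\<lambda>s. (s *\<^sub>R axis i 1) \<bullet> sgn x) = (*) (x $ i / norm x)"
    by (simp add: fun_eq_iff sgn_div_norm inner_axis' divide_inverse mult_ac)
  ultimately show ?thesis unfolding has_field_derivative_def by (simp only:)
qed

lemma yukawa_diff_along_axis_has_derivative:
  assumes "x \<noteq> 0"
  shows "((\<lambda>t. yukawa_diff a b (x + t *\<^sub>R axis i 1)) has_vector_derivative yukawa_diff_grad a b x $ i) (at 0)"
proof -
  define f where "f r = (exp (- a * r) - exp (- b * r)) / (4 * pi * r)" for r :: real
  have yukawa_diff: "yukawa_diff a b y = of_real (f (norm y))" for y
    by (simp add: yukawa_diff_def yukawa_def f_def diff_divide_distrib)
  have "(f has_real_derivative norm x * yukawa_slope a b (norm x)) (at (norm (x + 0 *\<^sub>R axis i 1)))"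
    unfolding f_def[abs_def] using yukawa_difference_profile_has_derivative[of "norm x" a b] assms by simp
  from DERIV_chain2[OF this norm_along_axis_has_derivative[OF assms]]
  have "((\<lambda>t. f (norm (x + t *\<^sub>R axis i 1))) has_real_derivative x $ i * yukawa_slope a b (norm x)) (at 0)"
    using assms by (simp add: mult_ac)
  then show ?thesis unfolding yukawa_diff yukawa_diff_grad_def vec_lambda_beta by (rule has_vector_derivative_of_real)
qed

text \<open>The origin is excluded because the function has the value 0 there instead of its limit
  (b - a) / (4 \<pi>). The estimate is made for the profile on the half-line of positive radii and
  transferred by | |x| - |y| | \<le> |x - y|, so a segment from x to y through the origin does no
  harm.\<close>

lemma yukawa_diff_Lipschitz:
  assumes a: "0 < a" "0 < b" and x: "x \<noteq> 0" "y \<noteq> 0"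
  shows "cmod (yukawa_diff a b x - yukawa_diff a b y) \<le> \<bar>a - b\<bar> * max a b * norm (x - y)"
proof -
  define f where "f r = (exp (- a * r) - exp (- b * r)) / (4 * pi * r)" for r :: real
  have yukawa_diff: "yukawa_diff a b y = of_real (f (norm y))" for y
    by (simp add: yukawa_diff_def yukawa_def f_def diff_divide_distrib)
  have "norm (f (norm x) - f (norm y)) \<le> (\<bar>a - b\<bar> * max a b) * norm (norm x - norm y)"
  proof (rule field_differentiable_bound[where S="{0<..}" and f'="\<lambda>r. r * yukawa_slope a b r"])
    show "(f has_field_derivative r * yukawa_slope a b r) (at r within {0<..})" if "r \<in> {0<..}" for r
      unfolding f_def[abs_def] using yukawa_difference_profile_has_derivative[of r a b] that
      by (auto intro: has_field_derivative_at_within)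
    show "norm (r * yukawa_slope a b r) \<le> \<bar>a - b\<bar> * max a b" if "r \<in> {0<..}" for r
    proof -
      have "norm (r * yukawa_slope a b r) \<le> r * (\<bar>a - b\<bar> * max a b * exp (- min a b * r) / r)"
        using mult_left_mono[OF yukawa_slope_bound[OF a, of r], of r] that by (simp add: abs_mult)
      also have "\<dots> = \<bar>a - b\<bar> * max a b * exp (- min a b * r)" using that by simp
      also have "\<dots> \<le> \<bar>a - b\<bar> * max a b * 1"
        using a that by (intro mult_left_mono) auto
      finally show ?thesis by simp
    qed
  qed (use x in auto)
  also have "\<dots> \<le> (\<bar>a - b\<bar> * max a b) * norm (x - y)"
    using a by (intro mult_left_mono) (auto simp: norm_triangle_ineq3)
  finally show ?thesis unfolding yukawa_diff
    by (simp only: of_real_diff[symmetric] norm_of_real real_norm_def)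
qed

text \<open>The difference quotients are moved from the test function onto the Lipschitz function \<open>yukawa_diff\<close>.\<close>

lemma yukawa_diff_weak_gradient:
  assumes a: "0 < a" "0 < b"
  shows "weak_gradient (yukawa_diff a b) (yukawa_diff_grad a b)"
  unfolding weak_gradient_def
proof (intro allI impI)
  fix \<eta> i assume \<eta>: "test_function \<eta>"
  let ?e = "axis i 1 :: real^3"
  define s where "s n = 1 / real (Suc n)" for n
  have s: "s \<longlonglongrightarrow> 0" "\<And>n. s n \<noteq> 0" "\<And>n. \<bar>s n\<bar> \<le> 1"
    unfolding s_def[abs_def] using LIMSEQ_inverse_real_of_nat by (auto simp: inverse_eq_divide)
  note WL = yukawa_diff_L2[OF a]
  have [measurable]: "yukawa_diff a b \<in> borel_measurable borel" using L2_D[OF WL] by simp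
  have DWm: "(\<lambda>x. yukawa_diff_grad a b x $ i) \<in> borel_measurable borel" using L2_D[OF L2_component[OF yukawa_diff_grad_L2[OF a], of i]] by simp
  note [measurable] = test_functionD(4)[OF \<eta>]
  have "(\<lambda>n. \<integral>x. yukawa_diff a b x * ((\<eta> (x + s n *\<^sub>R ?e) - \<eta> x) / of_real (s n)) \<partial>lborel)
    \<longlonglongrightarrow> (\<integral>x. yukawa_diff a b x * partial i \<eta> x \<partial>lborel)"
    by (rule tendsto_integral_difference_quotient[OF L2_locally_integrable[OF WL] \<eta> s])
  moreover have "(\<integral>x. yukawa_diff a b x * ((\<eta> (x + s n *\<^sub>R ?e) - \<eta> x) / of_real (s n)) \<partial>lborel)
     = (\<integral>x. - ((yukawa_diff a b (x + (- s n) *\<^sub>R ?e) - yukawa_diff a b x) / of_real (- s n)) * \<eta> x \<partial>lborel)" for n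
  proof -
    note li = locally_integrable_test_integrable[OF L2_locally_integrable[OF WL]]
    have i1: "integrable lborel (\<lambda>x. yukawa_diff a b x * \<eta> (x + s n *\<^sub>R ?e))"
      by (rule li[OF test_function_translate[OF \<eta>]])
    have i3: "integrable lborel (\<lambda>x. yukawa_diff a b (x + (- s n) *\<^sub>R ?e) * \<eta> x)"
      using integrable_affine[OF _ i1, of 1 "(- s n) *\<^sub>R ?e"] by (simp add: add.commute)
    have "(\<integral>x. yukawa_diff a b x * ((\<eta> (x + s n *\<^sub>R ?e) - \<eta> x) / of_real (s n)) \<partial>lborel)
      = (\<integral>x. (yukawa_diff a b x * \<eta> (x + s n *\<^sub>R ?e) - yukawa_diff a b x * \<eta> x) / of_real (s n) \<partial>lborel)"
      by (simp add: algebra_simps)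
    also have "\<dots> = ((\<integral>x. yukawa_diff a b x * \<eta> (x + s n *\<^sub>R ?e) \<partial>lborel) - (\<integral>x. yukawa_diff a b x * \<eta> x \<partial>lborel)) / of_real (s n)"
      using i1 li[OF \<eta>] by (subst Bochner_Integration.integral_divide_zero) simp
    also have "(\<integral>x. yukawa_diff a b x * \<eta> (x + s n *\<^sub>R ?e) \<partial>lborel) = (\<integral>x. yukawa_diff a b (x + (- s n) *\<^sub>R ?e) * \<eta> x \<partial>lborel)"
      using integral_translate[of "\<lambda>x. yukawa_diff a b x * \<eta> (x + s n *\<^sub>R ?e)" "(- s n) *\<^sub>R ?e"] by simp
    also have "((\<integral>x. yukawa_diff a b (x + (- s n) *\<^sub>R ?e) * \<eta> x \<partial>lborel) - (\<integral>x. yukawa_diff a b x * \<eta> x \<partial>lborel)) / of_real (s n)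
       = (\<integral>x. (yukawa_diff a b (x + (- s n) *\<^sub>R ?e) * \<eta> x - yukawa_diff a b x * \<eta> x) / of_real (s n) \<partial>lborel)"
      using i3 li[OF \<eta>] by (subst Bochner_Integration.integral_divide_zero) simp
    also have "\<dots> = (\<integral>x. - ((yukawa_diff a b (x + (- s n) *\<^sub>R ?e) - yukawa_diff a b x) / of_real (- s n)) * \<eta> x \<partial>lborel)"
      using s(2)[of n] by (intro Bochner_Integration.integral_cong refl) (simp add: field_simps)
    finally show ?thesis .
  qed
  moreover have "(\<lambda>n. \<integral>x. - ((yukawa_diff a b (x + (- s n) *\<^sub>R ?e) - yukawa_diff a b x) / of_real (- s n)) * \<eta> x \<partial>lborel)
     \<longlonglongrightarrow> (\<integral>x. - (yukawa_diff_grad a b x $ i) * \<eta> x \<partial>lborel)"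
  proof (rule integral_dominated_convergence[where w="\<lambda>x. (\<bar>a - b\<bar> * max a b) * norm (\<eta> x)"])
    show "(\<lambda>x. - (yukawa_diff_grad a b x $ i) * \<eta> x) \<in> borel_measurable lborel"
      using DWm by measurable
    show "(\<lambda>x. - ((yukawa_diff a b (x + (- s n) *\<^sub>R ?e) - yukawa_diff a b x) / of_real (- s n)) * \<eta> x) \<in> borel_measurable lborel" for n
      by measurable
    have "locally_integrable (\<lambda>_. 1)"
      unfolding locally_integrable_def
      by (auto intro!: integrable_real_indicator emeasure_bounded_finite integrable_scaleR_left)
    from locally_integrable_test_integrable[OF this \<eta>]
    show "integrable lborel (\<lambda>x. (\<bar>a - b\<bar> * max a b) * norm (\<eta> x))"
      by (intro integrable_mult_right integrable_norm) simp
    show "AE x in lborel. (\<lambda>n. - ((yukawa_diff a b (x + (- s n) *\<^sub>R ?e) - yukawa_diff a b x) / of_real (- s n)) * \<eta> x)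
        \<longlonglongrightarrow> - (yukawa_diff_grad a b x $ i) * \<eta> x"
    proof (rule AE_mp[OF AE_lborel_singleton[of 0]], intro AE_I2 impI)
      fix x :: "real^3" assume "x \<noteq> 0"
      from has_vector_derivative_imp_quotient_tendsto[OF yukawa_diff_along_axis_has_derivative[OF this, of a b i], of "\<lambda>n. - s n"] s
      have "(\<lambda>n. (yukawa_diff a b (x + (- s n) *\<^sub>R ?e) - yukawa_diff a b x) / of_real (- s n)) \<longlonglongrightarrow> yukawa_diff_grad a b x $ i"
        using tendsto_minus[OF s(1)] by simp
      then show "(\<lambda>n. - ((yukawa_diff a b (x + (- s n) *\<^sub>R ?e) - yukawa_diff a b x) / of_real (- s n)) * \<eta> x)
        \<longlonglongrightarrow> - (yukawa_diff_grad a b x $ i) * \<eta> x"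
        by (intro tendsto_mult tendsto_minus tendsto_const)
    qed
    show "AE x in lborel. norm (- ((yukawa_diff a b (x + (- s n) *\<^sub>R ?e) - yukawa_diff a b x) / of_real (- s n)) * \<eta> x)
        \<le> (\<bar>a - b\<bar> * max a b) * norm (\<eta> x)" for n
      \<comment> \<open>The Lipschitz bound fails to apply only if x or its translate is the origin,
        that is, at two points.\<close>
      using AE_lborel_singleton[of "0::real^3"] AE_lborel_singleton[of "s n *\<^sub>R ?e"]
    proof eventually_elim
      case (elim x)
      have "cmod (yukawa_diff a b (x + (- s n) *\<^sub>R ?e) - yukawa_diff a b x) \<le> \<bar>a - b\<bar> * max a b * norm ((x + (- s n) *\<^sub>R ?e) - x)"
        using elim by (intro yukawa_diff_Lipschitz[OF a]) auto
      then have "cmod (yukawa_diff a b (x + (- s n) *\<^sub>R ?e) - yukawa_diff a b x) / \<bar>s n\<bar> \<le> \<bar>a - b\<bar> * max a b"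
        using s(2)[of n] by (simp add: field_simps)
      then have "cmod (yukawa_diff a b (x + (- s n) *\<^sub>R ?e) - yukawa_diff a b x) / \<bar>s n\<bar> * norm (\<eta> x) \<le> (\<bar>a - b\<bar> * max a b) * norm (\<eta> x)"
        by (rule mult_right_mono) simp
      then show ?case by (simp only: norm_mult norm_minus_cancel norm_divide norm_of_real abs_minus_cancel)
    qed
  qed
  ultimately have "(\<integral>x. yukawa_diff a b x * partial i \<eta> x \<partial>lborel) = (\<integral>x. - (yukawa_diff_grad a b x $ i) * \<eta> x \<partial>lborel)"
    by (simp only: LIMSEQ_unique)
  then show "(\<integral>x. yukawa_diff a b x * partial i \<eta> x \<partial>lborel) = - (\<integral>x. yukawa_diff_grad a b x $ i * \<eta> x \<partial>lborel)"
    by simp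
qed

section \<open>Testing weak gradients against differences of Green functions\<close>

lemma isCont_bump': "isCont bump' s"
  unfolding bump'_eq_bump_deriv by (rule DERIV_isCont[OF bump_deriv_has_derivative])

text \<open>Depends on x only through |x|^2, so that it is smooth at the origin as well, and
  vanishes once |x| \<ge> n + 1. \<open>Suc n\<close> keeps the denominator nonzero.\<close>

definition cutoff :: "nat \<Rightarrow> real^3 \<Rightarrow> real" where
  "cutoff n x = bump (1 - (norm x)\<^sup>2 / (real (Suc n))\<^sup>2)"

definition cutoff' :: "nat \<Rightarrow> real^3 \<Rightarrow> real" where
  "cutoff' n x = bump' (1 - (norm x)\<^sup>2 / (real (Suc n))\<^sup>2)"

definition reg_radius :: "nat \<Rightarrow> real^3 \<Rightarrow> real" where
  "reg_radius n x = sqrt ((norm x)\<^sup>2 + 1 / (real (Suc n))\<^sup>2)"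

text \<open>Smooth compactly supported approximation of \<open>exp (-1)\<close> times the gradient of \<open>yukawa a - yukawa b\<close>:
  the radius is regularised to \<open>reg_radius n\<close>, and the cutoffs tend to \<open>bump 1 = exp (-1)\<close>.\<close>

definition approx_field :: "real \<Rightarrow> real \<Rightarrow> nat \<Rightarrow> 3 \<Rightarrow> real^3 \<Rightarrow> real" where
  "approx_field a b n i x = x $ i * yukawa_slope a b (reg_radius n x) * cutoff n x"

definition approx_field_div :: "real \<Rightarrow> real \<Rightarrow> nat \<Rightarrow> real^3 \<Rightarrow> real" where
  "approx_field_div a b n x = (3 * yukawa_slope a b (reg_radius n x) + (norm x)\<^sup>2 * yukawa_slope' a b (reg_radius n x) / reg_radius n x) * cutoff n x
     - 2 * ((norm x)\<^sup>2 / (real (Suc n))\<^sup>2) * yukawa_slope a b (reg_radius n x) * cutoff' n x"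

lemma reg_radius_pos: "reg_radius n x > 0"
  unfolding reg_radius_def by (simp add: add_nonneg_pos)

lemma norm_le_reg_radius: "norm x \<le> reg_radius n x"
  unfolding reg_radius_def by (rule real_le_rsqrt) simp

lemma reg_radius_tendsto: "(\<lambda>n. reg_radius n x) \<longlonglongrightarrow> norm x"
proof -
  have "(\<lambda>n. 1 / (real (Suc n))\<^sup>2) \<longlonglongrightarrow> 0" by real_asymp
  then have "(\<lambda>n. sqrt ((norm x)\<^sup>2 + 1 / (real (Suc n))\<^sup>2)) \<longlonglongrightarrow> sqrt ((norm x)\<^sup>2 + 0)"
    by (intro tendsto_intros)
  then show ?thesis by (simp add: reg_radius_def)
qed

lemma cutoff_arg_tendsto: "(\<lambda>n. 1 - (norm (x::real^3))\<^sup>2 / (real (Suc n))\<^sup>2) \<longlonglongrightarrow> 1"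
  by real_asymp

lemma cutoff_tendsto: "(\<lambda>n. cutoff n x) \<longlonglongrightarrow> exp (-1)"
  unfolding cutoff_def
  using isCont_tendsto_compose[OF DERIV_isCont[OF bump_has_derivative] cutoff_arg_tendsto[of x]]
  by (simp add: bump_def)

lemma cutoff'_tendsto: "(\<lambda>n. cutoff' n x) \<longlonglongrightarrow> exp (-1)"
  unfolding cutoff'_def
  using isCont_tendsto_compose[OF isCont_bump' cutoff_arg_tendsto[of x]]
  by (simp add: bump'_def)

lemma cutoff_bounds: "0 \<le> cutoff n x" "cutoff n x \<le> 1" "0 \<le> cutoff' n x" "cutoff' n x \<le> 2"
  by (simp_all add: cutoff_def cutoff'_def bump_bounds bump'_bounds)

lemma cutoff_outside:
  assumes "norm x \<ge> real (Suc n)"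
  shows "cutoff n x = 0" "cutoff' n x = 0"
proof -
  have "(real (Suc n))\<^sup>2 \<le> (norm x)\<^sup>2" using assms by (intro power_mono) auto
  then have *: "1 - (norm x)\<^sup>2 / (real (Suc n))\<^sup>2 \<le> 0" by (simp add: le_divide_eq)
  show "cutoff n x = 0" unfolding cutoff_def by (rule bump_le_0[OF *])
  show "cutoff' n x = 0" using * unfolding cutoff'_def bump'_def by (simp only: not_less[symmetric] if_False)
qed

lemma C_k_reg_radius_power2: "C_k k (\<lambda>x. complex_of_real ((norm x)\<^sup>2 + 1 / (real (Suc n))\<^sup>2))"
  using C_k_add[OF C_k_norm_square C_k_const[of k "of_real (1 / (real (Suc n))\<^sup>2)"]]
  by (simp only: of_real_add[symmetric])

text \<open>The square of \<open>reg_radius n\<close> is a positive polynomial in x, so all its real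
  powers are smooth; the slope is assembled from the powers 1/2 and -3/2 of it and from
  exponentials. This is why the radius is regularised.\<close>

lemma approx_field_C_k: "C_k k (\<lambda>x. complex_of_real (approx_field a b n i x))"
proof -
  let ?q = "\<lambda>x::real^3. (norm x)\<^sup>2 + 1 / (real (Suc n))\<^sup>2"
  have q: "?q x > 0" for x by (simp add: add_nonneg_pos)
  have reg_radius: "reg_radius n x = ?q x powr (1/2)" for x
    using q[of x] by (simp add: reg_radius_def powr_half_sqrt)
  have C1: "C_k k (\<lambda>x. complex_of_real (reg_radius n x))"
    unfolding reg_radius by (rule C_k_powr[OF C_k_reg_radius_power2 q])
  have C2: "C_k k (\<lambda>x. complex_of_real (exp (- c * reg_radius n x)))" for c
  proof (rule C_k_exp)
    show "C_k k (\<lambda>x. complex_of_real (- c * reg_radius n x))"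
      using C_k_mult[OF C_k_const[of k "of_real (- c)"] C1] by (simp only: of_real_mult[symmetric])
  qed
  have r3: "1 / reg_radius n x ^ 3 = ?q x powr (- 3/2)" for x
  proof -
    have "reg_radius n x ^ 3 = (?q x powr (1/2)) powr real 3" unfolding reg_radius using q[of x] by (subst powr_realpow) auto
    also have "\<dots> = ?q x powr (3/2)" by (simp add: powr_powr)
    finally show ?thesis by (simp add: powr_minus_divide)
  qed
  have C3: "C_k k (\<lambda>x. complex_of_real (1 / reg_radius n x ^ 3))"
    unfolding r3 by (rule C_k_powr[OF C_k_reg_radius_power2 q])
  have C4: "C_k k (\<lambda>x. complex_of_real (cutoff n x))"
    unfolding cutoff_def
  proof (rule C_k_bump)
    have "C_k k (\<lambda>x. of_real 1 + of_real (- 1 / (real (Suc n))\<^sup>2) * complex_of_real ((norm x)\<^sup>2))"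
      by (intro C_k_add C_k_mult C_k_const C_k_norm_square)
    then show "C_k k (\<lambda>x. complex_of_real (1 - (norm x)\<^sup>2 / (real (Suc n))\<^sup>2))"
      by simp
  qed
  have "C_k k (\<lambda>x. complex_of_real (x $ i) * (of_real (- 1 / (4 * pi)) *
     (((of_real a * of_real (reg_radius n x) + 1) * of_real (exp (- a * reg_radius n x))
       + of_real (-1) * ((of_real b * of_real (reg_radius n x) + 1) * of_real (exp (- b * reg_radius n x))))
       * of_real (1 / reg_radius n x ^ 3))) * of_real (cutoff n x))"
    by (intro C_k_mult C_k_add C_k_const C_k_component C1 C2 C3 C4)
  moreover have "approx_field a b n i x = x $ i * (- 1 / (4 * pi) *
     (((a * reg_radius n x + 1) * exp (- a * reg_radius n x) + (-1) * ((b * reg_radius n x + 1) * exp (- b * reg_radius n x)))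
       * (1 / reg_radius n x ^ 3))) * cutoff n x" for x
    by (simp add: approx_field_def yukawa_slope_def diff_divide_distrib add_divide_distrib algebra_simps)
  ultimately show ?thesis by (simp only: of_real_mult of_real_add of_real_1)
qed

lemma approx_field_test_function: "test_function (\<lambda>x. complex_of_real (approx_field a b n i x))"
proof (rule test_functionI[where S="cball 0 (real (Suc n))"])
  show "complex_of_real (approx_field a b n i x) = 0" if "x \<notin> cball 0 (real (Suc n))" for x
    using that cutoff_outside[of n x] by (simp add: approx_field_def)
qed (auto intro: approx_field_C_k)

lemma norm_power2_along_axis:
  fixes x :: "real^3"
  shows "(norm (x + t *\<^sub>R axis i 1))\<^sup>2 = (norm x)\<^sup>2 + 2 * (x $ i) * t + t\<^sup>2"
  unfolding power2_norm_eq_inner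
  by (simp add: inner_add_left inner_add_right inner_axis inner_axis' inner_axis_axis power2_eq_square algebra_simps)

text \<open>Differentiability is already known from the test function property, so the partial
  derivative equals the derivative along the axis through x, where one-variable rules apply.\<close>

lemma partial_approx_field:
  "partial i (\<lambda>x. complex_of_real (approx_field a b n i x)) x = of_real (
     yukawa_slope a b (reg_radius n x) * cutoff n x + (x $ i)\<^sup>2 * (yukawa_slope' a b (reg_radius n x) / reg_radius n x) * cutoff n x
     - 2 * ((x $ i)\<^sup>2 / (real (Suc n))\<^sup>2) * yukawa_slope a b (reg_radius n x) * cutoff' n x)"
proof -
  let ?e = "axis i 1 :: real^3"
  let ?N = "(real (Suc n))\<^sup>2"
  have d_sq: "((\<lambda>t. (norm (x + t *\<^sub>R ?e))\<^sup>2) has_real_derivative 2 * (x $ i)) (at 0)"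
    unfolding norm_power2_along_axis by (auto intro!: derivative_eq_intros)
  have pos: "0 < (norm (x + 0 *\<^sub>R ?e))\<^sup>2 + 1 / ?N" by (simp add: add_nonneg_pos)
  have d_rho: "((\<lambda>t. reg_radius n (x + t *\<^sub>R ?e)) has_real_derivative x $ i / reg_radius n x) (at 0)"
    unfolding reg_radius_def
    by (rule DERIV_cong[OF DERIV_chain2[OF DERIV_real_sqrt[OF pos] DERIV_add[OF d_sq DERIV_const]]])
       (simp add: inverse_eq_divide)
  have k: "(yukawa_slope a b has_real_derivative yukawa_slope' a b (reg_radius n x)) (at (reg_radius n (x + 0 *\<^sub>R ?e)))"
    using yukawa_slope_has_derivative[OF reg_radius_pos] by simp
  have d_k1: "((\<lambda>t. yukawa_slope a b (reg_radius n (x + t *\<^sub>R ?e))) has_real_derivative yukawa_slope' a b (reg_radius n x) * (x $ i / reg_radius n x)) (at 0)"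
    by (rule DERIV_chain2[OF k d_rho])
  have d_arg: "((\<lambda>t. 1 - (norm (x + t *\<^sub>R ?e))\<^sup>2 / ?N) has_real_derivative - (2 * (x $ i) / ?N)) (at 0)"
    by (rule DERIV_cong[OF DERIV_diff[OF DERIV_const DERIV_cdivide[OF d_sq]]]) simp
  have bm: "(bump has_real_derivative cutoff' n x) (at (1 - (norm (x + 0 *\<^sub>R ?e))\<^sup>2 / ?N))"
    unfolding cutoff'_def using bump_has_derivative[of "1 - (norm x)\<^sup>2 / ?N"] by simp
  have d_cut: "((\<lambda>t. cutoff n (x + t *\<^sub>R ?e)) has_real_derivative cutoff' n x * - (2 * (x $ i) / ?N)) (at 0)"
    unfolding cutoff_def by (rule DERIV_chain2[OF bm d_arg])
  have "(\<lambda>t. (x + t *\<^sub>R ?e) $ i) = (\<lambda>t. x $ i + t)" by (simp add: fun_eq_iff axis_def)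
  then have d_x: "((\<lambda>t. (x + t *\<^sub>R ?e) $ i) has_real_derivative 1) (at 0)"
    by (auto intro!: derivative_eq_intros)
  have "((\<lambda>t. approx_field a b n i (x + t *\<^sub>R ?e)) has_real_derivative
     yukawa_slope a b (reg_radius n x) * cutoff n x + (x $ i)\<^sup>2 * (yukawa_slope' a b (reg_radius n x) / reg_radius n x) * cutoff n x
     - 2 * ((x $ i)\<^sup>2 / (real (Suc n))\<^sup>2) * yukawa_slope a b (reg_radius n x) * cutoff' n x) (at 0)" (is "(_ has_real_derivative ?D) _")
    unfolding approx_field_def
    by (rule DERIV_cong[OF DERIV_mult[OF DERIV_mult[OF d_x d_k1] d_cut]])
       (simp add: power2_eq_square algebra_simps)
  then have 1: "((\<lambda>t. complex_of_real (approx_field a b n i (x + t *\<^sub>R ?e))) has_vector_derivative of_real ?D) (at 0)"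
    by (rule has_vector_derivative_of_real)
  have "((\<lambda>t. complex_of_real (approx_field a b n i (x + t *\<^sub>R ?e))) has_vector_derivative
      partial i (\<lambda>x. complex_of_real (approx_field a b n i x)) x) (at 0)"
    using has_vector_derivative_along_axis[OF test_functionD(2)[OF approx_field_test_function[of a b n i]], of x i 0] by simp
  from vector_derivative_unique_at[OF this 1] show ?thesis .
qed

lemma sum_partial_approx_field:
  "(\<Sum>i\<in>UNIV. partial i (\<lambda>x. complex_of_real (approx_field a b n i x)) x) = of_real (approx_field_div a b n x)"
proof -
  have n2: "(norm x)\<^sup>2 = (\<Sum>i\<in>UNIV. (x $ i)\<^sup>2)"
    by (simp add: norm_vec_def L2_set_def sum_nonneg)
  show ?thesis
    unfolding partial_approx_field of_real_sum[symmetric] approx_field_div_def n2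
    by (intro arg_cong[where f=of_real])
       (simp add: sum.distrib sum_subtractf sum_distrib_right sum_distrib_left sum_divide_distrib algebra_simps)
qed

lemma approx_field_bound:
  assumes a: "0 < a" "0 < b"
  shows "\<bar>approx_field a b n i x\<bar> \<le> \<bar>a - b\<bar> * max a b * exp (- min a b * norm x)"
proof -
  have "\<bar>x $ i\<bar> * \<bar>yukawa_slope a b (reg_radius n x)\<bar> * \<bar>cutoff n x\<bar>
     \<le> reg_radius n x * (\<bar>a - b\<bar> * max a b * exp (- min a b * reg_radius n x) / reg_radius n x) * 1"
    using cutoff_bounds[of n x] order_trans[OF component_le_norm_cart norm_le_reg_radius] reg_radius_pos[of n x]
      yukawa_slope_bound[OF a reg_radius_pos] a
    by (intro mult_mono) auto
  also have "\<dots> = \<bar>a - b\<bar> * max a b * exp (- min a b * reg_radius n x)" using reg_radius_pos[of n x] by simp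
  also have "\<dots> \<le> \<bar>a - b\<bar> * max a b * exp (- min a b * norm x)"
    using a norm_le_reg_radius[of x n] by (intro mult_left_mono) auto
  finally show ?thesis by (simp add: approx_field_def abs_mult)
qed

text \<open>The majorant must be independent of n and square-integrable, since it will be multiplied
  by a function in \<open>L2\<close>. With E as defined in the proof, 9 = 3 + 2 + 4: the slope term
  gives 3, the term with its derivative 2, and the cutoff term 4, because |x| \<le> n + 1 wherever
  \<open>cutoff'\<close> is nonzero and \<open>cutoff'\<close> is at most 2.\<close>

lemma approx_field_div_bound:
  assumes a: "0 < a" "0 < b" and x: "x \<noteq> 0"
  shows "\<bar>approx_field_div a b n x\<bar> \<le> 9 * \<bar>a - b\<bar> * max a b * (exp (- (min a b / 2) * norm x) / norm x)"
proof -
  define K where "K = \<bar>a - b\<bar> * max a b"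
  define m where "m = min a b"
  define R where "R = reg_radius n x"
  define E where "E = K * exp (- m * R / 2) / R"
  have K: "K \<ge> 0" using a by (simp add: K_def)
  have m: "m > 0" using a by (simp add: m_def)
  have R: "R > 0" "norm x \<le> R" using reg_radius_pos norm_le_reg_radius by (auto simp: R_def)
  have E0: "E \<ge> 0" using K R by (simp add: E_def)
  have "\<bar>yukawa_slope a b R\<bar> \<le> K * exp (- m * R) / R"
    using yukawa_slope_bound[OF a R(1)] by (simp add: K_def m_def)
  also have "\<dots> \<le> E"
    unfolding E_def using K R m by (intro divide_right_mono mult_left_mono) auto
  finally have b1: "\<bar>yukawa_slope a b R\<bar> \<le> E" .
  have "\<bar>(norm x)\<^sup>2 * yukawa_slope' a b R / R\<bar> = (norm x)\<^sup>2 * \<bar>yukawa_slope' a b R\<bar> / R"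
    using R by (simp add: abs_mult)
  also have "\<dots> \<le> R\<^sup>2 * (2 * \<bar>a - b\<bar> * max a b * exp (- min a b * R / 2) / R\<^sup>2) / R"
    using R yukawa_slope'_bound[OF a R(1)] by (intro divide_right_mono mult_mono power_mono) auto
  also have "\<dots> = 2 * E" using R by (simp add: E_def K_def m_def)
  finally have b2: "\<bar>(norm x)\<^sup>2 * yukawa_slope' a b R / R\<bar> \<le> 2 * E" .
  have "\<bar>(norm x)\<^sup>2 / (real (Suc n))\<^sup>2 * cutoff' n x\<bar> \<le> 2"
  proof (cases "norm x \<ge> real (Suc n)")
    case True
    then show ?thesis using cutoff_outside by simp
  next
    case False
    then have "(norm x)\<^sup>2 \<le> (real (Suc n))\<^sup>2" by (intro power_mono) auto
    then have "(norm x)\<^sup>2 / (real (Suc n))\<^sup>2 \<le> 1" by (simp add: divide_le_eq)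
    then have "(norm x)\<^sup>2 / (real (Suc n))\<^sup>2 * cutoff' n x \<le> 1 * 2"
      using cutoff_bounds[of n x] by (intro mult_mono) auto
    then show ?thesis using cutoff_bounds[of n x] by (subst abs_of_nonneg) auto
  qed
  then have b3: "\<bar>2 * ((norm x)\<^sup>2 / (real (Suc n))\<^sup>2) * yukawa_slope a b R * cutoff' n x\<bar> \<le> 4 * E"
    using mult_mono[OF b1, of "\<bar>(norm x)\<^sup>2 / (real (Suc n))\<^sup>2 * cutoff' n x\<bar>" 2] E0
    by (simp add: abs_mult mult_ac)
  have "\<bar>3 * yukawa_slope a b R + (norm x)\<^sup>2 * yukawa_slope' a b R / R\<bar> \<le> 5 * E" using b1 b2 by linarith
  then have b4: "\<bar>(3 * yukawa_slope a b R + (norm x)\<^sup>2 * yukawa_slope' a b R / R) * cutoff n x\<bar> \<le> 5 * E * 1"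
    unfolding abs_mult using cutoff_bounds[of n x] E0 by (intro mult_mono) auto
  have "\<bar>approx_field_div a b n x\<bar> \<le> 5 * E * 1 + 4 * E"
    unfolding approx_field_div_def R_def[symmetric]
    by (rule order_trans[OF abs_triangle_ineq4 add_mono[OF b4 b3]])
  also have "\<dots> = 9 * E" by simp
  also have "E \<le> K * exp (- m * norm x / 2) / norm x"
    unfolding E_def
  proof (rule frac_le)
    show "0 \<le> K * exp (- m * norm x / 2)" "0 < norm x" "norm x \<le> R" using K x R by simp_all
    show "K * exp (- m * R / 2) \<le> K * exp (- m * norm x / 2)"
      using K R m by (intro mult_left_mono) simp_all
  qed
  finally show ?thesis by (simp add: K_def m_def mult_ac)
qed

lemma approx_field_tendsto:
  assumes "x \<noteq> 0"
  shows "(\<lambda>n. approx_field a b n i x) \<longlonglongrightarrow> x $ i * yukawa_slope a b (norm x) * exp (-1)"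
proof -
  have "isCont (yukawa_slope a b) (norm x)" by (rule DERIV_isCont[OF yukawa_slope_has_derivative]) (simp add: assms)
  then have "(\<lambda>n. yukawa_slope a b (reg_radius n x)) \<longlonglongrightarrow> yukawa_slope a b (norm x)"
    by (rule isCont_tendsto_compose[OF _ reg_radius_tendsto])
  then show ?thesis unfolding approx_field_def by (intro tendsto_intros cutoff_tendsto)
qed

lemma approx_field_div_tendsto:
  assumes x: "x \<noteq> 0"
  shows "(\<lambda>n. approx_field_div a b n x) \<longlonglongrightarrow> (a\<^sup>2 * yukawa a x - b\<^sup>2 * yukawa b x) * exp (-1)"
proof -
  have r: "norm x > 0" using x by simp
  have "isCont (yukawa_slope a b) (norm x)" by (rule DERIV_isCont[OF yukawa_slope_has_derivative[OF r]])
  then have l1: "(\<lambda>n. yukawa_slope a b (reg_radius n x)) \<longlonglongrightarrow> yukawa_slope a b (norm x)"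
    by (rule isCont_tendsto_compose[OF _ reg_radius_tendsto])
  have "isCont (yukawa_slope' a b) (norm x)"
    unfolding yukawa_slope'_def[abs_def] using r by (intro continuous_intros) auto
  then have l2: "(\<lambda>n. yukawa_slope' a b (reg_radius n x)) \<longlonglongrightarrow> yukawa_slope' a b (norm x)"
    by (rule isCont_tendsto_compose[OF _ reg_radius_tendsto])
  have l3: "(\<lambda>n. (norm x)\<^sup>2 / (real (Suc n))\<^sup>2) \<longlonglongrightarrow> 0" by real_asymp
  have "(\<lambda>n. approx_field_div a b n x) \<longlonglongrightarrow>
     (3 * yukawa_slope a b (norm x) + (norm x)\<^sup>2 * yukawa_slope' a b (norm x) / norm x) * exp (-1) - 2 * 0 * yukawa_slope a b (norm x) * exp (-1)"
    unfolding approx_field_div_def using r by (intro tendsto_intros l1 l2 l3 reg_radius_tendsto cutoff_tendsto cutoff'_tendsto) auto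
  also have "(norm x)\<^sup>2 * yukawa_slope' a b (norm x) / norm x = norm x * yukawa_slope' a b (norm x)"
    using r by (simp add: power2_eq_square)
  also have "3 * yukawa_slope a b (norm x) + norm x * yukawa_slope' a b (norm x) = a\<^sup>2 * yukawa a x - b\<^sup>2 * yukawa b x"
    unfolding yukawa_slope_sum[OF r] by (simp add: yukawa_def diff_divide_distrib)
  finally show ?thesis by simp
qed

lemma approx_field_measurable [measurable]: "(\<lambda>x. approx_field a b n i x) \<in> borel_measurable borel"
  unfolding approx_field_def reg_radius_def cutoff_def bump_def by measurable

lemma approx_field_div_measurable [measurable]: "(\<lambda>x. approx_field_div a b n x) \<in> borel_measurable borel"
  unfolding approx_field_div_def reg_radius_def cutoff_def cutoff'_def bump_def bump'_def by measurable

text \<open>For each n the approximating fields are admissible in the definition of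
  \<open>weak_gradient\<close>; summing over the coordinates produces their divergence. Both sides
  converge by dominated convergence, with an \<open>L2\<close> function times the majorants
  \<open>B1\<close> and \<open>B2\<close>, and the common factor exp (-1) left by the cutoffs is
  cancelled at the end. The point masses in the Laplacians of the two kernels cancel, so no value of
  \<phi> at the origin appears. The pairing is bilinear, without conjugation, as in
  \<open>weak_gradient\<close>.\<close>

lemma weak_gradient_inner_yukawa_diff_grad:
  assumes \<phi>: "\<phi> \<in> L2" and g: "g \<in> L2" and wg: "weak_gradient \<phi> g" and a: "0 < a" "0 < b"
  shows "(\<integral>x. (\<Sum>i\<in>UNIV. g x $ i * yukawa_diff_grad a b x $ i) \<partial>lborel)
    = (\<integral>x. \<phi> x * (of_real (b\<^sup>2) * cyukawa b x - of_real (a\<^sup>2) * cyukawa a x) \<partial>lborel)"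
proof -
  have [measurable]: "\<phi> \<in> borel_measurable borel" using L2_D[OF \<phi>] by simp
  have gm[measurable]: "(\<lambda>x. g x $ i) \<in> borel_measurable borel" for i
    using L2_D[OF L2_component[OF g, of i]] by simp
  have DWm[measurable]: "(\<lambda>x. yukawa_diff_grad a b x $ i) \<in> borel_measurable borel" for i
    using L2_D[OF L2_component[OF yukawa_diff_grad_L2[OF a], of i]] by simp
  let ?\<eta> = "\<lambda>n i x. complex_of_real (approx_field a b n i x)"
  have int\<phi>: "integrable lborel (\<lambda>x. \<phi> x * partial i (?\<eta> n i) x)" for n i
    using L2_mult_integrable[OF \<phi> test_function_L2[OF test_function_partial[OF approx_field_test_function]]] .
  have intg: "integrable lborel (\<lambda>x. g x $ i * ?\<eta> n i x)" for n i
    using L2_mult_integrable[OF L2_component[OF g] test_function_L2[OF approx_field_test_function]] .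
  have eq: "(\<integral>x. \<phi> x * of_real (approx_field_div a b n x) \<partial>lborel) = - (\<integral>x. (\<Sum>i\<in>UNIV. g x $ i * ?\<eta> n i x) \<partial>lborel)" for n
  proof -
    have "(\<integral>x. \<phi> x * of_real (approx_field_div a b n x) \<partial>lborel) = (\<integral>x. (\<Sum>i\<in>UNIV. \<phi> x * partial i (?\<eta> n i) x) \<partial>lborel)"
      by (simp only: sum_partial_approx_field[symmetric] sum_distrib_left)
    also have "\<dots> = (\<Sum>i\<in>UNIV. \<integral>x. \<phi> x * partial i (?\<eta> n i) x \<partial>lborel)"
      by (intro Bochner_Integration.integral_sum int\<phi>)
    also have "\<dots> = (\<Sum>i\<in>UNIV. - (\<integral>x. g x $ i * ?\<eta> n i x \<partial>lborel))"
      using wg approx_field_test_function unfolding weak_gradient_def by (intro sum.cong refl) blast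
    also have "\<dots> = - (\<integral>x. (\<Sum>i\<in>UNIV. g x $ i * ?\<eta> n i x) \<partial>lborel)"
      by (subst Bochner_Integration.integral_sum[OF intg]) (simp add: sum_negf)
    finally show ?thesis .
  qed
  define c where "c = complex_of_real (exp (-1))"
  have c: "c \<noteq> 0" by (simp add: c_def)
  define B1 where "B1 = (\<lambda>x::real^3. (9 * \<bar>a - b\<bar> * max a b) *\<^sub>R (exp (- (min a b / 2) * norm x) / norm x))"
  have B1: "B1 \<in> L2" unfolding B1_def using a by (intro L2_scaleR exp_div_norm_L2) auto
  define B2 where "B2 = (\<lambda>x::real^3. (\<bar>a - b\<bar> * max a b) *\<^sub>R exp (- min a b * norm x))"
  have B2: "B2 \<in> L2" unfolding B2_def using a by (intro L2_scaleR exp_norm_L2) auto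
  have "(\<lambda>n. \<integral>x. \<phi> x * of_real (approx_field_div a b n x) \<partial>lborel)
     \<longlonglongrightarrow> (\<integral>x. \<phi> x * of_real ((a\<^sup>2 * yukawa a x - b\<^sup>2 * yukawa b x) * exp (-1)) \<partial>lborel)"
  proof (rule integral_dominated_convergence[where w="\<lambda>x. norm (\<phi> x) * norm (B1 x)"])
    show "integrable lborel (\<lambda>x. norm (\<phi> x) * norm (B1 x))" by (rule L2_mult_integrable_norm[OF \<phi> B1])
    show "AE x in lborel. (\<lambda>n. \<phi> x * of_real (approx_field_div a b n x))
        \<longlonglongrightarrow> \<phi> x * of_real ((a\<^sup>2 * yukawa a x - b\<^sup>2 * yukawa b x) * exp (-1))"
      by (rule AE_mp[OF AE_lborel_singleton[of 0]], intro AE_I2 impI tendsto_mult_left tendsto_of_real approx_field_div_tendsto)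
    show "AE x in lborel. norm (\<phi> x * of_real (approx_field_div a b n x)) \<le> norm (\<phi> x) * norm (B1 x)" for n
    proof (rule AE_mp[OF AE_lborel_singleton[of 0]], intro AE_I2 impI)
      fix x :: "real^3" assume "x \<noteq> 0"
      then have "\<bar>approx_field_div a b n x\<bar> \<le> norm (B1 x)"
        unfolding B1_def using approx_field_div_bound[OF a, of x n] a by (simp add: abs_mult)
      then show "norm (\<phi> x * of_real (approx_field_div a b n x)) \<le> norm (\<phi> x) * norm (B1 x)"
        unfolding norm_mult norm_of_real by (rule mult_left_mono) simp
    qed
  qed measurable
  note lim1 = this
  have "(\<lambda>n. \<integral>x. (\<Sum>i\<in>UNIV. g x $ i * ?\<eta> n i x) \<partial>lborel)
     \<longlonglongrightarrow> (\<integral>x. (\<Sum>i\<in>UNIV. g x $ i * (yukawa_diff_grad a b x $ i * c)) \<partial>lborel)"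
  proof (rule integral_dominated_convergence[where w="\<lambda>x. \<Sum>i\<in>UNIV. norm (g x $ i) * norm (B2 x)"])
    show "integrable lborel (\<lambda>x. \<Sum>i\<in>UNIV. norm (g x $ i) * norm (B2 x))"
      by (intro Bochner_Integration.integrable_sum L2_mult_integrable_norm[OF L2_component[OF g] B2])
    show "AE x in lborel. (\<lambda>n. (\<Sum>i\<in>UNIV. g x $ i * ?\<eta> n i x)) \<longlonglongrightarrow> (\<Sum>i\<in>UNIV. g x $ i * (yukawa_diff_grad a b x $ i * c))"
    proof (rule AE_mp[OF AE_lborel_singleton[of 0]], intro AE_I2 impI tendsto_sum tendsto_mult_left)
      fix x :: "real^3" and i assume "x \<noteq> 0"
      from tendsto_of_real[OF approx_field_tendsto[OF this, of a b i]]
      show "(\<lambda>n. ?\<eta> n i x) \<longlonglongrightarrow> yukawa_diff_grad a b x $ i * c"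
        by (simp add: yukawa_diff_grad_def c_def)
    qed
    show "AE x in lborel. norm (\<Sum>i\<in>UNIV. g x $ i * ?\<eta> n i x) \<le> (\<Sum>i\<in>UNIV. norm (g x $ i) * norm (B2 x))" for n
    proof (intro AE_I2 order_trans[OF norm_sum] sum_mono)
      fix x :: "real^3" and i
      have "\<bar>approx_field a b n i x\<bar> \<le> norm (B2 x)"
        unfolding B2_def using approx_field_bound[OF a, of n i x] a by (simp add: abs_mult)
      then show "norm (g x $ i * ?\<eta> n i x) \<le> norm (g x $ i) * norm (B2 x)"
        unfolding norm_mult norm_of_real by (rule mult_left_mono) simp
    qed
  qed measurable
  note lim2 = this
  have "(\<integral>x. \<phi> x * of_real ((a\<^sup>2 * yukawa a x - b\<^sup>2 * yukawa b x) * exp (-1)) \<partial>lborel)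
     = - (\<integral>x. (\<Sum>i\<in>UNIV. g x $ i * (yukawa_diff_grad a b x $ i * c)) \<partial>lborel)"
    by (rule LIMSEQ_unique[OF lim1[unfolded eq] tendsto_minus[OF lim2]])
  also have "(\<lambda>x. \<phi> x * of_real ((a\<^sup>2 * yukawa a x - b\<^sup>2 * yukawa b x) * exp (-1)))
     = (\<lambda>x. (- (\<phi> x * (of_real (b\<^sup>2) * cyukawa b x - of_real (a\<^sup>2) * cyukawa a x))) * c)"
    by (simp add: fun_eq_iff c_def algebra_simps)
  also have "(\<lambda>x. \<Sum>i\<in>UNIV. g x $ i * (yukawa_diff_grad a b x $ i * c)) = (\<lambda>x. (\<Sum>i\<in>UNIV. g x $ i * yukawa_diff_grad a b x $ i) * c)"
    by (simp add: fun_eq_iff sum_distrib_right mult.assoc)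
  finally show ?thesis using c by (simp del: of_real_power)
qed

section \<open>The quadratic form\<close>

lemma yukawa_diff_H1:
  assumes "0 < a" "0 < b"
  shows "yukawa_diff a b \<in> H1"
  by (rule H1_I[OF yukawa_diff_L2[OF assms] yukawa_diff_grad_L2[OF assms] yukawa_diff_weak_gradient[OF assms]])

lemma H1_add: "u \<in> H1 \<Longrightarrow> v \<in> H1 \<Longrightarrow> (\<lambda>x. u x + v x) \<in> H1"
  by (elim H1_E) (rule H1_I[OF L2_add L2_add weak_gradient_add])

lemma H1_cmult: "u \<in> H1 \<Longrightarrow> (\<lambda>x. c * u x) \<in> H1"
  by (elim H1_E) (rule H1_I[OF L2_cmult L2_cmult_vec weak_gradient_cmult])

lemma L2_norm_power2_components:
  fixes g :: "real^3 \<Rightarrow> complex^3"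
  assumes "g \<in> L2"
  shows "(L2_norm g)\<^sup>2 = (\<Sum>i\<in>UNIV. (L2_norm (\<lambda>x. g x $ i))\<^sup>2)"
  unfolding L2_norm_power2 norm_vec3_power2
  by (intro Bochner_Integration.integral_sum L2_D(3)[OF L2_component[OF assms]])

lemma L2_norm_power2_real:
  assumes "\<And>x. f x = complex_of_real (h x)"
  shows "(L2_norm f)\<^sup>2 = (\<integral>x. h x * h x \<partial>lborel)"
  unfolding L2_norm_power2 by (simp add: assms power2_eq_square)

text \<open>Since w is real-valued, the cross term of the sesquilinear expansion is expressed by the
  bilinear pairing of f and w, the one for which the identities above are stated.\<close>

lemma L2_norm_add_cmult_real:
  fixes f w :: "real^3 \<Rightarrow> complex"
  assumes f: "f \<in> L2" and w: "w \<in> L2" and real: "\<And>x. cnj (w x) = w x"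
  shows "(L2_norm (\<lambda>x. f x + q * w x))\<^sup>2 =
    (L2_norm f)\<^sup>2 + 2 * Re (cnj q * (\<integral>x. f x * w x \<partial>lborel)) + (cmod q)\<^sup>2 * (L2_norm w)\<^sup>2"
proof -
  have pt: "(cmod (f x + q * w x))\<^sup>2 = (cmod (f x))\<^sup>2 + 2 * Re (cnj q * (f x * w x)) + (cmod q)\<^sup>2 * (cmod (w x))\<^sup>2" for x
  proof -
    have "Im (w x) = 0" using real[of x] by (simp add: complex_eq_iff)
    then show ?thesis
      unfolding cmod_power2 by (simp add: algebra_simps power2_eq_square)
  qed
  have i: "integrable lborel (\<lambda>x. cnj q * (f x * w x))"
    by (intro integrable_mult_right L2_mult_integrable f w)
  then have iR: "integrable lborel (\<lambda>x. Re (cnj q * (f x * w x)))" by (rule integrable_Re)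
  have "(\<integral>x. Re (cnj q * (f x * w x)) \<partial>lborel) = Re (\<integral>x. cnj q * (f x * w x) \<partial>lborel)"
    using i by (rule integral_Re)
  also have "(\<integral>x. cnj q * (f x * w x) \<partial>lborel) = cnj q * (\<integral>x. f x * w x \<partial>lborel)" by simp
  finally have R: "(\<integral>x. Re (cnj q * (f x * w x)) \<partial>lborel) = Re (cnj q * (\<integral>x. f x * w x \<partial>lborel))" .
  show ?thesis
    unfolding L2_norm_power2 pt
    using L2_D(3)[OF f] L2_D(3)[OF w] iR R by (simp del: minus_complex.sel times_complex.sel)
qed

lemma L2_norm_cyukawa: "0 < a \<Longrightarrow> (L2_norm (cyukawa a))\<^sup>2 = 1 / (8 * pi * a)"
  by (subst L2_norm_power2_real[of _ "yukawa a"]) (simp_all add: yukawa_mult_integral)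

lemma L2_norm_yukawa_diff:
  assumes "0 < a" "0 < b"
  shows "(L2_norm (yukawa_diff a b))\<^sup>2 = 1 / (8 * pi * a) + 1 / (8 * pi * b) - 1 / (2 * pi * (a + b))"
proof -
  have "(L2_norm (yukawa_diff a b))\<^sup>2 = (\<integral>x. (yukawa a x - yukawa b x) * (yukawa a x - yukawa b x) \<partial>lborel)"
    by (rule L2_norm_power2_real) (simp add: yukawa_diff_def)
  also have "\<dots> = (\<integral>x. yukawa a x * yukawa a x - 2 * (yukawa a x * yukawa b x) + yukawa b x * yukawa b x \<partial>lborel)"
    by (simp add: algebra_simps)
  also have "\<dots> = 1 / (4 * pi * (a + a)) - 2 * (1 / (4 * pi * (a + b))) + 1 / (4 * pi * (b + b))"
    using yukawa_mult_integral[OF assms] yukawa_mult_integral[OF assms(1,1)] yukawa_mult_integral[OF assms(2,2)] by simp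
  finally have "(L2_norm (yukawa_diff a b))\<^sup>2 = 1 / (4 * pi * (a + a)) - 2 * (1 / (4 * pi * (a + b))) + 1 / (4 * pi * (b + b))" .
  moreover have "4 * pi * (a + a) = 8 * pi * a" "4 * pi * (b + b) = 8 * pi * b" "2 * (1 / (4 * pi * (a + b))) = 1 / (2 * pi * (a + b))"
    by simp_all
  ultimately show ?thesis by (simp only:)
qed

lemma integral_mult_kernel_difference:
  fixes c d :: complex
  assumes f: "f \<in> L2" and a: "0 < a" "0 < b"
  shows "(\<integral>x. f x * (c * cyukawa b x - d * cyukawa a x) \<partial>lborel) = c * (\<integral>x. f x * cyukawa b x \<partial>lborel) - d * (\<integral>x. f x * cyukawa a x \<partial>lborel)"
proof -
  have "(\<lambda>x. f x * (c * cyukawa b x - d * cyukawa a x)) = (\<lambda>x. c * (f x * cyukawa b x) - d * (f x * cyukawa a x))"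
    by (simp add: fun_eq_iff algebra_simps)
  then show ?thesis
    using L2_mult_integrable[OF f cyukawa_L2[OF a(1)]] L2_mult_integrable[OF f cyukawa_L2[OF a(2)]] by simp
qed

lemma integral_cyukawa_mult:
  assumes "0 < a" "0 < b"
  shows "(\<integral>x. cyukawa a x * cyukawa b x \<partial>lborel) = of_real (1 / (4 * pi * (a + b)))"
proof -
  have "(\<integral>x. cyukawa a x * cyukawa b x \<partial>lborel) = (\<integral>x. complex_of_real (yukawa a x * yukawa b x) \<partial>lborel)" by simp
  also have "\<dots> = of_real (\<integral>x. yukawa a x * yukawa b x \<partial>lborel)" by (rule integral_complex_of_real)
  finally show ?thesis by (simp only: yukawa_mult_integral(2)[OF assms])
qed

text \<open>The pairing identity is applied to the difference itself. Its gradient is real, so the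
  bilinear pairing is the squared norm, while the right-hand side consists of integrals of products
  of kernels.\<close>

lemma L2_norm_yukawa_diff_grad:
  assumes a: "0 < a" "0 < b"
  shows "(L2_norm (yukawa_diff_grad a b))\<^sup>2 = (a - b)\<^sup>2 / (8 * pi * (a + b))"
proof -
  have "complex_of_real ((L2_norm (yukawa_diff_grad a b))\<^sup>2) = (\<integral>x. complex_of_real ((norm (yukawa_diff_grad a b x))\<^sup>2) \<partial>lborel)"
    unfolding L2_norm_power2 by (rule integral_complex_of_real[symmetric])
  also have "\<dots> = (\<integral>x. (\<Sum>i\<in>UNIV. yukawa_diff_grad a b x $ i * yukawa_diff_grad a b x $ i) \<partial>lborel)"
    unfolding norm_vec3_power2
    by (intro Bochner_Integration.integral_cong refl) (simp add: yukawa_diff_grad_def power2_eq_square norm_mult abs_mult_self_eq flip: of_real_mult)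
  also have "\<dots> = (\<integral>x. yukawa_diff a b x * (of_real (b\<^sup>2) * cyukawa b x - of_real (a\<^sup>2) * cyukawa a x) \<partial>lborel)"
    by (rule weak_gradient_inner_yukawa_diff_grad[OF yukawa_diff_L2[OF a] yukawa_diff_grad_L2[OF a] yukawa_diff_weak_gradient[OF a] a])
  also have "\<dots> = of_real (b\<^sup>2) * (\<integral>x. yukawa_diff a b x * cyukawa b x \<partial>lborel) - of_real (a\<^sup>2) * (\<integral>x. yukawa_diff a b x * cyukawa a x \<partial>lborel)"
    by (rule integral_mult_kernel_difference[OF yukawa_diff_L2[OF a] a])
  also have "(\<integral>x. yukawa_diff a b x * cyukawa b x \<partial>lborel) = (\<integral>x. cyukawa b x * (1 * cyukawa a x - 1 * cyukawa b x) \<partial>lborel)"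
    by (simp add: yukawa_diff_def mult.commute)
  also have "\<dots> = of_real (1 / (4 * pi * (a + b)) - 1 / (4 * pi * (b + b)))"
    unfolding integral_mult_kernel_difference[OF cyukawa_L2[OF a(2)] a(2,1)]
    by (simp add: integral_cyukawa_mult a add.commute)
  also have "(\<integral>x. yukawa_diff a b x * cyukawa a x \<partial>lborel) = (\<integral>x. cyukawa a x * (1 * cyukawa a x - 1 * cyukawa b x) \<partial>lborel)"
    by (simp add: yukawa_diff_def mult.commute)
  also have "\<dots> = of_real (1 / (4 * pi * (a + a)) - 1 / (4 * pi * (a + b)))"
    unfolding integral_mult_kernel_difference[OF cyukawa_L2[OF a(1)] a(2,1)]
    by (simp add: integral_cyukawa_mult a)
  finally have "complex_of_real ((L2_norm (yukawa_diff_grad a b))\<^sup>2) = of_real (b\<^sup>2 * (1 / (4 * pi * (a + b)) - 1 / (4 * pi * (b + b)))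
     - a\<^sup>2 * (1 / (4 * pi * (a + a)) - 1 / (4 * pi * (a + b))))"
    by (simp only: of_real_mult of_real_diff)
  then have "(L2_norm (yukawa_diff_grad a b))\<^sup>2 = b\<^sup>2 * (1 / (4 * pi * (a + b)) - 1 / (4 * pi * (b + b)))
     - a\<^sup>2 * (1 / (4 * pi * (a + a)) - 1 / (4 * pi * (a + b)))"
    by (simp only: of_real_eq_iff)
  also have "\<dots> = (a - b)\<^sup>2 / (8 * pi * (a + b))"
  proof -
    have "pi * (a + b) \<noteq> 0" "pi * a \<noteq> 0" "pi * b \<noteq> 0" "a + b \<noteq> 0" using a by auto
    then show ?thesis using a by (simp add: divide_simps) (simp add: algebra_simps power2_eq_square)
  qed
  finally show ?thesis .
qed

lemma sum_mult_le_norm: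
  fixes v w :: "complex^3"
  shows "cmod (\<Sum>i\<in>UNIV. v $ i * w $ i) \<le> norm v * norm w"
proof -
  have "cmod (\<Sum>i\<in>UNIV. v $ i * w $ i) \<le> (\<Sum>i\<in>UNIV. \<bar>cmod (v $ i)\<bar> * \<bar>cmod (w $ i)\<bar>)"
    by (rule order_trans[OF norm_sum]) (simp add: norm_mult)
  also have "\<dots> \<le> norm v * norm w"
    unfolding norm_vec_def by (rule L2_set_mult_ineq)
  finally show ?thesis .
qed

text \<open>Testing the hypothetical gradient against \<open>yukawa_diff_grad 1 b\<close> and letting \<open>b\<close> tend to infinity: the left
  side grows like \<open>b\<close>, the norm of \<open>yukawa_diff_grad 1 b\<close> only like the square root of \<open>b\<close>.\<close>

lemma cmult_cyukawa_H1_imp_zero: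
  assumes l: "0 < l" and H: "(\<lambda>x. c * cyukawa l x) \<in> H1"
  shows "c = 0"
proof -
  obtain g where \<phi>: "(\<lambda>x. c * cyukawa l x) \<in> L2" and g: "g \<in> L2" and wg: "weak_gradient (\<lambda>x. c * cyukawa l x) g"
    using H by (rule H1_E)
  have le: "cmod c / (4 * pi) * (b\<^sup>2 / (l + b) - 1 / (l + 1)) \<le> L2_norm g * ((b - 1) / sqrt (8 * pi * (1 + b)))"
    if b: "b > 1" for b
  proof -
    have a: "0 < (1::real)" "0 < b" using b by auto
    have "(\<integral>x. (\<Sum>i\<in>UNIV. g x $ i * yukawa_diff_grad 1 b x $ i) \<partial>lborel)
      = (\<integral>x. c * cyukawa l x * (of_real (b\<^sup>2) * cyukawa b x - of_real (1\<^sup>2) * cyukawa 1 x) \<partial>lborel)"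
      by (rule weak_gradient_inner_yukawa_diff_grad[OF \<phi> g wg a])
    also have "\<dots> = (\<integral>x. c * (cyukawa l x * (of_real (b\<^sup>2) * cyukawa b x - 1 * cyukawa 1 x)) \<partial>lborel)"
      by (simp add: mult.assoc)
    also have "\<dots> = c * (of_real (b\<^sup>2) * (\<integral>x. cyukawa l x * cyukawa b x \<partial>lborel) - 1 * (\<integral>x. cyukawa l x * cyukawa 1 x \<partial>lborel))"
      by (simp only: integral_mult_right_zero integral_mult_kernel_difference[OF cyukawa_L2[OF l] a])
    also have "\<dots> = c * of_real (1 / (4 * pi) * (b\<^sup>2 / (l + b) - 1 / (l + 1)))"
      unfolding integral_cyukawa_mult[OF l a(2)] integral_cyukawa_mult[OF l a(1)]
      by (simp add: right_diff_distrib)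
    finally have 1: "cmod (\<integral>x. (\<Sum>i\<in>UNIV. g x $ i * yukawa_diff_grad 1 b x $ i) \<partial>lborel) = cmod c * \<bar>1 / (4 * pi) * (b\<^sup>2 / (l + b) - 1 / (l + 1))\<bar>"
      by (simp only: norm_mult norm_of_real)
    have 2: "cmod (\<integral>x. (\<Sum>i\<in>UNIV. g x $ i * yukawa_diff_grad 1 b x $ i) \<partial>lborel) \<le> (\<integral>x. norm (g x) * norm (yukawa_diff_grad 1 b x) \<partial>lborel)"
    proof (rule order_trans[OF integral_norm_bound])
      show "(\<integral>x. cmod (\<Sum>i\<in>UNIV. g x $ i * yukawa_diff_grad 1 b x $ i) \<partial>lborel) \<le> (\<integral>x. norm (g x) * norm (yukawa_diff_grad 1 b x) \<partial>lborel)"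
        by (intro Bochner_Integration.integral_mono integrable_norm Bochner_Integration.integrable_sum
            L2_mult_integrable L2_component g yukawa_diff_grad_L2[OF a] L2_mult_integrable_norm sum_mult_le_norm)
    qed
    have 3: "(\<integral>x. norm (g x) * norm (yukawa_diff_grad 1 b x) \<partial>lborel) \<le> L2_norm g * L2_norm (yukawa_diff_grad 1 b)"
      by (rule L2_Cauchy_Schwarz_norm[OF g yukawa_diff_grad_L2[OF a]])
    have 4: "L2_norm (yukawa_diff_grad 1 b) = (b - 1) / sqrt (8 * pi * (1 + b))"
    proof -
      have "L2_norm (yukawa_diff_grad 1 b) = sqrt ((1 - b)\<^sup>2 / (8 * pi * (1 + b)))"
        using L2_norm_yukawa_diff_grad[OF a] by (metis L2_norm_nonneg real_sqrt_unique)
      then show ?thesis using b by (simp add: real_sqrt_divide)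
    qed
    have 5: "cmod c / (4 * pi) * (b\<^sup>2 / (l + b) - 1 / (l + 1)) \<le> cmod c * \<bar>1 / (4 * pi) * (b\<^sup>2 / (l + b) - 1 / (l + 1))\<bar>"
      using mult_left_mono[OF abs_ge_self[of "1 / (4 * pi) * (b\<^sup>2 / (l + b) - 1 / (l + 1))"], of "cmod c"]
      by (simp add: mult.assoc)
    show ?thesis
      by (rule order_trans[OF 5[folded 1] order_trans[OF 2 3[unfolded 4]]])
  qed
  have "((\<lambda>b. (cmod c / (4 * pi) * (b\<^sup>2 / (l + b) - 1 / (l + 1))) / b) \<longlongrightarrow> cmod c / (4 * pi) * 1) at_top"
  proof -
    have "((\<lambda>b. (b\<^sup>2 / (l + b) - 1 / (l + 1)) / b) \<longlongrightarrow> 1) at_top" using l by real_asymp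
    then have "((\<lambda>b. cmod c / (4 * pi) * ((b\<^sup>2 / (l + b) - 1 / (l + 1)) / b)) \<longlongrightarrow> cmod c / (4 * pi) * 1) at_top"
      by (rule tendsto_mult_left)
    then show ?thesis by simp
  qed
  moreover have "((\<lambda>b. L2_norm g * ((b - 1) / sqrt (8 * pi * (1 + b))) / b) \<longlongrightarrow> L2_norm g * 0) at_top"
  proof -
    have "((\<lambda>b. (b - 1) / sqrt (8 * pi * (1 + b)) / b) \<longlongrightarrow> 0) at_top" by real_asymp
    then have "((\<lambda>b. L2_norm g * ((b - 1) / sqrt (8 * pi * (1 + b)) / b)) \<longlongrightarrow> L2_norm g * 0) at_top"
      by (rule tendsto_mult_left)
    then show ?thesis by simp
  qed
  moreover have "eventually (\<lambda>b. (cmod c / (4 * pi) * (b\<^sup>2 / (l + b) - 1 / (l + 1))) / b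
      \<le> L2_norm g * ((b - 1) / sqrt (8 * pi * (1 + b))) / b) at_top"
    using eventually_gt_at_top[of 1] by eventually_elim (intro divide_right_mono le, auto)
  ultimately have "cmod c / (4 * pi) * 1 \<le> L2_norm g * 0"
    by (rule_tac tendsto_le[of at_top]) auto
  then show ?thesis by (simp add: divide_le_eq)
qed

section \<open>Decompositions at different \<lambda>, and the form as a function of one of
  them\<close>

lemma decomposition_change:
  assumes "decomposition u \<phi> q lam" "0 < lam'"
  shows "decomposition u (\<lambda>x. \<phi> x + q * yukawa_diff (sqrt lam) (sqrt lam') x) q lam'"
proof -
  have "(\<lambda>x. \<phi> x + q * yukawa_diff (sqrt lam) (sqrt lam') x) \<in> H1"
    using assms by (intro H1_add H1_cmult[OF yukawa_diff_H1]) (simp_all add: decomposition_def)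
  then show ?thesis
    using assms unfolding decomposition_def green_eq_cyukawa
    by (simp add: yukawa_diff_def fun_eq_iff algebra_simps)
qed

text \<open>Once both decompositions are written at the same \<lambda>, their difference exhibits
  (q' - q) times a kernel as a function in \<open>H1\<close>, which forces q' = q.\<close>

lemma decomposition_unique:
  assumes d: "decomposition u \<phi> q lam" and d': "decomposition u \<phi>' q' lam'"
  shows "q' = q" "\<phi>' = (\<lambda>x. \<phi> x + q * yukawa_diff (sqrt lam) (sqrt lam') x)"
proof -
  have lam': "0 < lam'" using d' by (simp add: decomposition_def)
  define \<psi> where "\<psi> = (\<lambda>x. \<phi> x + q * yukawa_diff (sqrt lam) (sqrt lam') x)"
  have \<psi>: "decomposition u \<psi> q lam'" unfolding \<psi>_def by (rule decomposition_change[OF d lam'])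
  have eq: "\<phi>' x + q' * cyukawa (sqrt lam') x = \<psi> x + q * cyukawa (sqrt lam') x" for x
    using \<psi> d' unfolding decomposition_def green_eq_cyukawa by (metis (no_types, lifting))
  have "(\<lambda>x. \<psi> x + (-1) * \<phi>' x) \<in> H1"
    using \<psi> d' by (intro H1_add H1_cmult) (auto simp: decomposition_def)
  also have "(\<lambda>x. \<psi> x + (-1) * \<phi>' x) = (\<lambda>x. (q' - q) * cyukawa (sqrt lam') x)"
    using eq by (simp add: fun_eq_iff algebra_simps)
  finally have "q' - q = 0" using lam' by (intro cmult_cyukawa_H1_imp_zero[of "sqrt lam'"]) simp_all
  then show "q' = q" by simp
  then show "\<phi>' = (\<lambda>x. \<phi> x + q * yukawa_diff (sqrt lam) (sqrt lam') x)"
    using eq by (simp add: fun_eq_iff \<psi>_def)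
qed

text \<open>The value that one decomposition contributes to the description in
  \<open>Q_form\<close>. At \<alpha> = 0 it is the part of the form that a dilation multiplies by
  t^2.\<close>

definition Q_value :: "real \<Rightarrow> (real^3 \<Rightarrow> complex) \<Rightarrow> (real^3 \<Rightarrow> complex) \<Rightarrow> complex \<Rightarrow> real \<Rightarrow> real" where
  "Q_value \<alpha> u \<phi> q lam = (L2_norm (grad \<phi>))\<^sup>2 + lam * ((L2_norm \<phi>)\<^sup>2 - (L2_norm u)\<^sup>2)
      + (\<alpha> + sqrt lam / (4 * pi)) * (cmod q)\<^sup>2"

text \<open>Everything is expanded in the squared norms of \<phi> and its gradient, the pairings Pa,
  Pb of \<phi> with the two kernels, and s = |q|^2. The contributions 2 b^2 Pb of the gradient and -
  2 b^2 Pb of the mass term cancel, - 2 a^2 Pa is what the mass term of the old decomposition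
  contains, and comparing the coefficients of s is the rational identity \<open>key\<close>.\<close>

lemma Q_value_change:
  assumes d: "decomposition u \<phi> q lam" and lam': "0 < lam'"
  shows "Q_value \<alpha> u (\<lambda>x. \<phi> x + q * yukawa_diff (sqrt lam) (sqrt lam') x) q lam' = Q_value \<alpha> u \<phi> q lam"
proof -
  define a where "a = sqrt lam"
  define b where "b = sqrt lam'"
  have a: "0 < a" "0 < b" using d lam' by (auto simp: a_def b_def decomposition_def)
  have lam: "lam = a\<^sup>2" "lam' = b\<^sup>2" using d lam' by (auto simp: a_def b_def decomposition_def)
  obtain g where \<phi>: "\<phi> \<in> L2" and g: "g \<in> L2" and wg: "weak_gradient \<phi> g"
    using d by (auto simp: decomposition_def elim: H1_E)
  have u: "u = (\<lambda>x. \<phi> x + q * cyukawa a x)" using d by (simp add: decomposition_def green_eq_cyukawa a_def)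
  define Pa where "Pa = Re (cnj q * (\<integral>x. \<phi> x * cyukawa a x \<partial>lborel))"
  define Pb where "Pb = Re (cnj q * (\<integral>x. \<phi> x * cyukawa b x \<partial>lborel))"
  define s where "s = (cmod q)\<^sup>2"
  have nu: "(L2_norm u)\<^sup>2 = (L2_norm \<phi>)\<^sup>2 + 2 * Pa + s * (1 / (8 * pi * a))"
    unfolding u Pa_def s_def L2_norm_cyukawa[OF a(1), symmetric]
    by (rule L2_norm_add_cmult_real[OF \<phi> cyukawa_L2[OF a(1)]]) simp
  have "(\<integral>x. \<phi> x * yukawa_diff a b x \<partial>lborel) = (\<integral>x. \<phi> x * (1 * cyukawa a x - 1 * cyukawa b x) \<partial>lborel)"
    by (simp add: yukawa_diff_def)
  also have "\<dots> = (\<integral>x. \<phi> x * cyukawa a x \<partial>lborel) - (\<integral>x. \<phi> x * cyukawa b x \<partial>lborel)"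
    unfolding integral_mult_kernel_difference[OF \<phi> a(2,1)] by simp
  finally have PW: "Re (cnj q * (\<integral>x. \<phi> x * yukawa_diff a b x \<partial>lborel)) = Pa - Pb"
    by (simp add: Pa_def Pb_def right_diff_distrib del: minus_complex.sel times_complex.sel) simp
  have n\<phi>: "(L2_norm (\<lambda>x. \<phi> x + q * yukawa_diff a b x))\<^sup>2 = (L2_norm \<phi>)\<^sup>2 + 2 * (Pa - Pb)
      + s * (1 / (8 * pi * a) + 1 / (8 * pi * b) - 1 / (2 * pi * (a + b)))"
    unfolding PW[symmetric] s_def L2_norm_yukawa_diff[OF a, symmetric]
    by (rule L2_norm_add_cmult_real[OF \<phi> yukawa_diff_L2[OF a]]) (simp add: yukawa_diff_def)
  let ?g' = "\<lambda>x. g x + (\<chi> i. q * yukawa_diff_grad a b x $ i)"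
  have g': "?g' \<in> L2" by (intro L2_add g L2_cmult_vec yukawa_diff_grad_L2 a)
  have wg': "weak_gradient (\<lambda>x. \<phi> x + q * yukawa_diff a b x) ?g'"
    by (intro weak_gradient_add \<phi> g wg L2_cmult yukawa_diff_L2 a L2_cmult_vec yukawa_diff_grad_L2 weak_gradient_cmult yukawa_diff_weak_gradient)
  have "(L2_norm ?g')\<^sup>2 = (\<Sum>i\<in>UNIV. (L2_norm (\<lambda>x. g x $ i + q * yukawa_diff_grad a b x $ i))\<^sup>2)"
    unfolding L2_norm_power2_components[OF g'] by simp
  also have "\<dots> = (\<Sum>i\<in>UNIV. (L2_norm (\<lambda>x. g x $ i))\<^sup>2 + 2 * Re (cnj q * (\<integral>x. g x $ i * yukawa_diff_grad a b x $ i \<partial>lborel))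
      + s * (L2_norm (\<lambda>x. yukawa_diff_grad a b x $ i))\<^sup>2)"
    unfolding s_def
    by (intro sum.cong refl L2_norm_add_cmult_real L2_component g yukawa_diff_grad_L2 a) (simp add: yukawa_diff_grad_def)
  also have "\<dots> = (L2_norm g)\<^sup>2 + 2 * Re (cnj q * (\<Sum>i\<in>UNIV. \<integral>x. g x $ i * yukawa_diff_grad a b x $ i \<partial>lborel)) + s * (L2_norm (yukawa_diff_grad a b))\<^sup>2"
    unfolding L2_norm_power2_components[OF g] L2_norm_power2_components[OF yukawa_diff_grad_L2[OF a]]
    by (simp only: sum.distrib sum_distrib_left Re_sum)
  also have "(\<Sum>i\<in>UNIV. \<integral>x. g x $ i * yukawa_diff_grad a b x $ i \<partial>lborel) = (\<integral>x. (\<Sum>i\<in>UNIV. g x $ i * yukawa_diff_grad a b x $ i) \<partial>lborel)"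
    by (rule Bochner_Integration.integral_sum[symmetric]) (intro L2_mult_integrable L2_component g yukawa_diff_grad_L2 a)
  also have "\<dots> = (\<integral>x. \<phi> x * (of_real (b\<^sup>2) * cyukawa b x - of_real (a\<^sup>2) * cyukawa a x) \<partial>lborel)"
    by (rule weak_gradient_inner_yukawa_diff_grad[OF \<phi> g wg a])
  also have "\<dots> = of_real (b\<^sup>2) * (\<integral>x. \<phi> x * cyukawa b x \<partial>lborel) - of_real (a\<^sup>2) * (\<integral>x. \<phi> x * cyukawa a x \<partial>lborel)"
    by (rule integral_mult_kernel_difference[OF \<phi> a])
  also have "Re (cnj q * \<dots>) = b\<^sup>2 * Pb - a\<^sup>2 * Pa"
  proof -
    have "cnj q * (of_real (b\<^sup>2) * (\<integral>x. \<phi> x * cyukawa b x \<partial>lborel) - of_real (a\<^sup>2) * (\<integral>x. \<phi> x * cyukawa a x \<partial>lborel))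
      = of_real (b\<^sup>2) * (cnj q * (\<integral>x. \<phi> x * cyukawa b x \<partial>lborel)) - of_real (a\<^sup>2) * (cnj q * (\<integral>x. \<phi> x * cyukawa a x \<partial>lborel))"
      by (simp only: right_diff_distrib mult.left_commute)
    then show ?thesis unfolding Pa_def Pb_def
      by (simp only: minus_complex.sel Re_complex_of_real Im_complex_of_real times_complex.sel(1)[of "of_real _"] mult_zero_left diff_zero)
  qed
  finally have ng: "(L2_norm ?g')\<^sup>2 = (L2_norm g)\<^sup>2 + 2 * (b\<^sup>2 * Pb - a\<^sup>2 * Pa) + s * ((a - b)\<^sup>2 / (8 * pi * (a + b)))"
    unfolding L2_norm_yukawa_diff_grad[OF a] .
  have key: "(a - b)\<^sup>2 / (8 * pi * (a + b)) + b\<^sup>2 * (1 / (8 * pi * b) - 1 / (2 * pi * (a + b))) + b / (4 * pi)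
      = - a\<^sup>2 * (1 / (8 * pi * a)) + a / (4 * pi)"
  proof -
    have "pi * (a + b) \<noteq> 0" "pi * a \<noteq> 0" "pi * b \<noteq> 0" "a + b \<noteq> 0" using a by auto
    then show ?thesis using a by (simp add: divide_simps) (simp add: algebra_simps power2_eq_square)
  qed
  have "Q_value \<alpha> u (\<lambda>x. \<phi> x + q * yukawa_diff a b x) q lam' =
     (L2_norm g)\<^sup>2 - 2 * a\<^sup>2 * Pa + s * ((a - b)\<^sup>2 / (8 * pi * (a + b)) + b\<^sup>2 * (1 / (8 * pi * b) - 1 / (2 * pi * (a + b))) + b / (4 * pi)) + \<alpha> * s"
    unfolding Q_value_def L2_norm_grad_eq[OF g' wg'] ng n\<phi> nu b_def[symmetric] s_def[symmetric] unfolding lam(2)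
    by (simp add: algebra_simps)
  also have "\<dots> = Q_value \<alpha> u \<phi> q lam"
    unfolding key Q_value_def L2_norm_grad_eq[OF g wg] nu a_def[symmetric] s_def[symmetric] unfolding lam(1)
    by (simp add: algebra_simps)
  finally show ?thesis by (simp only: a_def b_def)
qed

text \<open>Uniqueness of the decomposition at given \<lambda> together with
  \<open>Q_value_change\<close> makes the \<open>THE\<close> in \<open>Q_form\<close> well
  defined.\<close>

lemma Q_form_eq:
  assumes d: "decomposition u \<phi> q lam"
  shows "Q_form \<alpha> u = Q_value \<alpha> u \<phi> q lam"
  unfolding Q_form_def Q_value_def[symmetric]
proof (rule the_equality)
  show "\<exists>\<phi>' q' lam'. decomposition u \<phi>' q' lam' \<and> Q_value \<alpha> u \<phi> q lam = Q_value \<alpha> u \<phi>' q' lam'"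
    using d by blast
  fix r assume "\<exists>\<phi>' q' lam'. decomposition u \<phi>' q' lam' \<and> r = Q_value \<alpha> u \<phi>' q' lam'"
  then obtain \<phi>' q' lam' where d': "decomposition u \<phi>' q' lam'" and r: "r = Q_value \<alpha> u \<phi>' q' lam'" by blast
  have "0 < lam'" using d' by (simp add: decomposition_def)
  from Q_value_change[OF d this] show "r = Q_value \<alpha> u \<phi> q lam"
    unfolding r decomposition_unique[OF d d'] .
qed

lemma Q_value_zero_pos:
  assumes d: "decomposition u \<phi> q lam" and \<mu>: "(L2_norm u)\<^sup>2 = \<mu>" "0 < \<mu>"
  shows "0 < Q_value 0 u \<phi> q lam"
proof (cases "q = 0")
  case False
  \<comment> \<open>s plays the role of the square root of the new \<lambda>. It maximises the lower
    bound s |q|^2 / (4 \<pi>) - s^2 \<mu>, whose maximum is s^2 \<mu>.\<close>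
  define s where "s = (cmod q)\<^sup>2 / (8 * pi * \<mu>)"
  have s: "0 < s" using False \<mu> by (simp add: s_def)
  define \<psi> where "\<psi> = (\<lambda>x. \<phi> x + q * yukawa_diff (sqrt lam) (sqrt (s\<^sup>2)) x)"
  have q2: "(cmod q)\<^sup>2 = 8 * pi * \<mu> * s" using \<mu> by (simp add: s_def)
  have "0 < s\<^sup>2 * \<mu>" using s \<mu> by simp
  also have "s\<^sup>2 * \<mu> = s\<^sup>2 * (0 - \<mu>) + (0 + s / (4 * pi)) * (cmod q)\<^sup>2"
    unfolding q2 by (simp add: power2_eq_square algebra_simps)
  also have "\<dots> \<le> (L2_norm (grad \<psi>))\<^sup>2 + s\<^sup>2 * ((L2_norm \<psi>)\<^sup>2 - \<mu>) + (0 + s / (4 * pi)) * (cmod q)\<^sup>2"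
  proof -
    have "s\<^sup>2 * (0 - \<mu>) \<le> s\<^sup>2 * ((L2_norm \<psi>)\<^sup>2 - \<mu>)" by (intro mult_left_mono) auto
    moreover have "0 \<le> (L2_norm (grad \<psi>))\<^sup>2" by simp
    ultimately show ?thesis by linarith
  qed
  also have "\<dots> = Q_value 0 u \<psi> q (s\<^sup>2)"
    using s by (simp add: Q_value_def \<mu>(1))
  also have "\<dots> = Q_value 0 u \<phi> q lam"
    unfolding \<psi>_def using s by (intro Q_value_change[OF d]) simp
  finally show ?thesis .
next
  case True
  obtain g where \<phi>: "\<phi> \<in> L2" and g: "g \<in> L2" and wg: "weak_gradient \<phi> g"
    using d by (auto simp: decomposition_def elim: H1_E)
  have u: "u = \<phi>" using d True by (simp add: decomposition_def)
  have Q: "Q_value 0 u \<phi> q lam = (L2_norm g)\<^sup>2"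
    by (simp add: Q_value_def True u L2_norm_grad_eq[OF g wg])
  moreover have "L2_norm g \<noteq> 0"
  proof
    assume "L2_norm g = 0"
    then have "(\<integral>x. (norm (g x))\<^sup>2 \<partial>lborel) = 0" using L2_norm_power2[of g] by simp
    then have AE: "AE x in lborel. (norm (g x))\<^sup>2 = 0"
      using integral_nonneg_eq_0_iff_AE[OF L2_D(3)[OF g]] by simp
    \<comment> \<open>One vanishing weak partial derivative already forces a square-integrable
      function to vanish; this contradicts the positive mass.\<close>
    have "(\<integral>x. \<phi> x * partial 1 \<eta> x \<partial>lborel) = 0" if \<eta>: "test_function \<eta>" for \<eta>
    proof -
      have "(\<integral>x. g x $ 1 * \<eta> x \<partial>lborel) = 0"
        by (rule integral_eq_zero_AE) (use AE in eventually_elim, simp)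
      then show ?thesis using wg \<eta> by (simp add: weak_gradient_def)
    qed
    then have "AE x in lborel. \<phi> x = 0" by (rule L2_zero_if_weak_partial_zero[OF \<phi>])
    then have "AE x in lborel. (norm (\<phi> x))\<^sup>2 = 0" by eventually_elim simp
    then have "(\<integral>x. (norm (\<phi> x))\<^sup>2 \<partial>lborel) = 0"
      by (rule integral_eq_zero_AE)
    then show False using \<mu> L2_norm_power2[of \<phi>] by (simp add: u)
  qed
  ultimately show ?thesis by simp
qed

section \<open>Dilations\<close>

lemma L2_dilate:
  fixes f :: "real^3 \<Rightarrow> 'b::euclidean_space"
  assumes f: "f \<in> L2" and t: "0 < t"
  shows "(\<lambda>x. f (t *\<^sub>R x)) \<in> L2"
proof (rule L2_I)
  note [measurable] = L2_D(2)[OF f]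
  show "(\<lambda>x. f (t *\<^sub>R x)) \<in> borel_measurable lborel" by measurable
  show "integrable lborel (\<lambda>x. (norm (f (t *\<^sub>R x)))\<^sup>2)"
    using integrable_affine[of t "\<lambda>x. (norm (f x))\<^sup>2" 0] L2_D(3)[OF f] t by simp
qed

lemma integral_dilate:
  fixes f :: "real^3 \<Rightarrow> 'b::{banach, second_countable_topology}"
  assumes "0 < t"
  shows "(\<integral>x. f (t *\<^sub>R x) \<partial>lborel) = (1 / t ^ 3) *\<^sub>R (\<integral>x. f x \<partial>lborel)"
  using integral_affine[of t f 0] assms by simp

lemma L2_norm_power2_dilate:
  fixes f :: "real^3 \<Rightarrow> 'b::euclidean_space"
  assumes "0 < t"
  shows "(L2_norm (\<lambda>x. f (t *\<^sub>R x)))\<^sup>2 = (L2_norm f)\<^sup>2 / t ^ 3"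
  unfolding L2_norm_power2 using integral_dilate[OF assms, of "\<lambda>x. (norm (f x))\<^sup>2"] by simp

lemma L2_norm_power2_scaleR:
  fixes f :: "real^3 \<Rightarrow> 'b::euclidean_space"
  shows "(L2_norm (\<lambda>x. c *\<^sub>R f x))\<^sup>2 = c\<^sup>2 * (L2_norm f)\<^sup>2"
  unfolding L2_norm_power2 by (simp add: power_mult_distrib)

lemma weak_gradient_dilate:
  assumes wg: "weak_gradient \<phi> g" and t: "0 < t"
  shows "weak_gradient (\<lambda>x. \<phi> (t *\<^sub>R x)) (\<lambda>x. t *\<^sub>R g (t *\<^sub>R x))"
  unfolding weak_gradient_def
proof (intro allI impI)
  fix \<eta> i assume \<eta>: "test_function \<eta>"
  \<comment> \<open>With the inverse dilation on the test function, both integrands become functions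
    of t x, and the same change of variables applies to each side.\<close>
  define \<xi> where "\<xi> = (\<lambda>x. \<eta> ((1 / t) *\<^sub>R x))"
  have \<xi>: "test_function \<xi>" unfolding \<xi>_def using t by (intro test_function_scale[OF \<eta>]) simp
  have p: "partial i \<eta> x = of_real t * partial i \<xi> (t *\<^sub>R x)" for x
    unfolding \<xi>_def using t partial_scale[OF test_functionD(2)[OF \<eta>], where t="1 / t" and x="t *\<^sub>R x" and i=i] by simp
  have e: "\<eta> x = \<xi> (t *\<^sub>R x)" for x unfolding \<xi>_def using t by simp
  have "(\<integral>x. \<phi> (t *\<^sub>R x) * partial i \<eta> x \<partial>lborel) = (\<integral>x. of_real t * (\<phi> (t *\<^sub>R x) * partial i \<xi> (t *\<^sub>R x)) \<partial>lborel)"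
    by (simp only: p mult.left_commute)
  also have "\<dots> = of_real t * ((1 / t ^ 3) *\<^sub>R (\<integral>x. \<phi> x * partial i \<xi> x \<partial>lborel))"
    by (simp only: integral_mult_right_zero integral_dilate[OF t, of "\<lambda>x. \<phi> x * partial i \<xi> x"])
  also have "\<dots> = - (of_real t * ((1 / t ^ 3) *\<^sub>R (\<integral>x. g x $ i * \<xi> x \<partial>lborel)))"
    using wg \<xi> unfolding weak_gradient_def by simp
  also have "\<dots> = - (\<integral>x. of_real t * (g (t *\<^sub>R x) $ i * \<xi> (t *\<^sub>R x)) \<partial>lborel)"
    by (simp only: integral_mult_right_zero integral_dilate[OF t, of "\<lambda>x. g x $ i * \<xi> x"])
  also have "\<dots> = - (\<integral>x. (t *\<^sub>R g (t *\<^sub>R x)) $ i * \<eta> x \<partial>lborel)"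
    by (simp add: e scaleR_conv_of_real[where 'a=complex] mult.assoc)
  finally show "(\<integral>x. \<phi> (t *\<^sub>R x) * partial i \<eta> x \<partial>lborel) = - (\<integral>x. (t *\<^sub>R g (t *\<^sub>R x)) $ i * \<eta> x \<partial>lborel)" .
qed

section \<open>Mass-preserving dilations of the form and of the nonlocal term\<close>

definition dilate :: "real \<Rightarrow> (real^3 \<Rightarrow> complex) \<Rightarrow> real^3 \<Rightarrow> complex" where
  "dilate t u x = of_real (t powr (3/2)) * u (t *\<^sub>R x)"

lemma powr_three_halves_power2:
  fixes t :: real
  assumes "0 < t"
  shows "(t powr (3/2))\<^sup>2 = t ^ 3"
  using assms by (simp add: power2_eq_square powr_add[symmetric] powr_numeral)

lemma L2_norm_dilate:
  assumes "0 < t"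
  shows "(L2_norm (dilate t u))\<^sup>2 = (L2_norm u)\<^sup>2"
proof -
  have "dilate t u = (\<lambda>x. (t powr (3/2)) *\<^sub>R u (t *\<^sub>R x))" by (simp add: fun_eq_iff dilate_def scaleR_conv_of_real)
  then show ?thesis
    using assms by (simp only: L2_norm_power2_scaleR L2_norm_power2_dilate powr_three_halves_power2) simp
qed

lemma H1_dilate:
  assumes \<phi>: "\<phi> \<in> L2" and g: "g \<in> L2" and wg: "weak_gradient \<phi> g" and t: "0 < t"
  shows "dilate t \<phi> \<in> H1" and "(L2_norm (grad (dilate t \<phi>)))\<^sup>2 = t\<^sup>2 * (L2_norm g)\<^sup>2"
proof -
  let ?c = "complex_of_real (t powr (3/2))"
  let ?g = "\<lambda>x. \<chi> i. ?c * (t *\<^sub>R g (t *\<^sub>R x)) $ i"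
  have L: "dilate t \<phi> \<in> L2" unfolding dilate_def[abs_def] by (intro L2_cmult L2_dilate \<phi> t)
  have Lg: "?g \<in> L2" by (intro L2_cmult_vec L2_scaleR L2_dilate g t)
  have w: "weak_gradient (dilate t \<phi>) ?g"
    unfolding dilate_def[abs_def] by (intro weak_gradient_cmult weak_gradient_dilate wg t)
  show "dilate t \<phi> \<in> H1" by (rule H1_I[OF L Lg w])
  have "?g = (\<lambda>x. (t powr (3/2) * t) *\<^sub>R g (t *\<^sub>R x))"
    by (simp add: fun_eq_iff vec_eq_iff scaleR_conv_of_real[where 'a=complex])
  then have "(L2_norm ?g)\<^sup>2 = (t powr (3/2) * t)\<^sup>2 * ((L2_norm g)\<^sup>2 / t ^ 3)"
    by (simp only: L2_norm_power2_scaleR L2_norm_power2_dilate[OF t])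
  also have "\<dots> = t\<^sup>2 * (L2_norm g)\<^sup>2"
    unfolding power_mult_distrib powr_three_halves_power2[OF t] using t by (simp add: eval_nat_numeral)
  finally show "(L2_norm (grad (dilate t \<phi>)))\<^sup>2 = t\<^sup>2 * (L2_norm g)\<^sup>2"
    unfolding L2_norm_grad_eq[OF Lg w] .
qed

text \<open>The kernel keeps its shape only if \<lambda> is rescaled too: t^(3/2) G(t x) at
  \<lambda> is t^(1/2) G(x) at \<lambda> t^2. Hence |q|^2 gains one factor t; the square root of
  \<lambda> supplies a second in the \<lambda>-dependent charge term, while the term with \<alpha>
  scales only like t.\<close>

lemma decomposition_dilate:
  assumes d: "decomposition u \<phi> q lam" and t: "0 < t"
  shows "decomposition (dilate t u) (dilate t \<phi>) (q * of_real (sqrt t)) (lam * t\<^sup>2)"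
proof -
  obtain g where "\<phi> \<in> L2" "g \<in> L2" "weak_gradient \<phi> g"
    using d by (auto simp: decomposition_def elim: H1_E)
  then have "dilate t \<phi> \<in> H1" using t by (rule H1_dilate(1))
  moreover have lam: "0 < lam" and u: "u = (\<lambda>x. \<phi> x + q * green lam x)" using d by (auto simp: decomposition_def)
  have "t powr (3/2) * yukawa (sqrt lam) (t *\<^sub>R x) = sqrt t * yukawa (sqrt (lam * t\<^sup>2)) x" for x
  proof -
    have "t powr (3/2) = t powr (1 + 1/2)" by simp
    also have "\<dots> = t * sqrt t" using t by (simp only: powr_add) (simp add: powr_half_sqrt)
    finally have c: "t powr (3/2) = t * sqrt t" .
    show ?thesis unfolding c yukawa_def using t by (simp add: real_sqrt_mult mult_ac)
  qed
  then have "of_real (t powr (3/2)) * green lam (t *\<^sub>R x) = of_real (sqrt t) * green (lam * t\<^sup>2) x" for x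
    unfolding green_eq_cyukawa of_real_mult[symmetric] by (simp only:)
  then have "of_real (t powr (3/2)) * (q * green lam (t *\<^sub>R x)) = q * of_real (sqrt t) * green (lam * t\<^sup>2) x" for x
    by (simp only: mult.left_commute[of _ q] mult.assoc)
  then have "dilate t u = (\<lambda>x. dilate t \<phi> x + q * of_real (sqrt t) * green (lam * t\<^sup>2) x)"
    unfolding u by (simp add: fun_eq_iff dilate_def distrib_left)
  ultimately show ?thesis using lam t by (simp add: decomposition_def)
qed

lemma Q_form_dilateate:
  assumes d: "decomposition u \<phi> q lam" and t: "0 < t"
  shows "Q_form \<alpha> (dilate t u) = t\<^sup>2 * Q_value 0 u \<phi> q lam + \<alpha> * t * (cmod q)\<^sup>2"
proof -
  obtain g where \<phi>: "\<phi> \<in> L2" and g: "g \<in> L2" and wg: "weak_gradient \<phi> g"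
    using d by (auto simp: decomposition_def elim: H1_E)
  have "0 < lam" using d by (simp add: decomposition_def)
  have q: "(cmod (q * of_real (sqrt t)))\<^sup>2 = t * (cmod q)\<^sup>2"
    using t by (simp add: norm_mult power_mult_distrib)
  have l: "sqrt (lam * t\<^sup>2) = t * sqrt lam" using t by (simp add: real_sqrt_mult)
  have "Q_form \<alpha> (dilate t u) = Q_value \<alpha> (dilate t u) (dilate t \<phi>) (q * of_real (sqrt t)) (lam * t\<^sup>2)"
    by (rule Q_form_eq[OF decomposition_dilate[OF d t]])
  also have "\<dots> = t\<^sup>2 * Q_value 0 u \<phi> q lam + \<alpha> * t * (cmod q)\<^sup>2"
    unfolding Q_value_def H1_dilate(2)[OF \<phi> g wg t] L2_norm_dilate[OF t] q l L2_norm_grad_eq[OF g wg]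
    by (simp add: algebra_simps power2_eq_square)
  finally show ?thesis .
qed

lemma dilate_one: "dilate 1 u = u"
  by (simp add: fun_eq_iff dilate_def)

lemma riesz_potential_scale:
  assumes "0 < t"
  shows "riesz_potential \<beta> ((1 / t) *\<^sub>R z) = t powr (3 - \<beta>) * riesz_potential \<beta> z"
  using assms by (simp add: riesz_potential_def powr_divide)

text \<open>Counting powers of t: 3 p / 2 from each of the two densities, 3 - \<beta> from the
  homogeneity of the kernel, and -3 from each of the two integrations. The total 3 p - 3 - \<beta>
  vanishes exactly at p = (3 + \<beta>) / 3.\<close>

lemma N_functional_dilate:
  assumes t: "0 < t" and p: "p = (3 + \<beta>) / 3"
  shows "N_functional \<beta> p (dilate t u) = N_functional \<beta> p u"
proof -
  define C where "C = (t powr (3/2)) powr p"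
  define h where "h y = cmod (u y) powr p" for y
  define K where "K = riesz_potential \<beta>"
  have h: "cmod (dilate t u y) powr p = C * h (t *\<^sub>R y)" for y
    by (simp add: dilate_def h_def C_def norm_mult powr_mult)
  have conv: "convolution K (\<lambda>y. C * h (t *\<^sub>R y)) x = C * t powr (- \<beta>) * convolution K h (t *\<^sub>R x)" for x
  proof -
    have "convolution K (\<lambda>y. C * h (t *\<^sub>R y)) x = (\<integral>y. C * t powr (3 - \<beta>) * (K (t *\<^sub>R x - t *\<^sub>R y) * h (t *\<^sub>R y)) \<partial>lborel)"
      unfolding convolution_def
    proof (intro Bochner_Integration.integral_cong refl)
      fix y
      have "K (x - y) = t powr (3 - \<beta>) * K (t *\<^sub>R x - t *\<^sub>R y)"
        unfolding K_def using riesz_potential_scale[OF t, of \<beta> "t *\<^sub>R x - t *\<^sub>R y"] t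
        by (simp add: scaleR_diff_right)
      then show "K (x - y) * (C * h (t *\<^sub>R y)) = C * t powr (3 - \<beta>) * (K (t *\<^sub>R x - t *\<^sub>R y) * h (t *\<^sub>R y))"
        by (simp only: mult_ac)
    qed
    also have "\<dots> = C * t powr (3 - \<beta>) * ((1 / t ^ 3) *\<^sub>R convolution K h (t *\<^sub>R x))"
      unfolding convolution_def
      by (simp only: integral_mult_right_zero integral_dilate[OF t, of "\<lambda>z. K (t *\<^sub>R x - z) * h z"])
    also have "\<dots> = C * t powr (- \<beta>) * convolution K h (t *\<^sub>R x)"
    proof -
      have "t powr (3 - \<beta>) = t powr 3 * t powr (- \<beta>)" by (simp add: powr_add[symmetric])
      also have "t powr 3 = t ^ 3" using t by (simp add: powr_numeral)
      finally show ?thesis using t by simp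
    qed
    finally show ?thesis .
  qed
  have "N_functional \<beta> p (dilate t u) = (\<integral>x. C * t powr (- \<beta>) * C * (convolution K h (t *\<^sub>R x) * h (t *\<^sub>R x)) \<partial>lborel)"
    unfolding N_functional_def K_def[symmetric] h conv
    by (intro Bochner_Integration.integral_cong refl) (simp only: mult_ac)
  also have "\<dots> = C * t powr (- \<beta>) * C * ((1 / t ^ 3) *\<^sub>R N_functional \<beta> p u)"
    unfolding N_functional_def K_def[symmetric] h_def[symmetric]
    by (simp only: integral_mult_right_zero integral_dilate[OF t, of "\<lambda>z. convolution K h z * h z"])
  also have "\<dots> = N_functional \<beta> p u"
  proof -
    have "C * t powr (- \<beta>) * C = t powr (3/2 * p + - \<beta> + 3/2 * p)"
      by (simp only: C_def powr_powr powr_add)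
    also have "3/2 * p + - \<beta> + 3/2 * p = 3" by (simp add: p field_simps)
    also have "t powr 3 = t ^ 3" using t by (simp add: powr_numeral)
    finally show ?thesis using t by simp
  qed
  finally show ?thesis .
qed

theorem theorem1p3:
  fixes \<alpha> \<beta> p :: real
  assumes "0 < \<beta>" and "\<beta> < 3"
    and "p = (3 + \<beta>) / 3"
    and "0 \<le> \<alpha>"
  shows "\<forall>\<mu>>0. \<not> (\<exists>u. ground_state \<alpha> \<beta> p \<mu> u)"
proof (intro allI impI notI)
  fix \<mu> :: real assume \<mu>: "0 < \<mu>" and "\<exists>u. ground_state \<alpha> \<beta> p \<mu> u"
  then obtain u where u: "u \<in> X_space" "(L2_norm u)\<^sup>2 = \<mu>"
    and min: "\<And>v. v \<in> X_mass \<mu> \<Longrightarrow> energy \<alpha> \<beta> p u \<le> energy \<alpha> \<beta> p v"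
    by (auto simp: ground_state_def X_mass_def)
  obtain \<phi> q lam where d: "decomposition u \<phi> q lam" using u(1) by (auto simp: X_space_def)
  define t :: real where "t = 1 / 2"
  have t: "0 < t" by (simp add: t_def)
  have "dilate t u \<in> X_mass \<mu>"
    using decomposition_dilate[OF d t] u(2) L2_norm_dilate[OF t, of u] by (auto simp: X_mass_def X_space_def)
  from min[OF this] have "Q_form \<alpha> u \<le> Q_form \<alpha> (dilate t u)"
    unfolding energy_def N_functional_dilate[OF t assms(3)] by simp
  also have "\<dots> = t\<^sup>2 * Q_value 0 u \<phi> q lam + \<alpha> * t * (cmod q)\<^sup>2"
    by (rule Q_form_dilateate[OF d t])
  \<comment> \<open>The dilation formula at \<open>t = 1\<close> splits the form of u itself into
    the same two terms; at \<open>t = 1 / 2\<close> they carry the factors 1/4 and 1/2.\<close>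
  finally have "Q_value 0 u \<phi> q lam + \<alpha> * (cmod q)\<^sup>2 \<le> 1 / 4 * Q_value 0 u \<phi> q lam + 1 / 2 * (\<alpha> * (cmod q)\<^sup>2)"
    using Q_form_dilateate[OF d, of 1 \<alpha>] by (simp add: dilate_one t_def power2_eq_square)
  moreover have "0 < Q_value 0 u \<phi> q lam" by (rule Q_value_zero_pos[OF d u(2) \<mu>])
  moreover have "0 \<le> \<alpha> * (cmod q)\<^sup>2" using assms(4) by simp
  ultimately show False by linarith
qed

end
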